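(* Let $f:\mathbb{R}^N\to\mathbb{R}^N$ be the piecewise-linear continuous map with switching manifold $\Sigma$ given in the context, and let $\mathcal{X}$ and $\mathcal{Y}$ be words in $\{L,R\}$ of lengths $n$ and $p$. Suppose: (i) $\mathcal{X}\mathcal{Y} = (\mathcal{Y}\mathcal{X})^{\overline{0}\,\overline{\alpha}}$ for some $\alpha\in\{1,\ldots,n+p-1\}$; (ii) $M_{\mathcal{X}}$ has eigenvalues $\lambda_1,\lambda_2$ of multiplicity one such that, with $\beta$ denoting the maximum modulus of the remaining eigenvalues of $M_{\mathcal{X}}$, $0\le\beta<\lambda_2<1<\lambda_1$; and $e_1^{\mathsf T}\zeta_1\neq 0$; (iii) $c\notin\{-1,0\}$, where $$c=\det\left(\begin{bmatrix}\omega_1^{\mathsf T}\\ \omega_2^{\mathsf T}\end{bmatrix} M_{\mathcal{Y}}\begin{bmatrix}\zeta_1 & \zeta_2\end{bmatrix}\right);$$ (iv) $f_{\mathcal{Y}^{\overline{0}}}\left(E^u(x_0^{\mathcal{X}})\right)\not\subset E^s(x_0^{\mathcal{X}})$; (v) there exists $k_{\min}\ge 0$ such that for all $k\ge k_{\min}$ the map $f$ has an admissible, stable $\mathcal{X}^k\mathcal{Y}$-cycle with no points on $\Sigma$. Then the $\mathcal{X}$-cycle is admissible with $x_0^{\mathcal{X}}\notin\Sigma$, and there exists an $\mathcal{S}$-orbit $\{y_i\}_{i\in\mathbb{Z}}$ (not necessarily admissible), where $\mathcal{S}=\mathcal{X}^\infty\mathcal{Y}\mathcal{X}^\infty$, that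 is homoclinic to the $\mathcal{X}$-cycle and with $y_0=E^u(x_0^{\mathcal{X}})\cap\Sigma$ and $y_\alpha\in\Sigma$. Moreover, $\lambda_1\lambda_2=1$ and $\lambda_2\le c\le 1$. Also, $\mathcal{X}^k\mathcal{Y}^{\overline{0}}$-cycles are unique (although not necessarily admissible) for sufficiently large values of $k$ (i.e. for all sufficiently large $k$ there is exactly one $\mathcal{X}^k\mathcal{Y}^{\overline{0}}$-cycle), and $x_{kn}^{\mathcal{X}^k\mathcal{Y}^{\overline{0}}}\to y_0$ as $k\to\infty$.
   Context: **The map.** $f(x)=f_L(x)=A_Lx+b$ if $e_1^{\mathsf T}x\le 0$ and $f(x)=f_R(x)=A_Rx+b$ if $e_1^{\mathsf T}x\ge 0$, where $A_L,A_R$ are real $N\times N$ matrices, $b\in\mathbb{R}^N$, $e_i$ is the $i$-th coordinate vector of $\mathbb{R}^N$, and $A_R=A_L+\xi e_1^{\mathsf T}$ for some $\xi\in\mathbb{R}^N$ (so $f$ is continuous). $\Sigma=\{x\in\mathbb{R}^N: e_1^{\mathsf T}x=0\}$. **Words.** A word of length $m$ is $\mathcal{Z}=\mathcal{Z}_0\cdots\mathcal{Z}_{m-1}$ with $\mathcal{Z}_i\in\{L,R\}$. Juxtaposition is concatenation, and $\mathcal{X}^k\mathcal{Y}$ is $k$ copies of $\mathcal{X}$ followed by $\mathcal{Y}$. $\mathcal{Z}^{\overline{i}}$ is $\mathcal{Z}$ with the symbol $\mathcal{Z}_i$ flipped ($L\leftrightarrow R$); $\mathcal{Z}^{\overline{i}\,\overline{j}}$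 is $\mathcal{Z}$ with the symbols at indices $i$ and $j$ flipped. $\mathcal{X}^k\mathcal{Y}^{\overline{0}}$ is $k$ copies of $\mathcal{X}$ followed by $\mathcal{Y}^{\overline{0}}$. **Compositions.** For a word $\mathcal{Z}$ of length $m$: $f_{\mathcal{Z}}=f_{\mathcal{Z}_{m-1}}\circ\cdots\circ f_{\mathcal{Z}_0}$ and $M_{\mathcal{Z}}=A_{\mathcal{Z}_{m-1}}\cdots A_{\mathcal{Z}_0}$ (the linear part of the affine map $f_{\mathcal{Z}}$). **Following, cycles.** With $x_{i+1}=f(x_i)$, a point $x_0$ follows $\mathcal{Z}$ under $f$ if for all $i=0,\ldots,m-1$: $\mathcal{Z}_i=L$ whenever $e_1^{\mathsf T}x_i<0$, and $\mathcal{Z}_i=R$ whenever $e_1^{\mathsf T}x_i>0$. A $\mathcal{Z}$-cycle is an $m$-tuple $\{x_i^{\mathcal{Z}}\}_{i=0}^{m-1}$ with $f_{\mathcal{Z}_i}(x_i^{\mathcal{Z}})=x_{(i+1)\bmod m}^{\mathcal{Z}}$ for all $i$. It is admissible if $x_0^{\mathcal{Z}}$ follows $\mathcal{Z}$ under $f$ (then it is a periodic orbit of $f$). It is unique if $1$ is not an eigenvalue of $M_{\mathcal{Z}}$; in particular, under the eigenvalue condition the $\mathcal{X}$-cycle exists and is unique. An admissible $\mathcal{Z}$-cycle with no points on $\Sigma$ is regarded as stable (as a periodic solution of $f$) if and only if all eigenvalues of $M_{\mathcal{Z}}$ have modulus less than or equal to $1$. **Orbits.** $\mathcal{S}=\mathcal{X}^\infty\mathcal{Y}\mathcal{X}^\infty$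 is the bi-infinite sequence with $\mathcal{S}_i=\mathcal{X}_{i\bmod n}$ for $i<0$, $\mathcal{S}_i=\mathcal{Y}_i$ for $0\le i\le p-1$, $\mathcal{S}_i=\mathcal{X}_{(i-p)\bmod n}$ for $i\ge p$, where $i\bmod n\in\{0,\ldots,n-1\}$. An $\mathcal{S}$-orbit is a sequence $\{y_i\}_{i\in\mathbb{Z}}$ with $y_{i+1}=f_{\mathcal{S}_i}(y_i)$ for all $i\in\mathbb{Z}$. It is admissible if for all $i\in\mathbb{Z}$: $\mathcal{S}_i=L$ whenever $e_1^{\mathsf T}y_i<0$ and $\mathcal{S}_i=R$ whenever $e_1^{\mathsf T}y_i>0$. It is homoclinic to the $\mathcal{X}$-cycle if $y_i$ converges to the $\mathcal{X}$-cycle (distance to the set of its points tends to $0$) as $i\to\infty$ and as $i\to-\infty$. **Eigenvectors and invariant subspaces.** For $i=1,2$, $\omega_i^{\mathsf T}$ and $\zeta_i$ are (real) left and right eigenvectors of $M_{\mathcal{X}}$ for $\lambda_i$, normalised so that $\omega_i^{\mathsf T}\zeta_i=1$. If $N=2$, $\beta=0$. $E^u(x_0^{\mathcal{X}})$ and $E^s(x_0^{\mathcal{X}})$ are the unstable and stable manifolds of the fixed point $x_0^{\mathcal{X}}$ of the affine map $f_{\mathcal{X}}$; under the eigenvalue condition these are the line $\{x_0^{\mathcal{X}}+a\zeta_1: a\in\mathbb{R}\}$ and the hyperplane $\{x:\omega_1^{\mathsf T}(x-x_0^{\mathcal{X}})=0\}$. Since $e_1^{\mathsf T}\zeta_1\ne0$,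 $E^u(x_0^{\mathcal{X}})\cap\Sigma$ is a single point. *)

theory Defs
  imports "HOL-Analysis.Analysis" "HOL-Computational_Algebra.Polynomial"
begin

datatype symb = L | R

fun flip_symb :: "symb \<Rightarrow> symb" where
  "flip_symb L = R"
| "flip_symb R = L"

definition flip_at :: "nat \<Rightarrow> symb list \<Rightarrow> symb list" where
  "flip_at i Z = Z[i := flip_symb (Z ! i)]"

definition word_power :: "nat \<Rightarrow> symb list \<Rightarrow> symb list" where
  "word_power k X = concat (replicate k X)"

text \<open>The bi-infinite sequence \<open>X\<^sup>\<infinity> Y X\<^sup>\<infinity>\<close>, with \<open>Y\<close> occupying the indices \<open>0, \<dots>, p - 1\<close>.\<close>

definition homoclinic_seq :: "symb list \<Rightarrow> symb list \<Rightarrow> int \<Rightarrow> symb" where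
  "homoclinic_seq X Y i =
    (if i < 0 then X ! nat (i mod int (length X))
     else if i < int (length Y) then Y ! nat i
     else X ! nat ((i - int (length Y)) mod int (length X)))"

text \<open>The pair of matrices \<open>A\<^sub>L, A\<^sub>R\<close> is a function \<open>A\<close> on symbols. Vectors are indexed by an
  arbitrary finite type, which carries no canonical first element, so the distinguished coordinate
  is a parameter \<open>j\<close>: \<open>e\<^sub>1\<close> is \<open>axis j 1\<close>, and \<open>e\<^sub>1\<^sup>T x\<close> is \<open>x $ j\<close>.\<close>

definition affine_piece ::
  "(symb \<Rightarrow> real^'n^'n) \<Rightarrow> real^'n \<Rightarrow> symb \<Rightarrow> real^'n \<Rightarrow> real^'n" where
  "affine_piece A b s x = A s *v x + b"

definition pwl_map ::
  "'n \<Rightarrow> (symb \<Rightarrow> real^'n^'n) \<Rightarrow> real^'n \<Rightarrow> real^'n \<Rightarrow> real^'n" where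
  "pwl_map j A b x = (if x $ j \<le> 0 then affine_piece A b L x else affine_piece A b R x)"

definition switching_manifold :: "'n \<Rightarrow> (real^'n) set" where
  "switching_manifold j = {x. x $ j = 0}"

text \<open>\<open>Z ! 0\<close> is applied first, i.e. it is the rightmost factor of both compositions.\<close>

definition word_map ::
  "(symb \<Rightarrow> real^'n^'n) \<Rightarrow> real^'n \<Rightarrow> symb list \<Rightarrow> real^'n \<Rightarrow> real^'n" where
  "word_map A b Z x = fold (affine_piece A b) Z x"

definition word_matrix :: "(symb \<Rightarrow> real^'n^'n) \<Rightarrow> symb list \<Rightarrow> real^'n^'n" where
  "word_matrix A Z = fold (\<lambda>s M. A s ** M) Z (mat 1)"

definition cmatrix :: "real^'n^'n \<Rightarrow> complex^'n^'n" where
  "cmatrix M = (\<chi> i k. complex_of_real (M $ i $ k))"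

definition eigenvalues :: "real^'n^'n \<Rightarrow> complex set" where
  "eigenvalues M = {z. \<exists>v. v \<noteq> 0 \<and> cmatrix M *v v = z *s v}"

definition charpoly :: "'a::comm_ring_1^'n^'n \<Rightarrow> 'a poly" where
  "charpoly M = det (mat [:0, 1:] - (\<chi> i k. [:M $ i $ k:]))"

definition alg_multiplicity :: "real^'n^'n \<Rightarrow> complex \<Rightarrow> nat" where
  "alg_multiplicity M z = order z (charpoly (cmatrix M))"

text \<open>The maximum modulus of the eigenvalues other than \<open>l1\<close> and \<open>l2\<close>. This agrees with
  discarding one copy each of \<open>l1\<close> and \<open>l2\<close> from the spectrum when both have multiplicity one;
  in dimension two nothing remains and the value is \<open>0\<close> by convention.\<close>

definition remaining_modulus :: "real^'n^'n \<Rightarrow> real \<Rightarrow> real \<Rightarrow> real" where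
  "remaining_modulus M l1 l2 =
    (if CARD('n) = 2 then 0
     else Max (cmod ` (eigenvalues M - {complex_of_real l1, complex_of_real l2})))"

definition right_eigenvector :: "real^'n^'n \<Rightarrow> real \<Rightarrow> real^'n \<Rightarrow> bool" where
  "right_eigenvector M l v \<longleftrightarrow> v \<noteq> 0 \<and> M *v v = l *\<^sub>R v"

definition left_eigenvector :: "real^'n^'n \<Rightarrow> real \<Rightarrow> real^'n \<Rightarrow> bool" where
  "left_eigenvector M l w \<longleftrightarrow> w \<noteq> 0 \<and> w v* M = l *\<^sub>R w"

definition follows ::
  "'n \<Rightarrow> (symb \<Rightarrow> real^'n^'n) \<Rightarrow> real^'n \<Rightarrow> symb list \<Rightarrow> real^'n \<Rightarrow> bool" where
  "follows j A b Z x \<longleftrightarrow>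
    (\<forall>i<length Z. ((pwl_map j A b ^^ i) x $ j < 0 \<longrightarrow> Z ! i = L) \<and>
                  ((pwl_map j A b ^^ i) x $ j > 0 \<longrightarrow> Z ! i = R))"

definition is_cycle ::
  "(symb \<Rightarrow> real^'n^'n) \<Rightarrow> real^'n \<Rightarrow> symb list \<Rightarrow> (real^'n) list \<Rightarrow> bool" where
  "is_cycle A b Z xs \<longleftrightarrow> length xs = length Z \<and>
    (\<forall>i<length Z. affine_piece A b (Z ! i) (xs ! i) = xs ! (Suc i mod length Z))"

text \<open>The points \<open>x\<^sub>i\<^sup>Z\<close> of the \<open>Z\<close>-cycle; only meaningful when the \<open>Z\<close>-cycle exists and is unique.\<close>

definition the_cycle ::
  "(symb \<Rightarrow> real^'n^'n) \<Rightarrow> real^'n \<Rightarrow> symb list \<Rightarrow> (real^'n) list" where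
  "the_cycle A b Z = (THE xs. is_cycle A b Z xs)"

definition admissible_cycle ::
  "'n \<Rightarrow> (symb \<Rightarrow> real^'n^'n) \<Rightarrow> real^'n \<Rightarrow> symb list \<Rightarrow> (real^'n) list \<Rightarrow> bool" where
  "admissible_cycle j A b Z xs \<longleftrightarrow> is_cycle A b Z xs \<and> follows j A b Z (xs ! 0)"

text \<open>Stability of an admissible \<open>Z\<close>-cycle with no points on the switching manifold; here an
  eigenvalue of modulus one counts as stable.\<close>

definition stable_word :: "(symb \<Rightarrow> real^'n^'n) \<Rightarrow> symb list \<Rightarrow> bool" where
  "stable_word A Z \<longleftrightarrow> (\<forall>z\<in>eigenvalues (word_matrix A Z). cmod z \<le> 1)"

definition symbolic_orbit ::
  "(symb \<Rightarrow> real^'n^'n) \<Rightarrow> real^'n \<Rightarrow> (int \<Rightarrow> symb) \<Rightarrow> (int \<Rightarrow> real^'n) \<Rightarrow> bool" where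
  "symbolic_orbit A b S y \<longleftrightarrow> (\<forall>i. y (i + 1) = affine_piece A b (S i) (y i))"

definition homoclinic_to :: "(int \<Rightarrow> real^'n) \<Rightarrow> (real^'n) set \<Rightarrow> bool" where
  "homoclinic_to y C \<longleftrightarrow>
    ((\<lambda>i. infdist (y i) C) \<longlongrightarrow> 0) at_top \<and> ((\<lambda>i. infdist (y i) C) \<longlongrightarrow> 0) at_bot"

definition stable_manifold :: "(real^'n \<Rightarrow> real^'n) \<Rightarrow> real^'n \<Rightarrow> (real^'n) set" where
  "stable_manifold g p = {x. (\<lambda>k. (g ^^ k) x) \<longlonglongrightarrow> p}"

text \<open>Formulated with backward orbits, because \<open>g\<close> need not be invertible.\<close>

definition unstable_manifold :: "(real^'n \<Rightarrow> real^'n) \<Rightarrow> real^'n \<Rightarrow> (real^'n) set" where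
  "unstable_manifold g p = {x. \<exists>u. u 0 = x \<and> (\<forall>k::nat. g (u (Suc k)) = u k) \<and> u \<longlonglongrightarrow> p}"

end

theory Submission
  imports Defs "HOL-Complex_Analysis.Complex_Analysis"
    "HOL-Computational_Algebra.Fundamental_Theorem_Algebra"
begin

text \<open>Write \<open>F\<close>, \<open>G\<close>, \<open>G0\<close> for the affine maps of the words \<open>X\<close>, \<open>Y\<close> and of \<open>Y\<close> with its first symbol flipped,
\<open>P\<close>, \<open>Q\<close>, \<open>Q0\<close> for their linear parts, and \<open>q\<^sub>i\<^sub>k = w\<^sub>i \<bullet> Q z\<^sub>k\<close>. The point of the \<open>X\<^sup>k Y\<close>-cycle at which
\<open>Y\<close> begins is \<open>x0 + V\<close>, where \<open>V = P\<^sup>k (\<gamma> + Q V)\<close> and \<open>\<gamma> = G x0 - x0\<close>. The spectral gap turns this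
equation into an asymptotic one: \<open>P\<^sup>k = l1\<^sup>k z1 w1\<^sup>T + l2\<^sup>k T\<^sub>k\<close> with \<open>T\<^sub>k\<close> tending to \<open>z2 w2\<^sup>T\<close> (lemma
\<open>matpow_splitting\<close>), and everything follows by comparing the orders \<open>l1\<^sup>k\<close>, \<open>(l1 l2)\<^sup>k\<close> and \<open>l2\<^sup>k\<close>.

\<^bold>\<open>Stability.\<close> When all eigenvalues of \<open>Q P\<^sup>k\<close> have modulus at most one, \<open>det (I - w Q P\<^sup>k)\<close> lies between
\<open>(1 - |w|)\<^sup>N\<close> and \<open>(1 + |w|)\<^sup>N\<close> in modulus for \<open>|w| \<le> 1\<close>. By the splitting it is asymptotic to
\<open>1 - w l1\<^sup>k q\<^sub>1\<^sub>1 - w\<^sup>2 (l1 l2)\<^sup>k q\<^sub>1\<^sub>2 q\<^sub>2\<^sub>1\<close>. Hence \<open>q\<^sub>1\<^sub>1 = 0\<close>, so \<open>c = - q\<^sub>1\<^sub>2 q\<^sub>2\<^sub>1\<close>; moreover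
\<open>l1 l2 \<le> 1\<close>, and in the case of equality \<open>|c| \<le> 1\<close> (lemma \<open>multiplier_constraints\<close>).

\<^bold>\<open>Signs.\<close> As \<open>XY\<close> and \<open>YX\<close> differ at index 0, the words \<open>X\<close> and \<open>Y\<close> begin with different symbols, so the
points of the cycle where the last \<open>X\<close> and where \<open>Y\<close> begin lie on opposite sides of the switching
manifold. Asymptotically they are \<open>x0 + (a / l1) z1\<close> and \<open>x0 + a z1\<close> with the same amplitude \<open>a\<close>. If
\<open>w1 \<bullet> \<gamma>\<close> were not zero, \<open>a\<close> would grow like \<open>l1\<^sup>k\<close> and both points would lie on the same side. So
\<open>w1 \<bullet> \<gamma> = 0\<close>, and then \<open>a\<close> converges, to \<open>0\<close> if \<open>l1 l2 < 1\<close> (lemmas \<open>fixed_points_degenerate\<close> and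
\<open>alternating_fixed_points\<close>).

\<^bold>\<open>The homoclinic orbit.\<close> The two equations \<open>q\<^sub>1\<^sub>1 = 0\<close> and \<open>w1 \<bullet> \<gamma> = 0\<close> say that \<open>G\<close> maps the unstable line
into the stable hyperplane. By continuity of \<open>f\<close>, flipping one symbol changes an affine map by a fixed
vector times the distinguished coordinate of the point where the symbol is used. Since \<open>XY\<close> is \<open>YX\<close> with two
symbols flipped, the \<open>w1\<close>-components of the two corrections cancel along the unstable line, and
hypothesis (iv) says that they do not vanish identically. At \<open>y0\<close>, where the line meets the switching
manifold, the first correction vanishes, hence so does the second one: the orbit of \<open>y0\<close> is on the
manifold again at index \<open>\<alpha>\<close>, and \<open>G (F y0) = F (G y0)\<close>.

\<^bold>\<open>The numbers.\<close> If \<open>x0\<close> were on the manifold, then \<open>y0 = x0\<close> and the last identity would make \<open>G x0\<close> a fixed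
point of \<open>F\<close>, so \<open>G x0 = x0\<close>, and the \<open>X\<^sup>k Y\<close>-cycles would pass through \<open>x0\<close>, against (v). Therefore
\<open>a = 0\<close> is excluded by the signs, and \<open>l1 l2 = 1\<close>. With \<open>y0 = x0 + a0 z1\<close>, the \<open>w2\<close>-component of the same
identity gives \<open>a = a0 c (1 + l1) / (1 + c)\<close>, and the opposite signs force \<open>a / a0 \<ge> 1\<close>, which is
\<open>c \<ge> 1 / l1 = l2\<close>. Admissibility of the \<open>X\<close>-cycle passes to the limit from the middle of the
\<open>X\<^sup>k Y\<close>-cycles.

\<^bold>\<open>The flipped cycles.\<close> For \<open>Q0\<close> the entry \<open>w1 \<bullet> Q0 z1\<close> is not zero, so the order \<open>l1\<^sup>k\<close> dominates: the cycle
is unique for large \<open>k\<close>, and its amplitude converges to the solution of \<open>w1 \<bullet> (G0 (x0 + a z1) - x0) = 0\<close>,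
which is \<open>a0\<close> (lemma \<open>fixed_points_nondegenerate\<close>).\<close>

section \<open>Determinants and the pencil $I - wM$\<close>

lemma det_eq_0_iff_kernel:
  fixes B :: "'a::field^'n^'n"
  shows "det B = 0 \<longleftrightarrow> (\<exists>v. v \<noteq> 0 \<and> B *v v = 0)"
  by (metis invertible_det_nz invertible_left_inverse matrix_left_invertible_ker)

text \<open>Let \<open>S\<close> be the identity matrix with one row \<open>m\<close> replaced by \<open>v\<close>, where \<open>v $ m\<close> is not zero. Then
\<open>v\<^sup>T = e\<^sub>m\<^sup>T S\<close>, so \<open>S (I + u v\<^sup>T) = (I + (S u) e\<^sub>m\<^sup>T) S\<close>, and \<open>I + (S u) e\<^sub>m\<^sup>T\<close> differs from the
identity only in column \<open>m\<close>. Both auxiliary determinants are instances of Cramer's lemma.\<close>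

lemma det_rank_one_update:
  fixes u v :: "'a::field^'n"
  shows "det (mat 1 + (\<chi> i k. u $ i * v $ k)) = 1 + (\<Sum>i\<in>UNIV. v $ i * u $ i)"
proof (cases "v = 0")
  case True
  have "(\<chi> i k. u $ i * v $ k) = (0 :: 'a^'n^'n)"
    using True by (simp add: vec_eq_iff)
  then show ?thesis using True by simp
next
  case False
  then obtain m where m: "v $ m \<noteq> 0" by (auto simp: vec_eq_iff)
  define S :: "'a^'n^'n" where "S = (\<chi> i. if i = m then v else axis i 1)"
  define s where "s = S *v u"
  have Sm: "S $ m = v" and Si: "\<And>i. i \<noteq> m \<Longrightarrow> S $ i = axis i 1"
    by (auto simp: S_def)
  have rows': "(\<Sum>i\<in>UNIV. v $ i *s (axis i 1 :: 'a^'n)) = v"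
    by (simp add: vec_eq_iff axis_def if_distrib [of "(*) _"] cong: if_cong)
  have rowax: "row i (mat 1 :: 'a^'n^'n) = axis i 1" for i
    by (simp add: vec_eq_iff row_def mat_def axis_def)
  have detS: "det S = v $ m"
    using cramer_lemma_transpose [where k = m and x = v and A = "mat 1 :: 'a^'n^'n"]
    unfolding rowax rows' by (simp add: S_def)
  define C :: "'a^'n^'n" where "C = (\<chi> i k. if k = m then (axis m 1 + s) $ i else mat 1 $ i $ k)"
  have "det C = (axis m 1 + s) $ m * det (mat 1 :: 'a^'n^'n)"
    unfolding C_def
    using cramer_lemma [where k = m and x = "axis m 1 + s" and A = "mat 1 :: 'a^'n^'n"]
    by (simp only: matrix_vector_mul_lid)
  then have detC: "det C = 1 + (\<Sum>i\<in>UNIV. v $ i * u $ i)"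
    by (simp add: axis_def s_def matrix_vector_mult_def Sm)
  have S1: "(\<Sum>l\<in>UNIV. mat 1 $ i $ l * S $ l $ k) = S $ i $ k" for i k
  proof -
    have "(mat 1 ** S) $ i $ k = S $ i $ k" by simp
    then show ?thesis by (simp add: matrix_matrix_mult_def)
  qed
  have "S ** (mat 1 + (\<chi> i k. u $ i * v $ k)) = C ** S"
  proof -
    have C: "C $ i $ l = mat 1 $ i $ l + (if l = m then s $ i else 0)" for i l
      by (auto simp: C_def axis_def mat_def)
    have "(C ** S) $ i $ k = S $ i $ k + s $ i * v $ k" for i k
      by (simp add: matrix_matrix_mult_def C distrib_right sum.distrib S1 Sm
          if_distrib [of "\<lambda>x. x * _"] cong: if_cong)
    moreover have "(S ** (\<chi> i k. u $ i * v $ k)) $ i $ k = s $ i * v $ k" for i k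
      by (simp add: matrix_matrix_mult_def s_def matrix_vector_mult_def sum_distrib_right mult.assoc)
    ultimately show ?thesis by (simp add: vec_eq_iff matrix_add_ldistrib)
  qed
  then have "det S * det (mat 1 + (\<chi> i k. u $ i * v $ k)) = det C * det S"
    by (metis det_mul)
  with m show ?thesis by (simp add: detS detC mult.commute)
qed

lemma poly_det:
  fixes N :: "'a::comm_ring_1 poly^'n^'n"
  shows "poly (det N) z = det (\<chi> i k. poly (N $ i $ k) z)"
  by (simp add: det_def poly_sum poly_prod poly_mult of_int_poly)

lemma degree_det_le:
  fixes N :: "'a::comm_ring_1 poly^'n^'n"
  assumes "\<And>i k. degree (N $ i $ k) \<le> 1"
  shows "degree (det N) \<le> CARD('n)"
  unfolding det_def
proof (rule degree_sum_le)
  fix p :: "'n \<Rightarrow> 'n"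
  have "degree (\<Prod>i\<in>UNIV. N $ i $ p i) \<le> (\<Sum>i\<in>UNIV. degree (N $ i $ p i))"
    using degree_prod_sum_le [of UNIV "\<lambda>i. N $ i $ p i"] by (simp add: o_def)
  also have "\<dots> \<le> (\<Sum>i\<in>(UNIV::'n set). 1)" by (rule sum_mono) (rule assms)
  finally have "degree (\<Prod>i\<in>UNIV. N $ i $ p i) \<le> CARD('n)" by simp
  moreover have "degree (of_int (sign p) * (\<Prod>i\<in>UNIV. N $ i $ p i))
      \<le> degree (of_int (sign p) :: 'a poly) + degree (\<Prod>i\<in>UNIV. N $ i $ p i)"
    by (rule degree_mult_le)
  ultimately show "degree (of_int (sign p) * (\<Prod>i\<in>UNIV. N $ i $ p i)) \<le> CARD('n)"
    by simp
qed simp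

text \<open>The determinant of \<open>I - w M\<close> is used instead of the characteristic polynomial: its value at \<open>w = 0\<close> is
\<open>1\<close>, and the reciprocals of its roots are eigenvalues of \<open>M\<close>.\<close>

definition pencil :: "'a::comm_ring_1^'n^'n \<Rightarrow> 'a \<Rightarrow> 'a^'n^'n" where
  "pencil M w = mat 1 - map_matrix ((*) w) M"

lemma pencil_mult_vec: "pencil M w *v v = v - w *s (M *v v)"
proof -
  have "map_matrix ((*) w) M *v v = w *s (M *v v)"
    by (simp add: vec_eq_iff matrix_vector_mult_def sum_distrib_left mult.assoc)
  then show ?thesis by (simp add: pencil_def matrix_vector_mult_diff_rdistrib)
qed

lemma det_pencil_poly:
  fixes M :: "'a::comm_ring_1^'n^'n"
  obtains p where "degree p \<le> CARD('n)" "\<And>w. poly p w = det (pencil M w)"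
proof
  let ?N = "(\<chi> i k. [: mat 1 $ i $ k, - M $ i $ k :]) :: 'a poly^'n^'n"
  show "degree (det ?N) \<le> CARD('n)"
    by (rule degree_det_le) simp
  show "poly (det ?N) w = det (pencil M w)" for w
    by (simp add: poly_det pencil_def, rule arg_cong [where f = det], simp add: vec_eq_iff)
qed

lemma det_pencil_eq_0:
  fixes M :: "'a::field^'n^'n"
  assumes "det (pencil M w) = 0"
  obtains v where "w \<noteq> 0" "v \<noteq> 0" "M *v v = (1 / w) *s v"
proof -
  obtain v where v: "v \<noteq> 0" "v = w *s (M *v v)"
    using assms by (auto simp: det_eq_0_iff_kernel pencil_mult_vec)
  have w: "w \<noteq> 0" using v by (metis vector_smult_lzero)
  have "(1 / w) *s v = (1 / w) *s (w *s (M *v v))" using v(2) by simp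
  also have "\<dots> = M *v v" using w by (simp add: vector_smult_assoc)
  finally show ?thesis using that w v(1) by simp
qed

text \<open>Each root \<open>z\<close> contributes the factor \<open>1 - w / z\<close>, whose modulus is between \<open>1 - |w|\<close> and \<open>1 + |w|\<close>
when \<open>|z| \<ge> 1\<close>. The proof splits off one root at a time.\<close>

lemma norm_poly_bounds_of_large_roots:
  fixes p :: "complex poly"
  assumes "\<And>z. poly p z = 0 \<Longrightarrow> 1 \<le> norm z"
  shows "norm w \<le> 1 \<Longrightarrow> (1 - norm w) ^ degree p * norm (poly p 0) \<le> norm (poly p w)"
    and "norm (poly p w) \<le> (1 + norm w) ^ degree p * norm (poly p 0)"
proof -
  have "(norm w \<le> 1 \<longrightarrow> (1 - norm w) ^ d * norm (poly p 0) \<le> norm (poly p w)) \<and>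
    norm (poly p w) \<le> (1 + norm w) ^ d * norm (poly p 0)"
    if "degree p = d" "\<And>z. poly p z = 0 \<Longrightarrow> 1 \<le> norm z" for d p
    using that
  proof (induction d arbitrary: p)
    case 0
    then obtain a where "p = [:a:]" by (metis degree_eq_zeroE)
    then show ?case by simp
  next
    case (Suc d)
    then have "\<not> constant (poly p)" by (simp add: constant_degree)
    then obtain z where z: "poly p z = 0" using fundamental_theorem_of_algebra by blast
    then obtain q where q: "p = [:-z, 1:] * q" by (metis dvdE poly_eq_0_iff_dvd)
    have "q \<noteq> 0" using Suc.prems(1) q by auto
    then have "degree p = degree [:-z, 1:] + degree q" unfolding q by (intro degree_mult_eq) auto
    then have dq: "degree q = d" using Suc.prems(1) by simp
    have IH: "(norm w \<le> 1 \<longrightarrow> (1 - norm w) ^ d * norm (poly q 0) \<le> norm (poly q w)) \<and>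
        norm (poly q w) \<le> (1 + norm w) ^ d * norm (poly q 0)"
      by (rule Suc.IH [OF dq]) (rule Suc.prems(2), simp add: q)
    have z1: "1 \<le> norm z" using Suc.prems(2) z by blast
    have up: "norm (w - z) \<le> (1 + norm w) * norm z"
    proof -
      have "norm (w - z) \<le> norm w + norm z" by (rule norm_triangle_ineq4)
      moreover have "norm w * 1 \<le> norm w * norm z" by (rule mult_left_mono [OF z1]) simp
      ultimately show ?thesis by (simp add: algebra_simps)
    qed
    have lo: "(1 - norm w) * norm z \<le> norm (w - z)"
    proof -
      have "norm z - norm w \<le> norm (w - z)" by (metis norm_minus_commute norm_triangle_ineq2)
      moreover have "norm w * 1 \<le> norm w * norm z" by (rule mult_left_mono [OF z1]) simp
      ultimately show ?thesis by (simp add: algebra_simps)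
    qed
    have pw: "norm (poly p w) = norm (w - z) * norm (poly q w)"
      by (simp add: q norm_mult [symmetric] algebra_simps)
    have p0: "norm (poly p 0) = norm z * norm (poly q 0)"
      by (simp add: q norm_mult)
    have "norm (poly p w) \<le> ((1 + norm w) * norm z) * ((1 + norm w) ^ d * norm (poly q 0))"
      unfolding pw by (rule mult_mono) (use up IH in auto)
    moreover have "((1 - norm w) * norm z) * ((1 - norm w) ^ d * norm (poly q 0)) \<le> norm (poly p w)"
      if "norm w \<le> 1"
      unfolding pw by (rule mult_mono) (use lo IH that in auto)
    ultimately show ?case by (auto simp: p0 algebra_simps)
  qed
  then show "norm w \<le> 1 \<Longrightarrow> (1 - norm w) ^ degree p * norm (poly p 0) \<le> norm (poly p w)"
    and "norm (poly p w) \<le> (1 + norm w) ^ degree p * norm (poly p 0)"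
    using assms by blast+
qed

text \<open>These bounds are all that is extracted from the stability of a cycle. They are uniform over all stable
matrices, so they survive the limit of long cycles.\<close>

lemma det_pencil_bounds:
  fixes M :: "complex^'n^'n"
  assumes ev: "\<And>z v. v \<noteq> 0 \<Longrightarrow> M *v v = z *s v \<Longrightarrow> norm z \<le> 1"
  shows "norm w \<le> 1 \<Longrightarrow> (1 - norm w) ^ CARD('n) \<le> norm (det (pencil M w))"
    and "norm (det (pencil M w)) \<le> (1 + norm w) ^ CARD('n)"
proof -
  obtain p where p: "degree p \<le> CARD('n)" "\<And>w. poly p w = det (pencil M w)"
    using det_pencil_poly [of M] by blast
  have root: "1 \<le> norm z" if z: "poly p z = 0" for z
  proof -
    obtain v where v: "z \<noteq> 0" "v \<noteq> 0" "M *v v = (1 / z) *s v"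
      using det_pencil_eq_0 z unfolding p(2) by blast
    then have "norm (1 / z) \<le> 1" using ev by blast
    then show ?thesis using v(1) by (simp add: norm_divide divide_simps)
  qed
  have p0: "poly p 0 = 1" by (simp add: p(2) pencil_def)
      (metis (no_types, lifting) det_I diff_zero map_matrix_def mult_zero_left vec_lambda_eta zero_index vec_eq_iff nth_map_matrix)
  show "(1 - norm w) ^ CARD('n) \<le> norm (det (pencil M w))" if w: "norm w \<le> 1"
  proof -
    have "(1 - norm w) ^ CARD('n) \<le> (1 - norm w) ^ degree p"
      by (rule power_decreasing) (use p(1) w in auto)
    then show ?thesis
      using norm_poly_bounds_of_large_roots(1) [of p w] root w p0 by (fastforce simp: p(2))
  qed
  have "(1 + norm w) ^ degree p \<le> (1 + norm w) ^ CARD('n)"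
    by (rule power_increasing) (use p(1) in auto)
  then show "norm (det (pencil M w)) \<le> (1 + norm w) ^ CARD('n)"
    using norm_poly_bounds_of_large_roots(2) [of p w] root p0 by (fastforce simp: p(2))
qed

section \<open>Limits of matrices and decay of matrix powers\<close>

lemma tendsto_matrix_vector_mult [tendsto_intros]:
  fixes M :: "'b \<Rightarrow> 'a::real_normed_field^'n^'m"
  assumes "(M \<longlongrightarrow> M0) F" "(v \<longlongrightarrow> v0) F"
  shows "((\<lambda>k. M k *v v k) \<longlongrightarrow> M0 *v v0) F"
  unfolding matrix_vector_mult_def by (intro tendsto_intros assms)

lemma tendsto_matrix_mult [tendsto_intros]:
  fixes M :: "'b \<Rightarrow> 'a::real_normed_field^'n^'m" and N :: "'b \<Rightarrow> 'a^'l^'n"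
  assumes "(M \<longlongrightarrow> M0) F" "(N \<longlongrightarrow> N0) F"
  shows "((\<lambda>k. M k ** N k) \<longlongrightarrow> M0 ** N0) F"
  unfolding matrix_matrix_mult_def by (intro tendsto_intros assms)

lemma tendsto_map_matrix_mult [tendsto_intros]:
  fixes M :: "'b \<Rightarrow> 'a::real_normed_field^'n^'m"
  assumes "(M \<longlongrightarrow> M0) F" "(e \<longlongrightarrow> e0) F"
  shows "((\<lambda>k. map_matrix ((*) (e k)) (M k)) \<longlongrightarrow> map_matrix ((*) e0) M0) F"
  unfolding map_matrix_def by (intro tendsto_intros assms)

lemma tendsto_det:
  fixes M :: "'b \<Rightarrow> 'a::real_normed_field^'n^'n"
  assumes "(M \<longlongrightarrow> M0) F"
  shows "((\<lambda>k. det (M k)) \<longlongrightarrow> det M0) F"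
  unfolding det_def by (intro tendsto_intros assms)

lemma matrix_inv_right: "invertible M \<Longrightarrow> M ** matrix_inv M = mat 1"
  and matrix_inv_left: "invertible M \<Longrightarrow> matrix_inv M ** M = mat 1"
  using someI_ex [of "\<lambda>B. M ** B = mat 1 \<and> B ** M = mat 1"]
  by (auto simp: invertible_def matrix_inv_def)

text \<open>By Cramer's rule the entries of an inverse are quotients of determinants, hence continuous functions of
the matrix near the identity.\<close>

lemma tendsto_matrix_inv_mat_1:
  fixes B :: "nat \<Rightarrow> 'a::real_normed_field^'n^'n"
  assumes B: "B \<longlonglongrightarrow> mat 1"
  shows "eventually (\<lambda>k. invertible (B k)) sequentially"
    and "(\<lambda>k. matrix_inv (B k)) \<longlonglongrightarrow> mat 1"
proof -
  have d: "(\<lambda>k. det (B k)) \<longlonglongrightarrow> 1"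
    using tendsto_det [OF B] by simp
  then have d0: "eventually (\<lambda>k. det (B k) \<noteq> 0) sequentially"
    by (rule tendsto_imp_eventually_ne) simp
  then show "eventually (\<lambda>k. invertible (B k)) sequentially"
    by (simp add: invertible_det_nz)
  define c where "c M i l = (\<chi> a m. if m = i then axis l 1 $ a else M $ a $ m)"
    for M :: "'a^'n^'n" and i l
  have entry: "matrix_inv M $ i $ l = det (c M i l) / det M" if "det M \<noteq> 0"
    for M :: "'a^'n^'n" and i l
  proof -
    have "M *v (matrix_inv M *v axis l 1) = axis l 1"
      using that by (simp add: matrix_vector_mul_assoc matrix_inv_right invertible_det_nz)
    then have "(matrix_inv M *v axis l 1) $ i = det (c M i l) / det M"
      unfolding cramer [OF that] c_def by simp
    moreover have "(matrix_inv M *v axis l 1) $ i = matrix_inv M $ i $ l"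
      by (simp add: matrix_vector_mult_def axis_def if_distrib [of "(*) _"] cong: if_cong)
    ultimately show ?thesis by simp
  qed
  show "(\<lambda>k. matrix_inv (B k)) \<longlonglongrightarrow> mat 1"
  proof (intro vec_tendstoI)
    fix i l
    have cB: "(\<lambda>k. c (B k) i l) \<longlonglongrightarrow> c (mat 1) i l"
      unfolding c_def
    proof (intro tendsto_vec_lambda)
      fix a m
      show "(\<lambda>k. if m = i then axis l 1 $ a else B k $ a $ m)
          \<longlonglongrightarrow> (if m = i then axis l 1 $ a else mat 1 $ a $ m)"
        by (cases "m = i") (simp_all add: tendsto_vec_nth B)
    qed
    have "det (c (mat 1) i l) = (mat 1 :: 'a^'n^'n) $ i $ l"
      unfolding c_def
      using cramer_lemma [where A = "mat 1 :: 'a^'n^'n" and x = "axis l 1" and k = i]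
      by (simp only: matrix_vector_mul_lid det_I mult_1_right) (simp add: axis_def mat_def)
    then have "(\<lambda>k. det (c (B k) i l) / det (B k)) \<longlonglongrightarrow> mat 1 $ i $ l"
      using tendsto_divide [OF tendsto_det [OF cB] d] by simp
    then show "(\<lambda>k. matrix_inv (B k) $ i $ l) \<longlonglongrightarrow> mat 1 $ i $ l"
      by (rule Lim_transform_eventually) (use d0 entry in \<open>auto elim: eventually_mono\<close>)
  qed
qed

primrec matpow :: "'a::semiring_1^'n^'n \<Rightarrow> nat \<Rightarrow> 'a^'n^'n" where
  "matpow M 0 = mat 1"
| "matpow M (Suc k) = M ** matpow M k"

text \<open>The generating function of column \<open>l\<close> of \<open>M\<^sup>k\<close> is the solution \<open>H\<close> of \<open>(I - z M) H(z) = e\<^sub>l\<close>. Cramer's rule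
makes it holomorphic as long as \<open>1 / z\<close> is no eigenvalue, in particular on a disc of radius larger than
\<open>1 / \<rho>\<close>. Its power series therefore converges at \<open>1 / \<rho>\<close>, and comparing coefficients in the equation
identifies the coefficients with the entries of the powers.\<close>

lemma matpow_entry_decay:
  fixes M :: "complex^'n^'n"
  assumes ev: "\<And>z v. v \<noteq> 0 \<Longrightarrow> M *v v = z *s v \<Longrightarrow> norm z \<le> \<beta>"
    and \<rho>: "0 \<le> \<beta>" "\<beta> < \<rho>"
  shows "(\<lambda>k. matpow M k $ i $ l / of_real \<rho> ^ k) \<longlonglongrightarrow> 0"
proof -
  \<comment> \<open>The reciprocal of the mean of \<open>\<beta>\<close> and \<open>\<rho>\<close>, so that \<open>1 / \<rho> < r\<close> and \<open>\<beta> r < 1\<close>.\<close>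
  define r where "r = 2 / (\<beta> + \<rho>)"
  have r: "0 < r" "\<beta> * r < 1" "1 / \<rho> < r"
    using \<rho> by (simp_all add: r_def field_simps)
  have nz: "det (pencil M z) \<noteq> 0" if z: "norm z < r" for z
  proof
    assume "det (pencil M z) = 0"
    then obtain v where v: "z \<noteq> 0" "v \<noteq> 0" "M *v v = (1 / z) *s v"
      by (rule det_pencil_eq_0)
    then have "norm (1 / z) \<le> \<beta>" using ev by blast
    then have "1 \<le> \<beta> * norm z" using v(1) by (simp add: norm_divide divide_simps)
    also have "\<dots> \<le> \<beta> * r" using z \<rho> by (intro mult_left_mono) auto
    finally show False using r by simp
  qed
  define H where "H m z = det (\<chi> a b. if b = m then axis l 1 $ a else pencil M z $ a $ b)
      / det (pencil M z)" for m z
  have H_eq: "H m z = axis l 1 $ m + z * (\<Sum>b\<in>UNIV. M $ m $ b * H b z)" if "norm z < r" for m z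
  proof -
    have "pencil M z *v (\<chi> m. H m z) = axis l 1"
      using cramer [OF nz [OF that]] unfolding H_def by blast
    then have "((\<chi> m. H m z) - z *s (M *v (\<chi> m. H m z))) $ m = axis l 1 $ m"
      unfolding pencil_mult_vec by simp
    then show ?thesis
      by (simp add: matrix_vector_mult_def algebra_simps)
  qed
  have det_holo: "(\<lambda>z. det (N z)) holomorphic_on S"
    if "\<And>a b. (\<lambda>z. N z $ a $ b) holomorphic_on S" for N :: "complex \<Rightarrow> complex^'n^'n" and S
    unfolding det_def by (intro holomorphic_intros that)
  have pencil_holo: "(\<lambda>z. pencil M z $ a $ b) holomorphic_on S" for a b S
    unfolding pencil_def by (simp, intro holomorphic_intros)
  have H_holo: "H m holomorphic_on ball 0 r" for m
  proof -
    have "(\<lambda>z. (\<chi> a b. if b = m then axis l 1 $ a else pencil M z $ a $ b) $ a $ b)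
        holomorphic_on ball 0 r" for a b
      by (cases "b = m") (simp_all add: pencil_holo)
    then show ?thesis
      unfolding H_def [abs_def]
      by (intro holomorphic_on_divide det_holo pencil_holo) (auto simp: nz)
  qed
  define F where "F m = fps_expansion (H m) 0" for m
  have F: "H m has_fps_expansion F m" for m
    unfolding F_def by (rule has_fps_expansion_fps_expansion [OF _ _ H_holo]) (use r in auto)
  have nhd: "eventually (\<lambda>z. z \<in> ball (0::complex) r) (nhds 0)"
    using r by (intro eventually_nhds_in_open) auto
  have F_eq: "F m = fps_const (axis l 1 $ m) + fps_X * (\<Sum>b\<in>UNIV. fps_const (M $ m $ b) * F b)" for m
  proof -
    let ?G = "fps_const (axis l 1 $ m) + fps_X * (\<Sum>b\<in>UNIV. fps_const (M $ m $ b) * F b)"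
    have "(\<lambda>z. axis l 1 $ m + z * (\<Sum>b\<in>UNIV. M $ m $ b * H b z)) has_fps_expansion ?G"
      by (intro fps_expansion_intros F)
    moreover have "eventually (\<lambda>z. axis l 1 $ m + z * (\<Sum>b\<in>UNIV. M $ m $ b * H b z) = H m z) (nhds 0)"
      using nhd by eventually_elim (simp add: H_eq [symmetric])
    ultimately have "H m has_fps_expansion ?G"
      by (auto simp: has_fps_expansion_def elim: eventually_elim2)
    then show ?thesis
      using F [of m] by (intro fps_ext) (simp only: fps_nth_fps_expansion)
  qed
  have coeff: "fps_nth (F m) k = matpow M k $ m $ l" for m k
  proof (induction k arbitrary: m)
    case 0
    show ?case by (subst F_eq) (simp add: axis_def mat_def)
  next
    case (Suc k)
    show ?case
      by (subst F_eq) (simp add: fps_sum_nth Suc.IH matrix_matrix_mult_def)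
  qed
  have "fps_conv_radius (F i) \<ge> ereal r"
    unfolding F_def by (rule conv_radius_fps_expansion) (simp add: H_holo)
  moreover have "ereal (norm (1 / of_real \<rho> :: complex)) < ereal r"
    using r \<rho> by (simp add: norm_divide)
  ultimately have "summable (\<lambda>k. fps_nth (F i) k * (1 / of_real \<rho>) ^ k)"
    by (intro summable_fps) (meson less_le_trans)
  then have "(\<lambda>k. fps_nth (F i) k * (1 / of_real \<rho>) ^ k) \<longlonglongrightarrow> 0"
    by (rule summable_LIMSEQ_zero)
  then show ?thesis by (simp add: coeff power_divide)
qed

section \<open>Simple eigenvalues and the splitting of matrix powers\<close>

definition outer :: "'a::comm_ring_1^'n \<Rightarrow> 'a^'m \<Rightarrow> 'a^'m^'n" where
  "outer u v = (\<chi> i k. u $ i * v $ k)"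

definition pairing :: "'a::comm_ring_1^'n \<Rightarrow> 'a^'n \<Rightarrow> 'a" where
  "pairing u v = (\<Sum>i\<in>UNIV. u $ i * v $ i)"

lemma outer_mult_vec: "outer u v *v x = pairing v x *s u"
proof -
  have "(\<Sum>k\<in>UNIV. u $ i * v $ k * x $ k) = (\<Sum>k\<in>UNIV. v $ k * x $ k) * u $ i" for i
    unfolding sum_distrib_right by (rule sum.cong) (simp_all add: mult_ac)
  then show ?thesis
    by (simp add: vec_eq_iff outer_def pairing_def matrix_vector_mult_def)
qed

lemma outer_mult_vec_real: "outer u v *v x = (v \<bullet> x) *\<^sub>R (u :: real^'n)"
  by (simp add: outer_mult_vec pairing_def inner_vec_def scalar_mult_eq_scaleR)

lemma mult_outer: "M ** outer u v = outer (M *v u) v"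
  by (simp add: vec_eq_iff outer_def matrix_matrix_mult_def matrix_vector_mult_def sum_distrib_right mult.assoc)

lemma outer_mult: "outer u v ** M = outer u (v v* M)"
  by (simp add: vec_eq_iff outer_def matrix_matrix_mult_def vector_matrix_mult_def sum_distrib_left mult.assoc)

lemma outer_scaleR: "outer (c *\<^sub>R u) v = c *\<^sub>R outer u (v :: real^'n)" 
  "outer u (c *\<^sub>R v) = c *\<^sub>R outer u (v :: real^'n)" "outer u (0 :: real^'n) = 0"
  by (simp_all add: vec_eq_iff outer_def)

lemma scaleR_matrix_mult: "(c *\<^sub>R M) ** N = c *\<^sub>R (M ** (N :: real^'l^'n) :: real^'l^'m)"
  and matrix_mult_scaleR: "M ** (c *\<^sub>R N) = c *\<^sub>R (M ** N)"
  by (simp_all add: vec_eq_iff matrix_matrix_mult_def sum_distrib_left algebra_simps)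

lemma matrix_diff_ldistrib: "M ** (N - K) = M ** N - M ** (K :: 'a::ring_1^'l^'n)"
  and matrix_add_rdistrib: "(N' + K') ** N = N' ** N + K' ** (N :: 'a::ring_1^'l^'n)"
  by (simp_all add: vec_eq_iff matrix_matrix_mult_def algebra_simps sum_subtractf sum.distrib)

lemma det_mat_1_minus_outer: "det (mat 1 - outer u v) = 1 - pairing v (u :: 'a::field^'n)"
proof -
  have "mat 1 - outer u v = mat 1 + (\<chi> i k. (- u) $ i * v $ k)"
    by (simp add: vec_eq_iff outer_def)
  then have "det (mat 1 - outer u v) = 1 + (\<Sum>i\<in>UNIV. v $ i * (- u) $ i)"
    using det_rank_one_update [of "- u" v] by (rule subst [OF sym])
  then show ?thesis
    by (simp add: pairing_def sum_negf)
qed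

definition cvec :: "real^'n \<Rightarrow> complex^'n" where
  "cvec v = (\<chi> i. complex_of_real (v $ i))"

lemma cmatrix_mult: "cmatrix (M ** N) = cmatrix M ** cmatrix N"
  by (simp add: vec_eq_iff cmatrix_def matrix_matrix_mult_def)

lemma cmatrix_mat_1: "cmatrix (mat 1) = mat 1"
  by (simp add: vec_eq_iff cmatrix_def mat_def)

lemma cmatrix_matpow: "cmatrix (matpow M k) = matpow (cmatrix M) k"
  by (induction k) (simp_all add: cmatrix_mult cmatrix_mat_1)

lemma cmatrix_mult_cvec: "cmatrix M *v cvec v = cvec (M *v v)"
  by (simp add: vec_eq_iff cmatrix_def cvec_def matrix_vector_mult_def)

lemma pairing_cvec: "pairing (cvec u) (cvec v) = of_real (u \<bullet> v)"
  by (simp add: pairing_def cvec_def inner_vec_def)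

lemma tendsto_cmatrix:
  fixes M :: "nat \<Rightarrow> real^'m^'m"
  assumes "M \<longlonglongrightarrow> M0" shows "(\<lambda>k. cmatrix (M k)) \<longlonglongrightarrow> cmatrix M0"
  unfolding cmatrix_def by (intro tendsto_intros assms)

lemma tendsto_pairing:
  fixes v :: "nat \<Rightarrow> complex^'m"
  assumes "v \<longlonglongrightarrow> v0" shows "(\<lambda>k. pairing u (v k)) \<longlonglongrightarrow> pairing u v0"
  unfolding pairing_def by (intro tendsto_intros assms)

lemma poly_charpoly: "poly (charpoly M) z = det (mat z - M)"
  unfolding charpoly_def poly_det
  by (rule arg_cong [where f = det]) (simp add: vec_eq_iff mat_def)

lemma degree_charpoly_le: "degree (charpoly (M :: 'a::comm_ring_1^'n^'n)) \<le> CARD('n)"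
  unfolding charpoly_def by (rule degree_det_le) (simp add: mat_def)

lemma mat_mult_vec: "mat z *v v = z *s (v :: 'a::comm_semiring_1^'n)"
  by (simp add: vec_eq_iff mat_def matrix_vector_mult_def if_distrib [of "\<lambda>x. x * _"] cong: if_cong)

lemma charpoly_root_iff:
  fixes M :: "'a::field^'n^'n"
  shows "poly (charpoly M) z = 0 \<longleftrightarrow> (\<exists>v. v \<noteq> 0 \<and> M *v v = z *s v)"
  by (auto simp: poly_charpoly det_eq_0_iff_kernel matrix_vector_mult_diff_rdistrib mat_mult_vec)

text \<open>The pencil has determinant \<open>1\<close> at \<open>0\<close>, so its determinant is also nonzero at some \<open>w \<noteq> 0\<close>, and then
\<open>1 / w\<close> is not a root of the characteristic polynomial.\<close>

lemma charpoly_nonzero: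
  fixes M :: "complex^'n^'n"
  shows "charpoly M \<noteq> 0"
proof
  assume c: "charpoly M = 0"
  obtain p where p: "\<And>w. poly p w = det (pencil M w)" using det_pencil_poly [of M] by blast
  have "pencil M 0 = mat 1" by (simp add: pencil_def vec_eq_iff)
  then have "poly p 0 \<noteq> 0" by (simp add: p)
  then have "p \<noteq> 0" by auto
  then have "finite (insert 0 {w. poly p w = 0})" by (simp add: poly_roots_finite)
  then obtain w where w: "w \<notin> insert 0 {w. poly p w = 0}"
    using ex_new_if_finite [OF infinite_UNIV_char_0] by blast
  obtain v where v: "v \<noteq> 0" "M *v v = (1 / w) *s v"
    using c charpoly_root_iff [of M "1 / w"] by auto
  then have "pencil M w *v v = 0" using w by (simp add: pencil_mult_vec)
  then have "det (pencil M w) = 0" using v(1) det_eq_0_iff_kernel by blast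
  then show False using w by (simp add: p)
qed

text \<open>Deflation: subtracting \<open>l u w\<^sup>T\<close> from \<open>M\<close> moves one copy of the eigenvalue \<open>l\<close> to \<open>0\<close>, that is, it replaces the
characteristic polynomial \<open>(x - l) q(x)\<close> by \<open>x q(x)\<close>. As \<open>l\<close> is a simple root, \<open>q(l)\<close> is not zero, so \<open>l\<close> is not
an eigenvalue of the deflated matrix. But \<open>v\<close> would be an eigenvector of it.\<close>

lemma simple_eigenvalue_kernel_transversal:
  fixes M :: "complex^'n^'n"
  assumes ord: "order l (charpoly M) = 1"
    and u: "M *v u = l *s u" and wu: "pairing w u = 1" and l: "l \<noteq> 0"
    and v: "M *v v = l *s v" and wv: "pairing w v = 0"
  shows "v = 0"
proof (rule ccontr)
  assume v0: "v \<noteq> 0"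
  define D where "D = M - outer (l *s u) w"
  have Dv: "D *v v = l *s v"
    by (simp add: D_def matrix_vector_mult_diff_rdistrib outer_mult_vec wv v)
  obtain q where q: "charpoly M = [:- l, 1:] ^ order l (charpoly M) * q" "\<not> [:- l, 1:] dvd q"
    using order_decomp [OF charpoly_nonzero] by blast
  have q': "poly (charpoly M) z = (z - l) * poly q z" for z
    by (subst q(1) [unfolded ord power_one_right]) (simp add: algebra_simps)
  have ql: "poly q l \<noteq> 0" using q(2) by (simp add: poly_eq_0_iff_dvd)
  have "(z - l) * poly (charpoly D) z = (z - l) * (z * poly q z)" for z
  proof (cases "z = l")
    case False
    define t where "t = l / (z - l)"
    have t: "t * (z - l) = l" "1 + t = z / (z - l)" using False by (simp_all add: t_def field_simps)
    have "mat z - D = (mat z - M) ** (mat 1 - outer (- t *s u) w)"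
    proof -
      have "(mat z - M) *v (- t *s u) = z *s (- t *s u) - (- t) *s (l *s u)"
        by (simp only: matrix_vector_mult_diff_rdistrib mat_mult_vec vector_scalar_commute u)
          (simp add: vec_eq_iff algebra_simps)
      also have "\<dots> = - ((t * (z - l)) *s u)"
        by (simp add: vec_eq_iff algebra_simps)
      finally have "(mat z - M) *v (- t *s u) = - (l *s u)" by (simp only: t(1))
      then show ?thesis
        by (simp add: matrix_diff_ldistrib mult_outer D_def) (simp add: vec_eq_iff outer_def)
    qed
    then have "poly (charpoly D) z = poly (charpoly M) z * (1 - pairing w (- t *s u))"
      by (simp add: poly_charpoly det_mul det_mat_1_minus_outer)
    also have "pairing w (- t *s u) = - t * pairing w u"
      by (simp add: pairing_def sum_distrib_left sum_negf algebra_simps)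
    finally show ?thesis using False by (simp add: wu t(2) q')
  qed simp
  moreover have "poly ([:- l, 1:] * r) z = (z - l) * poly r z" "poly ([:0, 1:] * r) z = z * poly r z"
    for r z by (simp_all add: algebra_simps)
  ultimately have "poly ([:- l, 1:] * charpoly D) = poly ([:- l, 1:] * ([:0, 1:] * q))"
    by (intro ext) (simp only:)
  then have "[:- l, 1:] * charpoly D = [:- l, 1:] * ([:0, 1:] * q)"
    by (simp only: poly_eq_poly_eq_iff)
  then have "charpoly D = [:0, 1:] * q" by (simp only: mult_cancel_left) auto
  then have "poly (charpoly D) l \<noteq> 0" using l ql by simp
  with Dv v0 show False by (auto simp: charpoly_root_iff)
qed

lemma eigenvalues_eq_roots: "eigenvalues M = {z. poly (charpoly (cmatrix M)) z = 0}"
  by (simp add: eigenvalues_def charpoly_root_iff)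

text \<open>In dimension two \<open>remaining_modulus\<close> is \<open>0\<close> by convention; a third eigenvalue would exceed the degree of
the characteristic polynomial.\<close>

lemma remaining_eigenvalue_bound:
  fixes M :: "real^'n^'n"
  assumes "complex_of_real l1 \<in> eigenvalues M" "complex_of_real l2 \<in> eigenvalues M" "l1 \<noteq> l2"
    and z: "z \<in> eigenvalues M" "z \<noteq> of_real l1" "z \<noteq> of_real l2"
  shows "cmod z \<le> remaining_modulus M l1 l2"
proof -
  have fin: "finite (eigenvalues M)"
    unfolding eigenvalues_eq_roots by (rule poly_roots_finite) (rule charpoly_nonzero)
  have "CARD('n) \<noteq> 2"
  proof
    assume two: "CARD('n) = 2"
    have "card {complex_of_real l1, of_real l2, z} \<le> card (eigenvalues M)"
      using assms by (intro card_mono fin) auto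
    also have "\<dots> \<le> degree (charpoly (cmatrix M))"
      unfolding eigenvalues_eq_roots by (rule card_poly_roots_bound) (rule charpoly_nonzero)
    also have "\<dots> \<le> 2" using degree_charpoly_le [of "cmatrix M"] two by simp
    finally show False using assms by simp
  qed
  then show ?thesis
    using fin z by (auto simp: remaining_modulus_def)
qed

text \<open>Let \<open>D = P - l1 z1 w1\<^sup>T - l2 z2 w2\<^sup>T\<close>. Left and right eigenvectors for different eigenvalues are
orthogonal, hence \<open>w1\<close> and \<open>w2\<close> annihilate \<open>D\<close> from the left and
\<open>P\<^sup>k = l1\<^sup>k z1 w1\<^sup>T + l2\<^sup>k z2 w2\<^sup>T + D\<^sup>k\<close> for \<open>k \<ge> 1\<close>. An eigenvector of \<open>D\<close> for a nonzero eigenvalue is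
orthogonal to \<open>w1\<close> and \<open>w2\<close>, so it is an eigenvector of \<open>P\<close>, and its eigenvalue is neither \<open>l1\<close> nor \<open>l2\<close>
because these are simple. Thus the eigenvalues of \<open>D\<close> are at most the remaining modulus, which is below
\<open>l2\<close>, and \<open>D\<^sup>k\<close> is negligible against \<open>l2\<^sup>k\<close>.\<close>

lemma matpow_splitting:
  fixes P :: "real^'n^'n"
  assumes ev: "complex_of_real l1 \<in> eigenvalues P" "complex_of_real l2 \<in> eigenvalues P"
    and mult: "alg_multiplicity P (complex_of_real l1) = 1" "alg_multiplicity P (complex_of_real l2) = 1"
    and \<beta>: "0 \<le> remaining_modulus P l1 l2" "remaining_modulus P l1 l2 < l2" and lt: "l2 < l1"
    and vecs: "left_eigenvector P l1 w1" "right_eigenvector P l1 z1"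
      "left_eigenvector P l2 w2" "right_eigenvector P l2 z2" "w1 \<bullet> z1 = 1" "w2 \<bullet> z2 = 1"
  obtains T where "\<And>k. matpow P k = l1 ^ k *\<^sub>R outer z1 w1 + l2 ^ k *\<^sub>R T k"
    and "T \<longlonglongrightarrow> outer z2 w2"
proof -
  define \<beta> where "\<beta> = remaining_modulus P l1 l2"
  have l2: "l2 > 0" using \<beta> by simp
  have Pz: "P *v z1 = l1 *\<^sub>R z1" "P *v z2 = l2 *\<^sub>R z2"
    and wP: "w1 v* P = l1 *\<^sub>R w1" "w2 v* P = l2 *\<^sub>R w2"
    using vecs by (auto simp: left_eigenvector_def right_eigenvector_def)
  have w12: "w1 \<bullet> z2 = 0" and w21: "w2 \<bullet> z1 = 0"
    using dot_lmul_matrix [of w1 P z2] dot_lmul_matrix [of w2 P z1] lt by (auto simp: Pz wP)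
  define D where "D = P - l1 *\<^sub>R outer z1 w1 - l2 *\<^sub>R outer z2 w2"
  have w_outer: "w v* outer u v = (w \<bullet> u) *\<^sub>R v" for w u v :: "real^'n"
  proof -
    have "(\<Sum>i\<in>UNIV. u $ i * v $ k * w $ i) = (\<Sum>i\<in>UNIV. w $ i * u $ i) * v $ k" for k
      unfolding sum_distrib_right by (rule sum.cong) (simp_all add: mult_ac)
    then show ?thesis
      by (simp add: vec_eq_iff vector_matrix_mult_def outer_def inner_vec_def mult_ac)
  qed
  have wsc: "w v* (c *\<^sub>R M) = c *\<^sub>R (w v* M)" for w :: "real^'n" and c and M :: "real^'n^'n"
    by (simp add: vec_eq_iff vector_matrix_mult_def sum_distrib_left algebra_simps)
  have wD: "w1 v* D = 0" "w2 v* D = 0"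
    by (simp_all add: D_def vector_matrix_mult_diff_distrib vector_matrix_mult_diff_rdistrib
        wsc w_outer wP w12 w21 vecs)
  have split: "matpow P (Suc k) = l1 ^ Suc k *\<^sub>R outer z1 w1 + l2 ^ Suc k *\<^sub>R outer z2 w2
      + matpow D (Suc k)" for k
  proof (induction k)
    case 0
    then show ?case by (simp add: D_def)
  next
    case (Suc k)
    have "P = D + l1 *\<^sub>R outer z1 w1 + l2 *\<^sub>R outer z2 w2" by (simp add: D_def)
    then have "P ** matpow D (Suc k) = D ** matpow D (Suc k)
       + (l1 *\<^sub>R outer z1 w1) ** (D ** matpow D k) + (l2 *\<^sub>R outer z2 w2) ** (D ** matpow D k)"
      by (metis matpow.simps(2) matrix_add_rdistrib)
    also have "(l1 *\<^sub>R outer z1 w1) ** (D ** matpow D k) = 0"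
      by (simp add: matrix_mul_assoc scaleR_matrix_mult outer_mult wD outer_scaleR)
    also have "(l2 *\<^sub>R outer z2 w2) ** (D ** matpow D k) = 0"
      by (simp add: matrix_mul_assoc scaleR_matrix_mult outer_mult wD outer_scaleR)
    finally have PD: "P ** matpow D (Suc k) = matpow D (Suc (Suc k))" by simp
    have "matpow P (Suc (Suc k)) = P ** matpow P (Suc k)" by simp
    also have "\<dots> = l1 ^ Suc (Suc k) *\<^sub>R outer z1 w1 + l2 ^ Suc (Suc k) *\<^sub>R outer z2 w2
        + matpow D (Suc (Suc k))"
      unfolding Suc.IH by (simp only: matrix_add_ldistrib PD matrix_mult_scaleR mult_outer Pz outer_scaleR)
        (simp add: algebra_simps)
    finally show ?case .
  qed
  have cD: "cmatrix D *v v = cmatrix P *v v - (of_real l1 * pairing (cvec w1) v) *s cvec z1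
      - (of_real l2 * pairing (cvec w2) v) *s cvec z2" for v
  proof -
    have "cmatrix D = cmatrix P - outer (of_real l1 *s cvec z1) (cvec w1)
        - outer (of_real l2 *s cvec z2) (cvec w2)"
      by (simp add: vec_eq_iff cmatrix_def D_def outer_def cvec_def)
    then show ?thesis
      by (simp add: matrix_vector_mult_diff_rdistrib outer_mult_vec vector_smult_assoc mult.commute)
  qed
  have pD: "pairing (cvec w) (cmatrix D *v v) = pairing (cvec (w v* D)) v" for w v
  proof -
    have "pairing (cvec w) (cmatrix D *v v)
        = (\<Sum>i\<in>UNIV. \<Sum>k\<in>UNIV. of_real (w $ i) * (of_real (D $ i $ k) * v $ k))"
      by (simp add: pairing_def cvec_def cmatrix_def matrix_vector_mult_def sum_distrib_left)
    also have "\<dots> = (\<Sum>k\<in>UNIV. \<Sum>i\<in>UNIV. of_real (w $ i) * (of_real (D $ i $ k) * v $ k))"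
      by (rule sum.swap)
    also have "\<dots> = pairing (cvec (w v* D)) v"
      by (simp add: pairing_def cvec_def vector_matrix_mult_def sum_distrib_left mult_ac)
    finally show ?thesis .
  qed
  have scal: "pairing u (z *s v) = z * pairing u v" for u v :: "complex^'n" and z
    by (simp add: pairing_def sum_distrib_left mult.left_commute)
  have Dev: "cmod z \<le> \<beta>" if v: "v \<noteq> 0" "cmatrix D *v v = z *s v" for z v
  proof (cases "z = 0")
    case True
    then show ?thesis using \<beta> by (simp add: \<beta>_def)
  next
    case False
    have "z * pairing (cvec w1) v = 0" "z * pairing (cvec w2) v = 0"
      using pD [of w1 v] pD [of w2 v] by (simp_all add: v scal wD) (simp_all add: pairing_def cvec_def)
    then have d: "pairing (cvec w1) v = 0" "pairing (cvec w2) v = 0" using False by auto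
    then have Pv: "cmatrix P *v v = z *s v" using cD [of v] v by simp
    have cz: "cmatrix P *v cvec z1 = of_real l1 *s cvec z1" "cmatrix P *v cvec z2 = of_real l2 *s cvec z2"
      by (simp_all add: cmatrix_mult_cvec Pz) (simp_all add: vec_eq_iff cvec_def)
    have "z \<noteq> of_real l1"
      using simple_eigenvalue_kernel_transversal [of "of_real l1" "cmatrix P" "cvec z1" "cvec w1" v]
        mult cz d v(1) Pv lt l2 vecs by (auto simp: alg_multiplicity_def pairing_cvec)
    moreover have "z \<noteq> of_real l2"
      using simple_eigenvalue_kernel_transversal [of "of_real l2" "cmatrix P" "cvec z2" "cvec w2" v]
        mult cz d v(1) Pv lt l2 vecs by (auto simp: alg_multiplicity_def pairing_cvec)
    moreover have "z \<in> eigenvalues P" using Pv v by (auto simp: eigenvalues_def)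
    ultimately show ?thesis
      using remaining_eigenvalue_bound [OF ev] lt by (simp add: \<beta>_def)
  qed
  have D0: "(\<lambda>k. (1 / l2 ^ k) *\<^sub>R matpow D k) \<longlonglongrightarrow> 0"
  proof (intro vec_tendstoI)
    fix i m
    have "(\<lambda>k. matpow (cmatrix D) k $ i $ m / of_real l2 ^ k) \<longlonglongrightarrow> 0"
      by (rule matpow_entry_decay [where \<beta> = \<beta>]) (use Dev \<beta> in \<open>auto simp: \<beta>_def\<close>)
    moreover have "matpow (cmatrix D) k $ i $ m / of_real l2 ^ k
        = of_real (matpow D k $ i $ m / l2 ^ k)" for k
      unfolding cmatrix_matpow [symmetric] by (simp add: cmatrix_def)
    ultimately have "(\<lambda>k. complex_of_real (matpow D k $ i $ m / l2 ^ k)) \<longlonglongrightarrow> of_real 0"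
      by simp
    then have "(\<lambda>k. matpow D k $ i $ m / l2 ^ k) \<longlonglongrightarrow> 0"
      by (simp only: tendsto_of_real_iff)
    then show "(\<lambda>k. ((1 / l2 ^ k) *\<^sub>R matpow D k) $ i $ m) \<longlonglongrightarrow> 0 $ i $ m"
      by simp
  qed
  define T where "T k = (1 / l2 ^ k) *\<^sub>R (matpow P k - l1 ^ k *\<^sub>R outer z1 w1)" for k
  have "matpow P k = l1 ^ k *\<^sub>R outer z1 w1 + l2 ^ k *\<^sub>R T k" for k
    using l2 by (simp add: T_def)
  moreover have "T \<longlonglongrightarrow> outer z2 w2"
  proof (rule Lim_transform_eventually)
    show "(\<lambda>k. outer z2 w2 + (1 / l2 ^ k) *\<^sub>R matpow D k) \<longlonglongrightarrow> outer z2 w2"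
      using tendsto_add [OF tendsto_const D0, of "outer z2 w2"] by simp
    have "outer z2 w2 + (1 / l2 ^ k) *\<^sub>R matpow D k = T k" if k: "k > 0" for k
    proof -
      obtain k' where k': "k = Suc k'" using k by (cases k) auto
      have "matpow P k - l1 ^ k *\<^sub>R outer z1 w1 = l2 ^ k *\<^sub>R outer z2 w2 + matpow D k"
        unfolding k' split by simp
      then show ?thesis using l2 by (simp add: T_def scaleR_add_right)
    qed
    then show "eventually (\<lambda>k. outer z2 w2 + (1 / l2 ^ k) *\<^sub>R matpow D k = T k) sequentially"
      by (intro eventually_sequentiallyI [of 1]) auto
  qed
  ultimately show ?thesis using that by blast
qed

section \<open>One expanding and one weakly contracting direction\<close>

lemma filterlim_div2: "filterlim (\<lambda>k::nat. k div 2) at_top sequentially"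
  and filterlim_minus_div2: "filterlim (\<lambda>k::nat. k - k div 2) at_top sequentially"
proof -
  show "filterlim (\<lambda>k::nat. k div 2) at_top sequentially"
    unfolding filterlim_at_top
  proof
    fix Z show "eventually (\<lambda>k. Z \<le> k div 2) sequentially"
      by (rule eventually_sequentiallyI [of "2 * Z"]) simp
  qed
  show "filterlim (\<lambda>k::nat. k - k div 2) at_top sequentially"
    unfolding filterlim_at_top
  proof
    fix Z show "eventually (\<lambda>k. Z \<le> k - k div 2) sequentially"
      by (rule eventually_sequentiallyI [of "2 * Z"]) simp
  qed
qed

text \<open>The asymptotic form of the powers of \<open>P\<close>, isolated from its spectral origin. Keeping all of
\<open>P\<^sup>k - l1\<^sup>k z1 w1\<^sup>T\<close> in the single factor \<open>T k\<close> leaves only one rank-one term to be split off exactly.\<close>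

locale dominant_powers =
  fixes P :: "real^'n^'n" and T :: "nat \<Rightarrow> real^'n^'n" and l1 l2 :: real
    and z1 w1 z2 w2 :: "real^'n"
  assumes pow: "matpow P k = l1 ^ k *\<^sub>R outer z1 w1 + l2 ^ k *\<^sub>R T k"
    and T: "T \<longlonglongrightarrow> outer z2 w2"
    and l: "0 < l2" "l2 < 1" "1 < l1"
    and w1z1: "w1 \<bullet> z1 = 1"
begin

lemma l2_power: "(\<lambda>k. l2 ^ k) \<longlonglongrightarrow> 0"
  using l by (intro LIMSEQ_realpow_zero) auto

lemma l1_power: "(\<lambda>k. 1 / l1 ^ k) \<longlonglongrightarrow> 0"
  using l LIMSEQ_inverse_realpow_zero [of l1] by (simp add: inverse_eq_divide)

lemma matpow_mult_vec: "matpow P k *v x = (l1 ^ k * (w1 \<bullet> x)) *\<^sub>R z1 + l2 ^ k *\<^sub>R (T k *v x)"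
  by (simp add: pow matrix_vector_mult_add_rdistrib scaleR_matrix_vector_assoc [symmetric]
      outer_mult_vec_real)

lemma tendsto_T_mult_vec: "v \<longlonglongrightarrow> x \<Longrightarrow> (\<lambda>k. T k *v v k) \<longlonglongrightarrow> (w2 \<bullet> x) *\<^sub>R z2"
  using tendsto_matrix_vector_mult [OF T] by (simp add: outer_mult_vec_real)

text \<open>With \<open>B\<^sub>k = I - w l2\<^sup>k Q T\<^sub>k\<close>, which tends to the identity, \<open>I - w Q P\<^sup>k\<close> is the rank-one perturbation
\<open>B\<^sub>k - w l1\<^sup>k (Q z1) w1\<^sup>T\<close>. Its determinant is \<open>det B\<^sub>k (1 - w l1\<^sup>k w1 \<bullet> y)\<close> with \<open>y = B\<^sub>k\<^sup>-\<^sup>1 Q z1\<close>, and one step of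
the Neumann recursion \<open>y = Q z1 + w l2\<^sup>k Q T\<^sub>k y\<close> exposes the two leading orders.\<close>

lemma det_pencil_asymptotics:
  fixes Q :: "real^'n^'n" and w :: complex
  obtains d g where "d \<longlonglongrightarrow> 1" "g \<longlonglongrightarrow> of_real ((w1 \<bullet> (Q *v z2)) * (w2 \<bullet> (Q *v z1)))"
    and "eventually (\<lambda>k. det (pencil (cmatrix (Q ** matpow P k)) w)
      = d k * (1 - w * of_real (l1 ^ k * (w1 \<bullet> (Q *v z1))) - w\<^sup>2 * of_real ((l1 * l2) ^ k) * g k))
      sequentially"
proof -
  define S where "S k = cmatrix (Q ** T k)" for k
  define e where "e k = w * of_real (l2 ^ k)" for k
  define B where "B k = pencil (S k) (e k)" for k
  define u where "u = cvec (Q *v z1)"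
  have S: "S \<longlonglongrightarrow> cmatrix (Q ** outer z2 w2)"
    unfolding S_def by (intro tendsto_cmatrix tendsto_intros T)
  have "e \<longlonglongrightarrow> w * of_real 0"
    unfolding e_def by (intro tendsto_intros l2_power)
  then have "(\<lambda>k. map_matrix ((*) (e k)) (S k)) \<longlonglongrightarrow> map_matrix ((*) 0) (cmatrix (Q ** outer z2 w2))"
    by (intro tendsto_intros S) simp
  moreover have "map_matrix ((*) 0) (cmatrix (Q ** outer z2 w2)) = 0"
    by (simp add: vec_eq_iff)
  ultimately have "B \<longlonglongrightarrow> mat 1 - 0"
    unfolding B_def pencil_def by (intro tendsto_diff tendsto_const) simp
  then have B: "B \<longlonglongrightarrow> mat 1" by simp
  note inv = tendsto_matrix_inv_mat_1 [OF B]
  define g where "g k = pairing (cvec w1) (S k *v (matrix_inv (B k) *v u))" for k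
  have "g \<longlonglongrightarrow> pairing (cvec w1) (cmatrix (Q ** outer z2 w2) *v (mat 1 *v u))"
    unfolding g_def by (intro tendsto_pairing tendsto_intros S inv(2))
  also have "pairing (cvec w1) (cmatrix (Q ** outer z2 w2) *v (mat 1 *v u))
      = of_real ((w1 \<bullet> (Q *v z2)) * (w2 \<bullet> (Q *v z1)))"
    by (simp add: u_def cmatrix_mult_cvec pairing_cvec mult_outer outer_mult_vec_real mult.commute)
  finally have g: "g \<longlonglongrightarrow> \<dots>" .
  have d: "(\<lambda>k. det (B k)) \<longlonglongrightarrow> 1" using tendsto_det [OF B] by simp
  have "eventually (\<lambda>k. det (pencil (cmatrix (Q ** matpow P k)) w)
      = det (B k) * (1 - w * of_real (l1 ^ k * (w1 \<bullet> (Q *v z1))) - w\<^sup>2 * of_real ((l1 * l2) ^ k) * g k))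
      sequentially"
    using inv(1)
  proof eventually_elim
    case (elim k)
    define y where "y = matrix_inv (B k) *v u"
    have By: "B k *v y = u"
      using elim by (simp add: y_def matrix_vector_mul_assoc matrix_inv_right)
    have "pencil (cmatrix (Q ** matpow P k)) w = B k - outer ((w * of_real (l1 ^ k)) *s u) (cvec w1)"
    proof -
      have Q: "Q ** matpow P k = l1 ^ k *\<^sub>R outer (Q *v z1) w1 + l2 ^ k *\<^sub>R (Q ** T k)"
        by (simp add: pow matrix_add_ldistrib matrix_mult_scaleR mult_outer)
      show ?thesis
        by (simp add: Q vec_eq_iff pencil_def B_def S_def e_def cmatrix_def outer_def u_def cvec_def algebra_simps)
    qed
    also have "\<dots> = B k ** (mat 1 - outer ((w * of_real (l1 ^ k)) *s y) (cvec w1))"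
      by (simp add: matrix_diff_ldistrib mult_outer vector_scalar_commute By)
    finally have "det (pencil (cmatrix (Q ** matpow P k)) w)
        = det (B k) * (1 - pairing (cvec w1) ((w * of_real (l1 ^ k)) *s y))"
      by (simp add: det_mul det_mat_1_minus_outer)
    also have "pairing (cvec w1) ((w * of_real (l1 ^ k)) *s y) = w * of_real (l1 ^ k) * pairing (cvec w1) y"
      by (simp add: pairing_def sum_distrib_left mult_ac)
    also have "pairing (cvec w1) y = of_real (w1 \<bullet> (Q *v z1)) + e k * g k"
    proof -
      have "y = u + e k *s (S k *v y)"
        using By by (simp add: B_def pencil_mult_vec algebra_simps)
      then have "pairing (cvec w1) y = pairing (cvec w1) (u + e k *s (S k *v y))" by simp
      also have "\<dots> = pairing (cvec w1) u + e k * g k"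
        by (simp add: g_def y_def pairing_def sum.distrib sum_distrib_left distrib_left mult_ac)
      finally show ?thesis by (simp add: u_def pairing_cvec)
    qed
    finally show ?case
      by (simp add: e_def algebra_simps power2_eq_square power_mult_distrib)
  qed
  then show ?thesis using that [OF d g] by blast
qed

text \<open>The three conclusions come from the two terms of the determinant that could be unbounded. A term of
order \<open>l1\<^sup>k\<close>, or after it one of order \<open>(l1 l2)\<^sup>k\<close> with \<open>l1 l2 > 1\<close>, contradicts the upper bound. If
\<open>l1 l2 = 1\<close>, the determinant tends to \<open>1 - q w\<^sup>2\<close>; for \<open>|q| > 1\<close> this has a zero inside the unit disc,
where the lower bound is positive.\<close>

lemma multiplier_constraints:
  fixes Q :: "real^'n^'n"
  defines "q11 \<equiv> w1 \<bullet> (Q *v z1)" and "q \<equiv> (w1 \<bullet> (Q *v z2)) * (w2 \<bullet> (Q *v z1))"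
  assumes stable: "eventually (\<lambda>k. \<forall>z\<in>eigenvalues (Q ** matpow P k). cmod z \<le> 1) sequentially"
  shows "q11 = 0" and "q \<noteq> 0 \<Longrightarrow> l1 * l2 \<le> 1" and "l1 * l2 = 1 \<Longrightarrow> \<bar>q\<bar> \<le> 1"
proof -
  define D where "D w k = det (pencil (cmatrix (Q ** matpow P k)) w)" for w k
  have up: "eventually (\<lambda>k. norm (D w k) \<le> (1 + norm w) ^ CARD('n)) sequentially" for w
    using stable unfolding D_def
    by eventually_elim (rule det_pencil_bounds(2), auto simp: eigenvalues_def)
  have lo: "eventually (\<lambda>k. (1 - norm w) ^ CARD('n) \<le> norm (D w k)) sequentially" if "norm w \<le> 1" for w
    using stable unfolding D_def
    by eventually_elim (rule det_pencil_bounds(1), use that in \<open>auto simp: eigenvalues_def\<close>)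
  have asym: "\<exists>d g. d \<longlonglongrightarrow> 1 \<and> g \<longlonglongrightarrow> of_real q \<and> eventually (\<lambda>k. D w k
      = d k * (1 - w * of_real (l1 ^ k * q11) - w\<^sup>2 * of_real ((l1 * l2) ^ k) * g k)) sequentially" for w
  proof -
    obtain d g where "d \<longlonglongrightarrow> 1" "g \<longlonglongrightarrow> of_real q" "eventually (\<lambda>k. D w k
        = d k * (1 - w * of_real (l1 ^ k * q11) - w\<^sup>2 * of_real ((l1 * l2) ^ k) * g k)) sequentially"
      unfolding D_def q_def q11_def by (rule det_pencil_asymptotics)
    then show ?thesis by (intro exI conjI)
  qed
  have scaled: "(\<lambda>k. D w k * of_real (1 / t ^ k)) \<longlonglongrightarrow> 0" if t: "1 < t" for w and t :: real
  proof -
    have Bf: "Bfun (D w) sequentially" using up [of w] by (rule BfunI)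
    have "(\<lambda>k. 1 / t ^ k) \<longlonglongrightarrow> 0"
      using t LIMSEQ_inverse_realpow_zero [of t] by (simp add: inverse_eq_divide)
    then have "(\<lambda>k. complex_of_real (1 / t ^ k)) \<longlonglongrightarrow> of_real 0" by (rule tendsto_of_real)
    then have "Zfun (\<lambda>k. complex_of_real (1 / t ^ k)) sequentially" by (simp add: tendsto_Zfun_iff)
    then have "Zfun (\<lambda>k. complex_of_real (1 / t ^ k) * D w k) sequentially"
      by (rule bounded_bilinear.Zfun_prod_Bfun [OF bounded_bilinear_mult _ Bf])
    then show ?thesis by (simp add: tendsto_Zfun_iff mult.commute)
  qed
  obtain d g where d: "d \<longlonglongrightarrow> 1" and g: "g \<longlonglongrightarrow> of_real q" and D: "eventually (\<lambda>k. D 1 k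
      = d k * (1 - 1 * of_real (l1 ^ k * q11) - 1\<^sup>2 * of_real ((l1 * l2) ^ k) * g k)) sequentially"
    using asym by blast
  show q11: "q11 = 0"
  proof -
    have "(\<lambda>k. d k * (of_real (1 / l1 ^ k) - of_real q11 - of_real (l2 ^ k) * g k))
        \<longlonglongrightarrow> 1 * (of_real 0 - of_real q11 - of_real 0 * of_real q)"
      by (intro tendsto_intros d g l1_power l2_power)
    then have "(\<lambda>k. D 1 k * of_real (1 / l1 ^ k)) \<longlonglongrightarrow> 1 * (of_real 0 - of_real q11 - of_real 0 * of_real q)"
    proof (rule Lim_transform_eventually)
      show "eventually (\<lambda>k. d k * (of_real (1 / l1 ^ k) - of_real q11 - of_real (l2 ^ k) * g k)
          = D 1 k * of_real (1 / l1 ^ k)) sequentially"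
        using D
      proof eventually_elim
        case (elim k)
        have alg: "x * (1 / t - y - m * z) = x * (1 - t * y - (t * m) * z) * (1 / t)"
          if "t \<noteq> 0" for x y z t m :: complex
          using that by (simp add: field_simps)
        have "d k * (1 / of_real (l1 ^ k) - of_real q11 - of_real (l2 ^ k) * g k) =
          d k * (1 - of_real (l1 ^ k) * of_real q11 - (of_real (l1 ^ k) * of_real (l2 ^ k)) * g k)
            * (1 / of_real (l1 ^ k))"
          by (rule alg) (use l in simp)
        then show ?case by (simp only: elim power_mult_distrib of_real_mult of_real_divide of_real_1
              mult_1_left power_one)
      qed
    qed
    from LIMSEQ_unique [OF this scaled] show ?thesis using l by simp
  qed
  show "l1 * l2 \<le> 1" if "q \<noteq> 0"
  proof (rule ccontr)
    assume "\<not> l1 * l2 \<le> 1"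
    then have m: "1 < l1 * l2" by simp
    then have "(\<lambda>k. 1 / (l1 * l2) ^ k) \<longlonglongrightarrow> 0"
      using LIMSEQ_inverse_realpow_zero [of "l1 * l2"] by (simp add: inverse_eq_divide)
    then have "(\<lambda>k. d k * (of_real (1 / (l1 * l2) ^ k) - g k)) \<longlonglongrightarrow> 1 * (of_real 0 - of_real q)"
      by (intro tendsto_intros d g)
    then have "(\<lambda>k. D 1 k * of_real (1 / (l1 * l2) ^ k)) \<longlonglongrightarrow> 1 * (of_real 0 - of_real q)"
    proof (rule Lim_transform_eventually)
      show "eventually (\<lambda>k. d k * (of_real (1 / (l1 * l2) ^ k) - g k)
          = D 1 k * of_real (1 / (l1 * l2) ^ k)) sequentially"
        using D
      proof eventually_elim
        case (elim k)
        have alg: "x * (1 / t - z) = x * (1 - t * z) * (1 / t)" if "t \<noteq> 0" for x z t :: complex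
          using that by (simp add: field_simps)
        have "d k * (1 / of_real ((l1 * l2) ^ k) - g k) =
          d k * (1 - of_real ((l1 * l2) ^ k) * g k) * (1 / of_real ((l1 * l2) ^ k))"
          by (rule alg) (use l in simp)
        then show ?case by (simp only: elim q11 of_real_divide of_real_1 of_real_0
              mult_1_left mult_zero_right diff_zero power_one)
      qed
    qed
    from LIMSEQ_unique [OF this scaled [OF m]] show False using that by simp
  qed
  show "\<bar>q\<bar> \<le> 1" if m: "l1 * l2 = 1"
  proof (rule ccontr)
    assume "\<not> \<bar>q\<bar> \<le> 1"
    then have q: "1 < \<bar>q\<bar>" by simp
    \<comment> \<open>A zero of the limit \<open>1 - q w\<^sup>2\<close>; it is imaginary when \<open>q\<close> is negative.\<close>
    define w where "w = csqrt (1 / of_real q)"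
    have w2: "w\<^sup>2 = 1 / of_real q" by (simp add: w_def)
    have "(norm w)\<^sup>2 = 1 / \<bar>q\<bar>" by (simp add: norm_power [symmetric] w2 norm_divide)
    also have "\<dots> < 1" using q by simp
    finally have w: "norm w < 1" using power_less_one_iff by (metis norm_ge_zero abs_square_less_1 abs_norm_cancel)
    obtain d g where d: "d \<longlonglongrightarrow> 1" and g: "g \<longlonglongrightarrow> of_real q" and D: "eventually (\<lambda>k. D w k
        = d k * (1 - w * of_real (l1 ^ k * q11) - w\<^sup>2 * of_real ((l1 * l2) ^ k) * g k)) sequentially"
      using asym by blast
    have "(\<lambda>k. d k * (1 - w\<^sup>2 * g k)) \<longlonglongrightarrow> 1 * (1 - w\<^sup>2 * of_real q)"
      by (intro tendsto_intros d g)
    moreover have "1 * (1 - w\<^sup>2 * of_real q) = 0" using q by (auto simp: w2)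
    ultimately have "(\<lambda>k. d k * (1 - w\<^sup>2 * g k)) \<longlonglongrightarrow> 0" by (simp only:)
    then have "D w \<longlonglongrightarrow> 0"
      by (rule Lim_transform_eventually) (use D in \<open>eventually_elim, simp add: q11 m\<close>)
    then have "(\<lambda>k. norm (D w k)) \<longlonglongrightarrow> 0" by (rule tendsto_norm_zero)
    then have "(1 - norm w) ^ CARD('n) \<le> 0"
      by (rule tendsto_lowerbound) (use lo w in auto)
    moreover have "0 < (1 - norm w) ^ CARD('n)" using w by simp
    ultimately show False by simp
  qed
qed

text \<open>Solving \<open>V = P\<^sup>k (\<gamma> + Q V)\<close> for its contracted part leaves the operator \<open>I - l2\<^sup>k T\<^sub>k Q\<close>, which tends to
the identity and so is invertible for large \<open>k\<close>.\<close>

definition resolvent :: "real^'n^'n \<Rightarrow> nat \<Rightarrow> real^'n^'n" where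
  "resolvent Q k = matrix_inv (mat 1 - l2 ^ k *\<^sub>R (T k ** Q))"

lemma resolvent:
  shows resolvent_limit: "resolvent Q \<longlonglongrightarrow> mat 1"
    and resolvent_eq: "eventually (\<lambda>k. \<forall>x y. x - l2 ^ k *\<^sub>R (T k *v (Q *v x)) = y \<longrightarrow> x = resolvent Q k *v y) sequentially"
proof -
  let ?B = "\<lambda>k. mat 1 - l2 ^ k *\<^sub>R (T k ** Q)"
  have "?B \<longlonglongrightarrow> mat 1 - 0 *\<^sub>R (outer z2 w2 ** Q)"
    by (intro tendsto_diff tendsto_scaleR tendsto_matrix_mult tendsto_const l2_power T)
  then have B: "?B \<longlonglongrightarrow> mat 1" by simp
  show "resolvent Q \<longlonglongrightarrow> mat 1"
    unfolding resolvent_def [abs_def] by (rule tendsto_matrix_inv_mat_1(2) [OF B])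
  show "eventually (\<lambda>k. \<forall>x y. x - l2 ^ k *\<^sub>R (T k *v (Q *v x)) = y \<longrightarrow> x = resolvent Q k *v y) sequentially"
    using tendsto_matrix_inv_mat_1(1) [OF B]
  proof eventually_elim
    case (elim k)
    have "resolvent Q k *v (x - l2 ^ k *\<^sub>R (T k *v (Q *v x))) = x" for x
    proof -
      have "x - l2 ^ k *\<^sub>R (T k *v (Q *v x)) = ?B k *v x"
        by (simp add: matrix_vector_mult_diff_rdistrib scaleR_matrix_vector_assoc [symmetric]
            matrix_vector_mul_assoc)
      then show ?thesis
        by (simp only: matrix_vector_mul_assoc resolvent_def matrix_inv_left [OF elim] matrix_vector_mul_lid)
    qed
    then show ?case by metis
  qed
qed

text \<open>The coefficient of \<open>z1\<close> contributed by the expanding direction when \<open>P\<^sup>k\<close> is applied to \<open>\<gamma> + Q v\<close>.\<close>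

definition amplitude :: "real^'n^'n \<Rightarrow> real^'n \<Rightarrow> nat \<Rightarrow> real^'n \<Rightarrow> real" where
  "amplitude Q \<gamma> k v = l1 ^ k * (w1 \<bullet> (\<gamma> + Q *v v))"

text \<open>The equation becomes scalar: apart from a term of order \<open>l2\<^sup>k\<close>, a solution is determined by its amplitude.\<close>

lemma fixed_point_representation:
  "eventually (\<lambda>k. \<forall>\<gamma> v. v = matpow P k *v (\<gamma> + Q *v v) \<longrightarrow>
     v = amplitude Q \<gamma> k v *\<^sub>R (resolvent Q k *v z1) + l2 ^ k *\<^sub>R (resolvent Q k *v (T k *v \<gamma>))) sequentially"
  using resolvent_eq [of Q]
proof eventually_elim
  case (elim k)
  show ?case
  proof (intro allI impI)
    fix \<gamma> v assume v: "v = matpow P k *v (\<gamma> + Q *v v)"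
    have "v = amplitude Q \<gamma> k v *\<^sub>R z1 + l2 ^ k *\<^sub>R (T k *v (\<gamma> + Q *v v))"
      using v unfolding matpow_mult_vec amplitude_def .
    then have "v - l2 ^ k *\<^sub>R (T k *v (Q *v v)) = amplitude Q \<gamma> k v *\<^sub>R z1 + l2 ^ k *\<^sub>R (T k *v \<gamma>)"
      by (simp add: matrix_vector_right_distrib scaleR_add_right algebra_simps)
    with elim have "v = resolvent Q k *v (amplitude Q \<gamma> k v *\<^sub>R z1 + l2 ^ k *\<^sub>R (T k *v \<gamma>))" by blast
    then show "v = amplitude Q \<gamma> k v *\<^sub>R (resolvent Q k *v z1) + l2 ^ k *\<^sub>R (resolvent Q k *v (T k *v \<gamma>))"
      by (simp only: matrix_vector_right_distrib matrix_vector_mult_scaleR)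
  qed
qed

lemma tendsto_resolvent_z1: "(\<lambda>k. resolvent Q k *v z1) \<longlonglongrightarrow> z1"
  and tendsto_resolvent_T: "(\<lambda>k. resolvent Q k *v (T k *v \<gamma>)) \<longlonglongrightarrow> (w2 \<bullet> \<gamma>) *\<^sub>R z2"
  using tendsto_matrix_vector_mult [OF resolvent_limit [of Q] tendsto_const, of z1]
    tendsto_matrix_vector_mult [OF resolvent_limit [of Q] tendsto_T_mult_vec [OF tendsto_const], of \<gamma>]
  by simp_all

lemma tendsto_inner_mult:
  "v \<longlonglongrightarrow> x \<Longrightarrow> (\<lambda>k. w1 \<bullet> (Q *v v k)) \<longlonglongrightarrow> w1 \<bullet> (Q *v x)" for Q :: "real^'n^'n"
  by (intro tendsto_intros)

text \<open>Inserting the representation into the definition of the amplitude \<open>a\<close> and dividing by \<open>l1\<^sup>k\<close> gives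
\<open>a (1 / l1\<^sup>k - w1 \<bullet> Q p\<^sub>k) = w1 \<bullet> \<gamma> + o(1)\<close>, where \<open>p\<^sub>k\<close> tends to \<open>z1\<close>. Since \<open>w1 \<bullet> Q z1\<close> is not zero, the
factor of \<open>a\<close> stays away from \<open>0\<close>.\<close>

lemma fixed_points_nondegenerate:
  assumes \<eta>: "w1 \<bullet> (Q *v z1) \<noteq> 0"
  shows "eventually (\<lambda>k. \<forall>v. v = matpow P k *v (Q *v v) \<longrightarrow> v = 0) sequentially"
    and "eventually (\<lambda>k. V k = matpow P k *v (\<gamma> + Q *v V k)) sequentially \<Longrightarrow>
      V \<longlonglongrightarrow> (- (w1 \<bullet> \<gamma>) / (w1 \<bullet> (Q *v z1))) *\<^sub>R z1"
proof -
  let ?\<eta> = "w1 \<bullet> (Q *v z1)"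
  define p where "p k = resolvent Q k *v z1" for k
  define s where "s k = 1 / l1 ^ k - w1 \<bullet> (Q *v p k)" for k
  have p: "p \<longlonglongrightarrow> z1" unfolding p_def by (rule tendsto_resolvent_z1)
  have "s \<longlonglongrightarrow> 0 - ?\<eta>"
    unfolding s_def by (intro tendsto_diff l1_power tendsto_inner_mult p)
  then have s: "s \<longlonglongrightarrow> - ?\<eta>" by simp
  then have s0: "eventually (\<lambda>k. s k \<noteq> 0) sequentially"
    by (rule tendsto_imp_eventually_ne) (use \<eta> in simp)
  have amp: "eventually (\<lambda>k. \<forall>\<gamma> v. v = matpow P k *v (\<gamma> + Q *v v) \<longrightarrow>
      amplitude Q \<gamma> k v = (w1 \<bullet> \<gamma> + l2 ^ k * (w1 \<bullet> (Q *v (resolvent Q k *v (T k *v \<gamma>))))) / s k) sequentially"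
    using fixed_point_representation [of Q] s0
  proof eventually_elim
    case (elim k)
    show ?case
    proof (intro allI impI)
      fix \<gamma> v
      let ?a = "amplitude Q \<gamma> k v" and ?q = "resolvent Q k *v (T k *v \<gamma>)"
      assume "v = matpow P k *v (\<gamma> + Q *v v)"
      with elim have v: "v = ?a *\<^sub>R p k + l2 ^ k *\<^sub>R ?q" by (auto simp: p_def)
      have "w1 \<bullet> (Q *v v) = ?a * (w1 \<bullet> (Q *v p k)) + l2 ^ k * (w1 \<bullet> (Q *v ?q))"
        by (subst v) (simp add: matrix_vector_right_distrib matrix_vector_mult_scaleR inner_add_right)
      moreover have "?a / l1 ^ k = w1 \<bullet> \<gamma> + w1 \<bullet> (Q *v v)"
        using l by (simp add: amplitude_def inner_add_right)
      ultimately have "?a * s k = w1 \<bullet> \<gamma> + l2 ^ k * (w1 \<bullet> (Q *v ?q))"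
        by (simp add: s_def algebra_simps)
      then show "?a = (w1 \<bullet> \<gamma> + l2 ^ k * (w1 \<bullet> (Q *v ?q))) / s k"
        using elim by (simp add: field_simps)
    qed
  qed
  show "eventually (\<lambda>k. \<forall>v. v = matpow P k *v (Q *v v) \<longrightarrow> v = 0) sequentially"
    using fixed_point_representation [of Q] amp
  proof eventually_elim
    case (elim k)
    show ?case
    proof (intro allI impI)
      fix v assume "v = matpow P k *v (Q *v v)"
      then have v: "v = matpow P k *v (0 + Q *v v)" by simp
      with elim(2) have "amplitude Q 0 k v = 0" by fastforce
      moreover have "v = amplitude Q 0 k v *\<^sub>R (resolvent Q k *v z1)
          + l2 ^ k *\<^sub>R (resolvent Q k *v (T k *v 0))" using elim(1) v by blast
      ultimately show "v = 0" by simp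
    qed
  qed
  assume V: "eventually (\<lambda>k. V k = matpow P k *v (\<gamma> + Q *v V k)) sequentially"
  define q where "q k = resolvent Q k *v (T k *v \<gamma>)" for k
  have q: "q \<longlonglongrightarrow> (w2 \<bullet> \<gamma>) *\<^sub>R z2" unfolding q_def by (rule tendsto_resolvent_T)
  define a where "a k = (w1 \<bullet> \<gamma> + l2 ^ k * (w1 \<bullet> (Q *v q k))) / s k" for k
  have "a \<longlonglongrightarrow> (w1 \<bullet> \<gamma> + 0 * (w1 \<bullet> (Q *v ((w2 \<bullet> \<gamma>) *\<^sub>R z2)))) / (- ?\<eta>)"
    unfolding a_def
    by (intro tendsto_divide tendsto_add tendsto_mult tendsto_const l2_power tendsto_inner_mult q s) (use \<eta> in simp)
  then have a: "a \<longlonglongrightarrow> - (w1 \<bullet> \<gamma>) / ?\<eta>" by simp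
  have "(\<lambda>k. a k *\<^sub>R p k + l2 ^ k *\<^sub>R q k) \<longlonglongrightarrow> (- (w1 \<bullet> \<gamma>) / ?\<eta>) *\<^sub>R z1 + 0 *\<^sub>R ((w2 \<bullet> \<gamma>) *\<^sub>R z2)"
    by (intro tendsto_intros a p q l2_power)
  then have "V \<longlonglongrightarrow> (- (w1 \<bullet> \<gamma>) / ?\<eta>) *\<^sub>R z1 + 0 *\<^sub>R ((w2 \<bullet> \<gamma>) *\<^sub>R z2)"
  proof (rule Lim_transform_eventually)
    show "eventually (\<lambda>k. a k *\<^sub>R p k + l2 ^ k *\<^sub>R q k = V k) sequentially"
      using fixed_point_representation [of Q] amp V
      by eventually_elim (metis a_def p_def q_def)
  qed
  then show "V \<longlonglongrightarrow> (- (w1 \<bullet> \<gamma>) / ?\<eta>) *\<^sub>R z1" by simp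
qed

text \<open>The three limits concern the solution \<open>V\<^sub>k = P\<^sup>k u\<close>, the vector \<open>P\<^sup>k\<^sup>-\<^sup>1 u\<close> one step before it and the one
halfway, where \<open>u = \<gamma> + Q V\<^sub>k\<close>. All are governed by the amplitude: going back \<open>i\<close> steps divides it by \<open>l1\<^sup>i\<close>. The
scaling \<open>r\<close> allows for growing solutions.\<close>

lemma fixed_point_limits:
  assumes V: "eventually (\<lambda>k. V k = matpow P k *v (\<gamma> + Q *v V k)) sequentially"
    and r: "r \<longlonglongrightarrow> r0" and a: "(\<lambda>k. r k * amplitude Q \<gamma> k (V k)) \<longlonglongrightarrow> a"
  shows "(\<lambda>k. r k *\<^sub>R V k) \<longlonglongrightarrow> a *\<^sub>R z1"
    and "(\<lambda>k. r k *\<^sub>R (matpow P (k - 1) *v (\<gamma> + Q *v V k))) \<longlonglongrightarrow> (a / l1) *\<^sub>R z1"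
    and "(\<lambda>k. r k *\<^sub>R (matpow P (k div 2) *v (\<gamma> + Q *v V k))) \<longlonglongrightarrow> 0"
proof -
  let ?a = "\<lambda>k. amplitude Q \<gamma> k (V k)" and ?x = "\<lambda>k. \<gamma> + Q *v V k"
  define p where "p k = resolvent Q k *v z1" for k
  define q where "q k = resolvent Q k *v (T k *v \<gamma>)" for k
  have p: "p \<longlonglongrightarrow> z1" unfolding p_def by (rule tendsto_resolvent_z1)
  have q: "q \<longlonglongrightarrow> (w2 \<bullet> \<gamma>) *\<^sub>R z2" unfolding q_def by (rule tendsto_resolvent_T)
  have "(\<lambda>k. (r k * ?a k) *\<^sub>R p k + l2 ^ k *\<^sub>R r k *\<^sub>R q k) \<longlonglongrightarrow> a *\<^sub>R z1 + 0 *\<^sub>R r0 *\<^sub>R ((w2 \<bullet> \<gamma>) *\<^sub>R z2)"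
    by (intro tendsto_intros a p q r l2_power)
  then have "(\<lambda>k. (r k * ?a k) *\<^sub>R p k + l2 ^ k *\<^sub>R r k *\<^sub>R q k) \<longlonglongrightarrow> a *\<^sub>R z1" by simp
  then show rV: "(\<lambda>k. r k *\<^sub>R V k) \<longlonglongrightarrow> a *\<^sub>R z1"
  proof (rule Lim_transform_eventually)
    show "eventually (\<lambda>k. (r k * ?a k) *\<^sub>R p k + l2 ^ k *\<^sub>R r k *\<^sub>R q k = r k *\<^sub>R V k) sequentially"
      using fixed_point_representation [of Q] V
    proof eventually_elim
      case (elim k)
      then have "V k = ?a k *\<^sub>R p k + l2 ^ k *\<^sub>R q k" unfolding p_def q_def by blast
      then have "r k *\<^sub>R V k = r k *\<^sub>R (?a k *\<^sub>R p k + l2 ^ k *\<^sub>R q k)" by simp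
      then show ?case by (simp add: scaleR_add_right mult_ac)
    qed
  qed
  have "(\<lambda>k. r k *\<^sub>R \<gamma> + Q *v (r k *\<^sub>R V k)) \<longlonglongrightarrow> r0 *\<^sub>R \<gamma> + Q *v (a *\<^sub>R z1)"
    by (intro tendsto_intros r rV)
  then have rx: "(\<lambda>k. r k *\<^sub>R ?x k) \<longlonglongrightarrow> r0 *\<^sub>R \<gamma> + Q *v (a *\<^sub>R z1)"
    by (simp add: scaleR_add_right matrix_vector_mult_scaleR)
  have split: "r k *\<^sub>R (matpow P i *v ?x k)
      = (r k * ?a k / l1 ^ (k - i)) *\<^sub>R z1 + l2 ^ i *\<^sub>R (T i *v (r k *\<^sub>R ?x k))" if "i \<le> k" for i k
  proof -
    have "l1 ^ i * (w1 \<bullet> ?x k) = ?a k / l1 ^ (k - i)"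
      using l that by (simp add: amplitude_def power_diff)
    moreover have "r k *\<^sub>R (matpow P i *v x)
        = (r k * (l1 ^ i * (w1 \<bullet> x))) *\<^sub>R z1 + l2 ^ i *\<^sub>R (T i *v (r k *\<^sub>R x))" for x
      by (simp add: matpow_mult_vec scaleR_add_right matrix_vector_mult_scaleR mult.commute)
    ultimately show ?thesis by simp
  qed
  have shrink: "(\<lambda>k. l2 ^ i k *\<^sub>R (T (i k) *v (r k *\<^sub>R ?x k))) \<longlonglongrightarrow> 0"
    if i: "filterlim i at_top sequentially" for i
  proof -
    have "(\<lambda>k. l2 ^ i k *\<^sub>R (T (i k) *v (r k *\<^sub>R ?x k)))
        \<longlonglongrightarrow> 0 *\<^sub>R (outer z2 w2 *v (r0 *\<^sub>R \<gamma> + Q *v (a *\<^sub>R z1)))"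
      by (intro tendsto_scaleR tendsto_matrix_vector_mult rx filterlim_compose [OF l2_power i]
          filterlim_compose [OF T i])
    then show ?thesis by simp
  qed
  have "(\<lambda>k. (r k * ?a k / l1) *\<^sub>R z1 + l2 ^ (k - 1) *\<^sub>R (T (k - 1) *v (r k *\<^sub>R ?x k)))
      \<longlonglongrightarrow> (a / l1) *\<^sub>R z1 + 0"
    by (intro tendsto_add tendsto_scaleR tendsto_divide tendsto_const a shrink
        filterlim_minus_const_nat_at_top) (use l in auto)
  then have "(\<lambda>k. (r k * ?a k / l1) *\<^sub>R z1 + l2 ^ (k - 1) *\<^sub>R (T (k - 1) *v (r k *\<^sub>R ?x k)))
      \<longlonglongrightarrow> (a / l1) *\<^sub>R z1" by simp
  then show "(\<lambda>k. r k *\<^sub>R (matpow P (k - 1) *v ?x k)) \<longlonglongrightarrow> (a / l1) *\<^sub>R z1"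
  proof (rule Lim_transform_eventually)
    show "eventually (\<lambda>k. (r k * ?a k / l1) *\<^sub>R z1 + l2 ^ (k - 1) *\<^sub>R (T (k - 1) *v (r k *\<^sub>R ?x k))
        = r k *\<^sub>R (matpow P (k - 1) *v ?x k)) sequentially"
      by (rule eventually_sequentiallyI [of 1]) (simp add: split)
  qed
  have "(\<lambda>k. (r k * ?a k * (1 / l1 ^ (k - k div 2))) *\<^sub>R z1
      + l2 ^ (k div 2) *\<^sub>R (T (k div 2) *v (r k *\<^sub>R ?x k))) \<longlonglongrightarrow> (a * 0) *\<^sub>R z1 + 0"
    by (intro tendsto_add tendsto_scaleR tendsto_mult tendsto_const a shrink filterlim_div2
        filterlim_compose [OF l1_power filterlim_minus_div2])
  then show "(\<lambda>k. r k *\<^sub>R (matpow P (k div 2) *v ?x k)) \<longlonglongrightarrow> 0"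
    by (simp add: split)
qed

text \<open>When \<open>w1 \<bullet> Q z1 = 0\<close>, the feedback of the amplitude on itself passes through the contracting direction:
from \<open>w1 \<bullet> Q v = l2\<^sup>k w1 \<bullet> Q T\<^sub>k (\<gamma> + Q v)\<close> one gets
\<open>a (1 - (l1 l2)\<^sup>k (q\<^sub>1\<^sub>2 q\<^sub>2\<^sub>1 + o(1))) = l1\<^sup>k w1 \<bullet> \<gamma> + (l1 l2)\<^sup>k (q\<^sub>1\<^sub>2 (w2 \<bullet> \<gamma>) + o(1))\<close>. In the boundary case
\<open>l1 l2 = 1\<close> the factor of \<open>a\<close> is nonzero in the limit exactly because \<open>q\<^sub>1\<^sub>2 q\<^sub>2\<^sub>1 \<noteq> 1\<close>.\<close>

lemma degenerate_amplitude:
  fixes Q :: "real^'n^'n"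
  defines "q12 \<equiv> w1 \<bullet> (Q *v z2)" and "q21 \<equiv> w2 \<bullet> (Q *v z1)"
  assumes q11: "w1 \<bullet> (Q *v z1) = 0" and m: "l1 * l2 \<le> 1" "l1 * l2 = 1 \<Longrightarrow> q12 * q21 \<noteq> 1"
  shows "\<exists>s h. s \<longlonglongrightarrow> (if l1 * l2 = 1 then 1 - q12 * q21 else 1) \<and>
    eventually (\<lambda>k. s k \<noteq> 0) sequentially \<and>
    (\<forall>\<gamma>. h \<gamma> \<longlonglongrightarrow> q12 * (w2 \<bullet> \<gamma>)) \<and> (\<forall>k. h 0 k = 0) \<and>
    eventually (\<lambda>k. \<forall>\<gamma> v. v = matpow P k *v (\<gamma> + Q *v v) \<longrightarrow>
       amplitude Q \<gamma> k v = (l1 ^ k * (w1 \<bullet> \<gamma>) + (l1 * l2) ^ k * h \<gamma> k) / s k) sequentially"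
proof -
  define p where "p k = resolvent Q k *v z1" for k
  define q where "q \<gamma> k = resolvent Q k *v (T k *v \<gamma>)" for \<gamma> k
  define g where "g k = w1 \<bullet> (Q *v (T k *v (Q *v p k)))" for k
  define s where "s k = 1 - (l1 * l2) ^ k * g k" for k
  define h where "h \<gamma> k = w1 \<bullet> (Q *v (T k *v (\<gamma> + l2 ^ k *\<^sub>R (Q *v q \<gamma> k))))" for \<gamma> k
  have p: "p \<longlonglongrightarrow> z1" unfolding p_def by (rule tendsto_resolvent_z1)
  have q: "q \<gamma> \<longlonglongrightarrow> (w2 \<bullet> \<gamma>) *\<^sub>R z2" for \<gamma> unfolding q_def by (rule tendsto_resolvent_T)
  have "g \<longlonglongrightarrow> w1 \<bullet> (Q *v ((w2 \<bullet> (Q *v z1)) *\<^sub>R z2))"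
    unfolding g_def by (intro tendsto_inner_mult tendsto_T_mult_vec tendsto_intros p)
  then have g: "g \<longlonglongrightarrow> q12 * q21"
    by (simp add: q12_def q21_def matrix_vector_mult_scaleR mult.commute)
  have "h \<gamma> \<longlonglongrightarrow> w1 \<bullet> (Q *v ((w2 \<bullet> (\<gamma> + 0 *\<^sub>R (Q *v ((w2 \<bullet> \<gamma>) *\<^sub>R z2)))) *\<^sub>R z2))" for \<gamma>
    unfolding h_def by (intro tendsto_inner_mult tendsto_T_mult_vec tendsto_intros q l2_power)
  then have h: "h \<gamma> \<longlonglongrightarrow> q12 * (w2 \<bullet> \<gamma>)" for \<gamma>
    by (simp add: q12_def matrix_vector_mult_scaleR mult.commute)
  have ml: "(\<lambda>k. (l1 * l2) ^ k) \<longlonglongrightarrow> (if l1 * l2 = 1 then 1 else 0)"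
    using m(1) l by (auto intro!: LIMSEQ_realpow_zero)
  have "s \<longlonglongrightarrow> 1 - (if l1 * l2 = 1 then 1 else 0) * (q12 * q21)"
    unfolding s_def by (intro tendsto_intros ml g)
  then have s: "s \<longlonglongrightarrow> (if l1 * l2 = 1 then 1 - q12 * q21 else 1)"
    by (simp split: if_splits)
  then have s0: "eventually (\<lambda>k. s k \<noteq> 0) sequentially"
    by (rule tendsto_imp_eventually_ne) (use m in auto)
  have "eventually (\<lambda>k. \<forall>\<gamma> v. v = matpow P k *v (\<gamma> + Q *v v) \<longrightarrow>
       amplitude Q \<gamma> k v = (l1 ^ k * (w1 \<bullet> \<gamma>) + (l1 * l2) ^ k * h \<gamma> k) / s k) sequentially"
    using fixed_point_representation [of Q] s0
  proof eventually_elim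
    case (elim k)
    show ?case
    proof (intro allI impI)
      fix \<gamma> v
      let ?a = "amplitude Q \<gamma> k v"
      assume fixed: "v = matpow P k *v (\<gamma> + Q *v v)"
      with elim have v: "v = ?a *\<^sub>R p k + l2 ^ k *\<^sub>R q \<gamma> k" by (auto simp: p_def q_def)
      have v': "v = ?a *\<^sub>R z1 + l2 ^ k *\<^sub>R (T k *v (\<gamma> + Q *v v))"
        using fixed unfolding matpow_mult_vec amplitude_def .
      have "w1 \<bullet> (Q *v v) = l2 ^ k * (w1 \<bullet> (Q *v (T k *v (\<gamma> + Q *v v))))"
        by (subst v') (simp add: matrix_vector_right_distrib matrix_vector_mult_scaleR inner_add_right q11)
      also have "\<gamma> + Q *v v = (\<gamma> + l2 ^ k *\<^sub>R (Q *v q \<gamma> k)) + ?a *\<^sub>R (Q *v p k)"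
        by (subst v) (simp add: matrix_vector_right_distrib matrix_vector_mult_scaleR)
      also have "w1 \<bullet> (Q *v (T k *v ((\<gamma> + l2 ^ k *\<^sub>R (Q *v q \<gamma> k)) + ?a *\<^sub>R (Q *v p k))))
          = h \<gamma> k + ?a * g k"
        unfolding h_def g_def
        by (simp only: matrix_vector_right_distrib matrix_vector_mult_scaleR inner_add_right inner_scaleR_right)
      finally have "w1 \<bullet> (Q *v v) = l2 ^ k * (h \<gamma> k + ?a * g k)" .
      moreover have "?a = l1 ^ k * (w1 \<bullet> \<gamma>) + l1 ^ k * (w1 \<bullet> (Q *v v))"
        by (simp add: amplitude_def inner_add_right distrib_left)
      moreover have "a * (1 - (x * y) * g) = x * c + (x * y) * h"
        if "u = y * (h + a * g)" "a = x * c + x * u" for a c g h u x y :: real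
        using that by algebra
      ultimately have "?a * s k = l1 ^ k * (w1 \<bullet> \<gamma>) + (l1 * l2) ^ k * h \<gamma> k"
        unfolding s_def power_mult_distrib by blast
      then show "?a = (l1 ^ k * (w1 \<bullet> \<gamma>) + (l1 * l2) ^ k * h \<gamma> k) / s k"
        using elim by (simp add: field_simps)
    qed
  qed
  moreover have "h 0 k = 0" for k by (simp add: h_def q_def)
  ultimately show ?thesis using s s0 h by (intro exI conjI allI)
qed

lemma fixed_points_degenerate:
  fixes Q :: "real^'n^'n"
  defines "q12 \<equiv> w1 \<bullet> (Q *v z2)" and "q21 \<equiv> w2 \<bullet> (Q *v z1)"
  defines "\<delta> \<equiv> if l1 * l2 = 1 then 1 - q12 * q21 else 1"
  assumes q11: "w1 \<bullet> (Q *v z1) = 0" and m: "l1 * l2 \<le> 1" "l1 * l2 = 1 \<Longrightarrow> q12 * q21 \<noteq> 1"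
  shows "eventually (\<lambda>k. \<forall>v. v = matpow P k *v (Q *v v) \<longrightarrow> v = 0) sequentially"
    and "eventually (\<lambda>k. V k = matpow P k *v (\<gamma> + Q *v V k)) sequentially \<Longrightarrow>
      (\<lambda>k. 1 / l1 ^ k * amplitude Q \<gamma> k (V k)) \<longlonglongrightarrow> w1 \<bullet> \<gamma> / \<delta>"
    and "eventually (\<lambda>k. V k = matpow P k *v (\<gamma> + Q *v V k)) sequentially \<Longrightarrow> w1 \<bullet> \<gamma> = 0 \<Longrightarrow>
      (\<lambda>k. amplitude Q \<gamma> k (V k)) \<longlonglongrightarrow> (if l1 * l2 = 1 then q12 * (w2 \<bullet> \<gamma>) else 0) / \<delta>"
proof -
  obtain s h where s: "s \<longlonglongrightarrow> \<delta>" and s0: "eventually (\<lambda>k. s k \<noteq> 0) sequentially"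
    and h: "\<And>\<gamma>. h \<gamma> \<longlonglongrightarrow> q12 * (w2 \<bullet> \<gamma>)" and h0: "\<And>k. h 0 k = 0"
    and amp: "eventually (\<lambda>k. \<forall>\<gamma> v. v = matpow P k *v (\<gamma> + Q *v v) \<longrightarrow>
       amplitude Q \<gamma> k v = (l1 ^ k * (w1 \<bullet> \<gamma>) + (l1 * l2) ^ k * h \<gamma> k) / s k) sequentially"
    using degenerate_amplitude [OF q11 m(1) m(2) [unfolded q12_def q21_def]]
    unfolding \<delta>_def q12_def q21_def by blast
  have \<delta>: "\<delta> \<noteq> 0" using m by (auto simp: \<delta>_def)
  have ml: "(\<lambda>k. (l1 * l2) ^ k) \<longlonglongrightarrow> (if l1 * l2 = 1 then 1 else 0)"
    using m(1) l by (auto intro!: LIMSEQ_realpow_zero)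
  show "eventually (\<lambda>k. \<forall>v. v = matpow P k *v (Q *v v) \<longrightarrow> v = 0) sequentially"
    using fixed_point_representation [of Q] amp
  proof eventually_elim
    case (elim k)
    show ?case
    proof (intro allI impI)
      fix v assume "v = matpow P k *v (Q *v v)"
      then have v: "v = matpow P k *v (0 + Q *v v)" by simp
      with elim(2) have "amplitude Q 0 k v = 0" by (fastforce simp: h0)
      moreover have "v = amplitude Q 0 k v *\<^sub>R (resolvent Q k *v z1)
          + l2 ^ k *\<^sub>R (resolvent Q k *v (T k *v 0))" using elim(1) v by blast
      ultimately show "v = 0" by simp
    qed
  qed
  assume V: "eventually (\<lambda>k. V k = matpow P k *v (\<gamma> + Q *v V k)) sequentially"
  have ampV: "eventually (\<lambda>k. amplitude Q \<gamma> k (V k)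
      = (l1 ^ k * (w1 \<bullet> \<gamma>) + (l1 * l2) ^ k * h \<gamma> k) / s k) sequentially"
    using amp V by eventually_elim blast
  show "(\<lambda>k. 1 / l1 ^ k * amplitude Q \<gamma> k (V k)) \<longlonglongrightarrow> w1 \<bullet> \<gamma> / \<delta>"
  proof -
    have "(\<lambda>k. (w1 \<bullet> \<gamma> + l2 ^ k * h \<gamma> k) / s k) \<longlonglongrightarrow> (w1 \<bullet> \<gamma> + 0 * (q12 * (w2 \<bullet> \<gamma>))) / \<delta>"
      by (intro tendsto_intros h s l2_power \<delta>)
    then have "(\<lambda>k. (w1 \<bullet> \<gamma> + l2 ^ k * h \<gamma> k) / s k) \<longlonglongrightarrow> w1 \<bullet> \<gamma> / \<delta>" by simp
    then show ?thesis
    proof (rule Lim_transform_eventually)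
      show "eventually (\<lambda>k. (w1 \<bullet> \<gamma> + l2 ^ k * h \<gamma> k) / s k
          = 1 / l1 ^ k * amplitude Q \<gamma> k (V k)) sequentially"
        using ampV by eventually_elim (use l in \<open>simp add: power_mult_distrib add_divide_distrib\<close>)
    qed
  qed
  show "(\<lambda>k. amplitude Q \<gamma> k (V k)) \<longlonglongrightarrow> (if l1 * l2 = 1 then q12 * (w2 \<bullet> \<gamma>) else 0) / \<delta>"
    if "w1 \<bullet> \<gamma> = 0"
  proof -
    have "(\<lambda>k. (l1 * l2) ^ k * h \<gamma> k / s k)
        \<longlonglongrightarrow> (if l1 * l2 = 1 then 1 else 0) * (q12 * (w2 \<bullet> \<gamma>)) / \<delta>"
      by (intro tendsto_intros h s ml \<delta>)
    then have "(\<lambda>k. (l1 * l2) ^ k * h \<gamma> k / s k)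
        \<longlonglongrightarrow> (if l1 * l2 = 1 then q12 * (w2 \<bullet> \<gamma>) else 0) / \<delta>"
      by (simp split: if_splits)
    then show ?thesis
      by (rule Lim_transform_eventually) (rule eventually_mono [OF ampV], simp add: that)
  qed
qed

text \<open>The hypothesis \<open>sgn\<close> puts the two points at which the last two blocks of the cycle begin on opposite
sides of the switching manifold. If \<open>w1 \<bullet> \<gamma>\<close> is not zero, both displacements, divided by \<open>l1\<^sup>k\<close>, tend to
nonzero multiples of \<open>z1\<close> with the same sign, which is impossible. Otherwise everything converges and the
sign condition holds in the limit as a weak inequality.\<close>

lemma alternating_fixed_points:
  fixes Q :: "real^'n^'n" and x0 \<gamma> :: "real^'n"
  defines "q12 \<equiv> w1 \<bullet> (Q *v z2)" and "q21 \<equiv> w2 \<bullet> (Q *v z1)"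
  defines "\<delta> \<equiv> if l1 * l2 = 1 then 1 - q12 * q21 else 1"
  defines "a \<equiv> (if l1 * l2 = 1 then q12 * (w2 \<bullet> \<gamma>) else 0) / \<delta>"
  assumes q11: "w1 \<bullet> (Q *v z1) = 0" and m: "l1 * l2 \<le> 1" "l1 * l2 = 1 \<Longrightarrow> q12 * q21 \<noteq> 1"
    and z1j: "z1 $ j \<noteq> 0"
    and V: "eventually (\<lambda>k. V k = matpow P k *v (\<gamma> + Q *v V k)) sequentially"
    and sgn: "eventually (\<lambda>k. (x0 + V k) $ j * (x0 + matpow P (k - 1) *v (\<gamma> + Q *v V k)) $ j < 0) sequentially"
  shows "w1 \<bullet> \<gamma> = 0"
    and "V \<longlonglongrightarrow> a *\<^sub>R z1"
    and "(\<lambda>k. matpow P (k div 2) *v (\<gamma> + Q *v V k)) \<longlonglongrightarrow> 0"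
    and "(x0 $ j + a * z1 $ j) * (x0 $ j + a / l1 * z1 $ j) \<le> 0"
proof -
  define U where "U k = matpow P (k - 1) *v (\<gamma> + Q *v V k)" for k
  have \<delta>: "\<delta> \<noteq> 0" using m by (auto simp: \<delta>_def)
  note sgn = sgn [folded U_def]
  note deg = fixed_points_degenerate(2,3) [OF q11 m [unfolded q12_def q21_def] V,
      folded q12_def q21_def, folded \<delta>_def]
  show w1\<gamma>: "w1 \<bullet> \<gamma> = 0"
  proof (rule ccontr)
    assume ne: "w1 \<bullet> \<gamma> \<noteq> 0"
    define r where "r k = 1 / l1 ^ k" for k
    define B where "B = w1 \<bullet> \<gamma> / \<delta>"
    have r: "r \<longlonglongrightarrow> 0" unfolding r_def by (rule l1_power)
    have "(\<lambda>k. r k * amplitude Q \<gamma> k (V k)) \<longlonglongrightarrow> B"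
      unfolding r_def B_def by (rule deg(1))
    note lim = fixed_point_limits(1,2) [OF V r this, folded U_def]
    have "(\<lambda>k. (r k * x0 $ j + (r k *\<^sub>R V k) $ j) * (r k * x0 $ j + (r k *\<^sub>R U k) $ j))
        \<longlonglongrightarrow> (0 * x0 $ j + (B *\<^sub>R z1) $ j) * (0 * x0 $ j + ((B / l1) *\<^sub>R z1) $ j)"
      by (intro tendsto_intros r lim)
    moreover have "eventually (\<lambda>k. (r k * x0 $ j + (r k *\<^sub>R V k) $ j)
        * (r k * x0 $ j + (r k *\<^sub>R U k) $ j) \<le> 0) sequentially"
      using sgn
    proof eventually_elim
      case (elim k)
      have "(r k * x0 $ j + (r k *\<^sub>R V k) $ j) * (r k * x0 $ j + (r k *\<^sub>R U k) $ j)
          = (r k)\<^sup>2 * ((x0 + V k) $ j * (x0 + U k) $ j)"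
        by (simp add: power2_eq_square algebra_simps)
      then show ?case using elim by (simp add: mult_nonneg_nonpos)
    qed
    ultimately have "(0 * x0 $ j + (B *\<^sub>R z1) $ j) * (0 * x0 $ j + ((B / l1) *\<^sub>R z1) $ j) \<le> 0"
      by (rule tendsto_upperbound) simp
    moreover have "(0 * x0 $ j + (B *\<^sub>R z1) $ j) * (0 * x0 $ j + ((B / l1) *\<^sub>R z1) $ j) = (B * z1 $ j)\<^sup>2 / l1"
      by (simp add: power2_eq_square)
    moreover have "0 < (B * z1 $ j)\<^sup>2 / l1"
      using ne \<delta> z1j l by (simp add: B_def)
    ultimately show False by linarith
  qed
  have "(\<lambda>k. 1 * amplitude Q \<gamma> k (V k)) \<longlonglongrightarrow> a"
    using deg(2) [OF _ w1\<gamma>] by (simp add: a_def)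
  note lim = fixed_point_limits [OF V tendsto_const this, folded U_def, unfolded scaleR_one]
  show "V \<longlonglongrightarrow> a *\<^sub>R z1" and "(\<lambda>k. matpow P (k div 2) *v (\<gamma> + Q *v V k)) \<longlonglongrightarrow> 0"
    using lim(1,3) .
  have "(\<lambda>k. (x0 + V k) $ j * (x0 + U k) $ j) \<longlonglongrightarrow> (x0 + a *\<^sub>R z1) $ j * (x0 + (a / l1) *\<^sub>R z1) $ j"
    by (intro tendsto_intros lim(1,2))
  then have "(x0 + a *\<^sub>R z1) $ j * (x0 + (a / l1) *\<^sub>R z1) $ j \<le> 0"
    by (rule tendsto_upperbound) (use sgn in \<open>auto elim: eventually_mono\<close>)
  then show "(x0 $ j + a * z1 $ j) * (x0 $ j + a / l1 * z1 $ j) \<le> 0" by simp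
qed

text \<open>Modulo \<open>z1\<close>, the images \<open>P\<^sup>k e\<^sub>k\<close> of a convergent sequence tend to zero; here they do not depend on \<open>k\<close>.\<close>

lemma backward_orbit_on_z1:
  assumes y: "\<And>k. y = matpow P k *v e k" and e: "e \<longlonglongrightarrow> e0"
  shows "y = (w1 \<bullet> y) *\<^sub>R z1"
proof -
  have "y - (w1 \<bullet> y) *\<^sub>R z1 = l2 ^ k *\<^sub>R (T k *v e k - (w1 \<bullet> (T k *v e k)) *\<^sub>R z1)" for k
  proof -
    define t where "t = T k *v e k"
    have "y = (l1 ^ k * (w1 \<bullet> e k)) *\<^sub>R z1 + l2 ^ k *\<^sub>R t"
      using y [of k] by (simp add: matpow_mult_vec t_def)
    then show ?thesis
      by (simp add: t_def [symmetric] inner_add_right w1z1 algebra_simps)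
  qed
  moreover have "(\<lambda>k. l2 ^ k *\<^sub>R (T k *v e k - (w1 \<bullet> (T k *v e k)) *\<^sub>R z1))
      \<longlonglongrightarrow> 0 *\<^sub>R ((w2 \<bullet> e0) *\<^sub>R z2 - (w1 \<bullet> ((w2 \<bullet> e0) *\<^sub>R z2)) *\<^sub>R z1)"
    by (intro tendsto_intros l2_power tendsto_T_mult_vec e)
  ultimately have "(\<lambda>k::nat. y - (w1 \<bullet> y) *\<^sub>R z1) \<longlonglongrightarrow> 0" by simp
  then have "y - (w1 \<bullet> y) *\<^sub>R z1 = 0" by (simp add: LIMSEQ_const_iff)
  then show ?thesis by simp
qed

lemma matpow_decay_on_kernel:
  assumes "w1 \<bullet> x = 0" shows "(\<lambda>k. matpow P k *v x) \<longlonglongrightarrow> 0"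
proof -
  have "(\<lambda>k. l2 ^ k *\<^sub>R (T k *v x)) \<longlonglongrightarrow> 0 *\<^sub>R ((w2 \<bullet> x) *\<^sub>R z2)"
    by (intro tendsto_scaleR l2_power tendsto_T_mult_vec tendsto_const)
  then show ?thesis by (simp add: matpow_mult_vec assms)
qed

text \<open>A fixed vector is its own backward orbit, so it is a multiple of \<open>z1\<close>, which is stretched by \<open>l1 > 1\<close>.\<close>

lemma one_not_eigenvalue:
  assumes Pz1: "P *v z1 = l1 *\<^sub>R z1" and v: "P *v v = v"
  shows "v = 0"
proof -
  have "matpow P k *v v = v" for k
    by (induction k) (simp_all add: matrix_vector_mul_assoc [symmetric] v)
  then have "v = matpow P k *v v" for k by simp
  then have v1: "v = (w1 \<bullet> v) *\<^sub>R z1" by (rule backward_orbit_on_z1) (rule tendsto_const)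
  have "(w1 \<bullet> v) *\<^sub>R l1 *\<^sub>R z1 = P *v ((w1 \<bullet> v) *\<^sub>R z1)"
    by (simp add: matrix_vector_mult_scaleR Pz1)
  also have "\<dots> = (w1 \<bullet> v) *\<^sub>R z1" using v v1 by metis
  finally have "((w1 \<bullet> v) * (l1 - 1)) *\<^sub>R z1 = 0"
    by (simp add: algebra_simps)
  then have "(w1 \<bullet> v) * (l1 - 1) = 0 \<or> z1 = 0"
    by (simp only: scaleR_eq_0_iff)
  moreover have "z1 \<noteq> 0" using w1z1 by auto
  ultimately have "w1 \<bullet> v = 0" using l by simp
  then show ?thesis using v1 by simp
qed

context
  fixes F :: "real^'n \<Rightarrow> real^'n" and x0 :: "real^'n"
  assumes F: "\<And>x. F x = x0 + P *v (x - x0)"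
begin

lemma affine_iterate: "(F ^^ k) x = x0 + matpow P k *v (x - x0)"
  by (induction k) (simp_all add: F matrix_vector_mul_assoc)

lemma kernel_subset_stable_manifold: "w1 \<bullet> (x - x0) = 0 \<Longrightarrow> x \<in> stable_manifold F x0"
  using tendsto_add [OF tendsto_const matpow_decay_on_kernel [of "x - x0"], of x0]
  by (simp add: stable_manifold_def affine_iterate)

text \<open>A backward orbit that converges to \<open>x0\<close> starts on the line through \<open>x0\<close> in direction \<open>z1\<close>; conversely
division by \<open>l1\<close> provides backward orbits on this line.\<close>

lemma unstable_manifold_eq:
  assumes Pz1: "P *v z1 = l1 *\<^sub>R z1"
  shows "unstable_manifold F x0 = range (\<lambda>a. x0 + a *\<^sub>R z1)"
proof (intro equalityI subsetI)
  fix x assume "x \<in> unstable_manifold F x0"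
  then obtain u where u: "u 0 = x" "\<And>k. F (u (Suc k)) = u k" "u \<longlonglongrightarrow> x0"
    by (auto simp: unstable_manifold_def)
  have "(F ^^ k) (u k) = x" for k
    by (induction k) (simp_all add: u(1) funpow_swap1 u(2))
  then have "x - x0 = matpow P k *v (u k - x0)" for k
    by (metis add_diff_cancel_left' affine_iterate)
  moreover have "(\<lambda>k. u k - x0) \<longlonglongrightarrow> x0 - x0" by (intro tendsto_intros u)
  ultimately have "x - x0 = (w1 \<bullet> (x - x0)) *\<^sub>R z1" by (rule backward_orbit_on_z1)
  then have "x = x0 + (w1 \<bullet> (x - x0)) *\<^sub>R z1" by (metis add.commute diff_add_cancel)
  then show "x \<in> range (\<lambda>a. x0 + a *\<^sub>R z1)" by (rule range_eqI)
next
  fix x assume "x \<in> range (\<lambda>a. x0 + a *\<^sub>R z1)"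
  then obtain a where x: "x = x0 + a *\<^sub>R z1" by blast
  define u where "u k = x0 + (a * (1 / l1 ^ k)) *\<^sub>R z1" for k
  have "u \<longlonglongrightarrow> x0 + (a * 0) *\<^sub>R z1"
    unfolding u_def by (intro tendsto_intros l1_power)
  moreover have "F (u (Suc k)) = u k" for k
    using l by (simp add: u_def F matrix_vector_mult_scaleR Pz1)
  moreover have "u 0 = x" by (simp add: u_def x)
  ultimately show "x \<in> unstable_manifold F x0" by (auto simp: unstable_manifold_def)
qed

end

end

section \<open>Words, cycles and switching\<close>

lemma word_map_Nil [simp]: "word_map A b [] x = x"
  and word_map_Cons [simp]: "word_map A b (s # Z) x = word_map A b Z (affine_piece A b s x)"
  and word_map_append: "word_map A b (Y @ Z) x = word_map A b Z (word_map A b Y x)"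
  by (simp_all add: word_map_def)

lemma
  fixes A :: "symb \<Rightarrow> real^'n^'n"
  shows word_matrix_Nil [simp]: "word_matrix A [] = mat 1"
  and word_matrix_Cons [simp]: "word_matrix A (s # Z) = word_matrix A Z ** A s"
proof -
  have "fold (\<lambda>s M. A s ** M) Z N = word_matrix A Z ** N" for N :: "real^'n^'n" and Z
  proof (induction Z arbitrary: N)
    case (Cons s Z)
    have "word_matrix A (s # Z) = word_matrix A Z ** A s"
      using Cons.IH [of "A s"] by (simp add: word_matrix_def)
    then show ?case using Cons.IH [of "A s ** N"] by (simp add: matrix_mul_assoc)
  qed (simp add: word_matrix_def)
  from this [of Z "A s"] show "word_matrix A (s # Z) = word_matrix A Z ** A s"
    by (simp add: word_matrix_def)
qed (simp add: word_matrix_def)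

lemma word_matrix_append: "word_matrix A (Y @ Z) = word_matrix A Z ** word_matrix A Y"
  by (induction Y) (simp_all add: matrix_mul_assoc)

lemma word_map_diff: "word_map A b Z x - word_map A b Z y = word_matrix A Z *v (x - y)"
  by (induction Z arbitrary: x y)
    (simp_all add: affine_piece_def matrix_vector_mul_assoc [symmetric] matrix_vector_mult_diff_distrib
      matrix_vector_right_distrib)

lemma word_map_affine: "word_map A b Z x = word_map A b Z y + word_matrix A Z *v (x - y)"
  using word_map_diff [of A b Z x y] by (simp add: algebra_simps)

lemma word_power_Suc: "word_power (Suc k) X = X @ word_power k X"
  and word_power_Suc': "word_power (Suc k) X = word_power k X @ X"
proof -
  show "word_power (Suc k) X = X @ word_power k X" by (simp add: word_power_def)
  have "word_power (Suc k) X = concat (replicate k X @ [X])"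
    by (simp only: word_power_def replicate_Suc replicate_append_same)
  then show "word_power (Suc k) X = word_power k X @ X" by (simp add: word_power_def)
qed

lemma word_power_0 [simp]: "word_power 0 X = []"
  by (simp add: word_power_def)

lemma length_word_power [simp]: "length (word_power k X) = k * length X"
  by (induction k) (simp_all add: word_power_Suc)

lemma word_power_add: "word_power (k + m) X = word_power k X @ word_power m X"
  by (induction k) (simp_all add: word_power_Suc)

lemma word_map_power: "word_map A b (word_power k X) = word_map A b X ^^ k"
  by (induction k) (simp_all add: fun_eq_iff word_power_Suc' word_map_append)

lemma word_matrix_power: "word_matrix A (word_power k X) = matpow (word_matrix A X) k"
  by (induction k) (simp_all add: word_power_Suc' word_matrix_append)

lemma word_map_take_Suc:
  "i < length Z \<Longrightarrow> word_map A b (take (Suc i) Z) x = affine_piece A b (Z ! i) (word_map A b (take i Z) x)"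
  by (simp add: take_Suc_conv_app_nth word_map_append)

lemma cycle_point:
  assumes "is_cycle A b Z xs" "i < length Z"
  shows "xs ! i = word_map A b (take i Z) (xs ! 0)"
  using assms(2)
proof (induction i)
  case (Suc i)
  have "affine_piece A b (Z ! i) (xs ! i) = xs ! (Suc i mod length Z)"
    using assms(1) Suc.prems by (simp add: is_cycle_def)
  with Suc show ?case by (simp add: word_map_take_Suc)
qed simp

lemma cycle_fixed_point:
  assumes "is_cycle A b Z xs" "Z \<noteq> []"
  shows "word_map A b Z (xs ! 0) = xs ! 0"
proof -
  define m where "m = length Z - 1"
  have m: "m < length Z" "Suc m = length Z" using assms(2) by (auto simp: m_def)
  have "affine_piece A b (Z ! m) (xs ! m) = xs ! (Suc m mod length Z)"
    using assms(1) m(1) by (simp add: is_cycle_def)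
  then have "word_map A b (take (Suc m) Z) (xs ! 0) = xs ! 0"
    unfolding word_map_take_Suc [OF m(1)] cycle_point [OF assms(1) m(1)] by (simp add: m(2))
  then show ?thesis by (simp add: m(2))
qed

lemma cycle_of_fixed_point:
  assumes "word_map A b Z x = x"
  shows "is_cycle A b Z (map (\<lambda>i. word_map A b (take i Z) x) [0..<length Z])"
  unfolding is_cycle_def
proof (intro conjI allI impI)
  fix i assume i: "i < length Z"
  show "affine_piece A b (Z ! i) (map (\<lambda>i. word_map A b (take i Z) x) [0..<length Z] ! i)
      = map (\<lambda>i. word_map A b (take i Z) x) [0..<length Z] ! (Suc i mod length Z)"
  proof (cases "Suc i = length Z")
    case True
    then have "affine_piece A b (Z ! i) (word_map A b (take i Z) x) = x"
      using assms unfolding word_map_take_Suc [OF i, symmetric] by simp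
    moreover have "map (\<lambda>i. word_map A b (take i Z) x) [0..<length Z] ! 0 = x"
    proof -
      have "Z \<noteq> []" using i by auto
      then show ?thesis by simp
    qed
    ultimately show ?thesis using i True by simp
  next
    case False
    then have "Suc i < length Z" using i by simp
    then show ?thesis using i by (simp add: word_map_take_Suc)
  qed
qed simp

text \<open>The fixed-point equation is linear with matrix \<open>I - M\<close>, so injectivity of this matrix gives existence
as well as uniqueness.\<close>

lemma unique_fixed_point:
  assumes "\<And>v. word_matrix A Z *v v = v \<Longrightarrow> v = 0"
  shows "\<exists>!x. word_map A b Z x = x"
proof -
  let ?B = "mat 1 - word_matrix A Z"
  have "det ?B \<noteq> 0"
    using assms by (auto simp: det_eq_0_iff_kernel matrix_vector_mult_diff_rdistrib)
  then have "?B ** matrix_inv ?B = mat 1"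
    by (intro matrix_inv_right) (simp add: invertible_det_nz)
  then have "?B *v (matrix_inv ?B *v word_map A b Z 0) = word_map A b Z 0"
    by (simp add: matrix_vector_mul_assoc)
  then obtain x where x: "?B *v x = word_map A b Z 0" by blast
  show ?thesis
  proof (rule ex1I)
    show "word_map A b Z x = x"
      using word_map_affine [of A b Z x 0] x [symmetric] by (simp add: matrix_vector_mult_diff_rdistrib)
    fix y assume "word_map A b Z y = y"
    with \<open>word_map A b Z x = x\<close> have "word_matrix A Z *v (y - x) = y - x"
      using word_map_diff [of A b Z y x] by simp
    then show "y = x" using assms by fastforce
  qed
qed

lemma unique_cycle:
  assumes "Z \<noteq> []" "\<exists>!x. word_map A b Z x = x"
  shows "\<exists>!xs. is_cycle A b Z xs" and "is_cycle A b Z (the_cycle A b Z)"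
proof -
  obtain x where x: "word_map A b Z x = x" using assms(2) by blast
  show ex1: "\<exists>!xs. is_cycle A b Z xs"
  proof (rule ex1I)
    show "is_cycle A b Z (map (\<lambda>i. word_map A b (take i Z) x) [0..<length Z])"
      by (rule cycle_of_fixed_point [OF x])
    fix xs assume xs: "is_cycle A b Z xs"
    then have "xs ! 0 = x" using cycle_fixed_point [OF xs assms(1)] x assms(2) by blast
    then show "xs = map (\<lambda>i. word_map A b (take i Z) x) [0..<length Z]"
      using xs cycle_point [OF xs] by (intro nth_equalityI) (auto simp: is_cycle_def)
  qed
  then show "is_cycle A b Z (the_cycle A b Z)"
    unfolding the_cycle_def by (rule theI')
qed

text \<open>Points on the switching manifold are consistent with both symbols, as in \<open>follows\<close>; this makes the
relation closed under limits.\<close>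

definition consistent :: "real \<Rightarrow> symb \<Rightarrow> bool" where
  "consistent t s \<longleftrightarrow> (t < 0 \<longrightarrow> s = L) \<and> (t > 0 \<longrightarrow> s = R)"

lemma follows_iff: "follows j A b Z x \<longleftrightarrow> (\<forall>i<length Z. consistent ((pwl_map j A b ^^ i) x $ j) (Z ! i))"
  by (simp add: follows_def consistent_def)

locale continuous_pwl =
  fixes A :: "symb \<Rightarrow> real^'n^'n" and b \<xi> :: "real^'n" and j :: 'n
  assumes continuity: "A R = A L + (\<chi> i k. \<xi> $ i * axis j 1 $ k)"
begin

lemma A_R: "A R *v x = A L *v x + (x $ j) *\<^sub>R \<xi>"
proof -
  have "(\<chi> i k. \<xi> $ i * axis j 1 $ k) = outer \<xi> (axis j 1)" by (simp add: outer_def)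
  then show ?thesis
    by (simp add: continuity matrix_vector_mult_add_rdistrib outer_mult_vec_real inner_axis')
qed

lemma pwl_map_consistent: "consistent (x $ j) s \<Longrightarrow> pwl_map j A b x = affine_piece A b s x"
  by (cases s) (auto simp: pwl_map_def consistent_def affine_piece_def A_R)

lemma consistent_orbit:
  assumes "is_cycle A b Z xs" "i < length Z"
    and "\<And>m. m < i \<Longrightarrow> consistent (xs ! m $ j) (Z ! m)"
  shows "(pwl_map j A b ^^ i) (xs ! 0) = xs ! i"
  using assms(2,3)
proof (induction i)
  case (Suc i)
  then have "(pwl_map j A b ^^ i) (xs ! 0) = xs ! i" by simp
  moreover have "pwl_map j A b (xs ! i) = affine_piece A b (Z ! i) (xs ! i)"
    by (rule pwl_map_consistent) (simp add: Suc.prems)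
  moreover have "\<dots> = xs ! Suc i"
    using assms(1) Suc.prems(1) by (simp add: is_cycle_def)
  ultimately show ?case by simp
qed simp

text \<open>Admissibility refers to the orbit of the piecewise-linear map. As long as the points of the cycle are
consistent with their symbols, that orbit runs along the cycle; on the switching manifold this needs the
continuity of the map.\<close>

lemma admissible_iff:
  assumes "is_cycle A b Z xs"
  shows "admissible_cycle j A b Z xs \<longleftrightarrow> (\<forall>i<length Z. consistent (xs ! i $ j) (Z ! i))"
proof
  assume *: "\<forall>i<length Z. consistent (xs ! i $ j) (Z ! i)"
  then have "(pwl_map j A b ^^ i) (xs ! 0) = xs ! i" if "i < length Z" for i
    by (intro consistent_orbit [OF assms that]) (use that in auto)
  with * show "admissible_cycle j A b Z xs"
    by (simp add: admissible_cycle_def follows_iff assms)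
next
  assume *: "admissible_cycle j A b Z xs"
  have "consistent (xs ! i $ j) (Z ! i)" if "i < length Z" for i
    using that
  proof (induction i rule: less_induct)
    case (less i)
    then have "(pwl_map j A b ^^ i) (xs ! 0) = xs ! i"
      by (intro consistent_orbit [OF assms]) auto
    then show ?case using * less.prems by (metis admissible_cycle_def follows_iff)
  qed
  then show "\<forall>i<length Z. consistent (xs ! i $ j) (Z ! i)" by blast
qed

lemma affine_piece_flip:
  "affine_piece A b (flip_symb s) x
    = affine_piece A b s x + (x $ j) *\<^sub>R ((case s of L \<Rightarrow> 1 | R \<Rightarrow> - 1) *\<^sub>R \<xi>)"
  by (cases s) (simp_all add: affine_piece_def A_R)

text \<open>The two pieces differ by a multiple of \<open>\<xi>\<close>, proportional to the coordinate \<open>j\<close> of their argument, and the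
rest of the word transports this difference linearly.\<close>

lemma word_map_flip:
  assumes "i < length Z"
  obtains \<eta> where
    "\<And>x. word_map A b (flip_at i Z) x = word_map A b Z x + (word_map A b (take i Z) x $ j) *\<^sub>R \<eta>"
proof
  let ?\<sigma> = "(case Z ! i of L \<Rightarrow> 1 | R \<Rightarrow> - 1) :: real"
  fix x
  let ?y = "word_map A b (take i Z) x"
  have flip: "flip_at i Z = take i Z @ flip_symb (Z ! i) # drop (Suc i) Z"
    using assms by (simp add: flip_at_def upd_conv_take_nth_drop)
  have Z: "Z = take i Z @ Z ! i # drop (Suc i) Z" using assms by (rule id_take_nth_drop)
  have "word_map A b (flip_at i Z) x = word_map A b (drop (Suc i) Z) (affine_piece A b (Z ! i) ?y)
      + word_matrix A (drop (Suc i) Z) *v ((?y $ j) *\<^sub>R (?\<sigma> *\<^sub>R \<xi>))"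
    by (simp add: flip word_map_append affine_piece_flip
        word_map_affine [of A b _ "_ + _" "affine_piece A b (Z ! i) ?y"])
  also have "word_map A b (drop (Suc i) Z) (affine_piece A b (Z ! i) ?y)
      = word_map A b (take i Z @ Z ! i # drop (Suc i) Z) x"
    by (simp only: word_map_append word_map_Cons)
  also have "take i Z @ Z ! i # drop (Suc i) Z = Z"
    by (rule Z [symmetric])
  finally show "word_map A b (flip_at i Z) x = word_map A b Z x
      + (?y $ j) *\<^sub>R (word_matrix A (drop (Suc i) Z) *v (?\<sigma> *\<^sub>R \<xi>))"
    by (simp add: matrix_vector_mult_scaleR)
qed

lemma word_map_flip_0_on_manifold:
  "Z \<noteq> [] \<Longrightarrow> x $ j = 0 \<Longrightarrow> word_map A b (flip_at 0 Z) x = word_map A b Z x"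
  by (cases Z) (simp_all add: flip_at_def affine_piece_flip)

end

section \<open>Homoclinic orbits and cycles of power words\<close>

lemma div_mod_succ:
  fixes i n :: int
  assumes "0 < n"
  shows "(i + 1) div n = (if i mod n + 1 = n then i div n + 1 else i div n)"
    and "(i + 1) mod n = (if i mod n + 1 = n then 0 else i mod n + 1)"
proof -
  have i: "n * (i div n) + i mod n = i" and r: "0 \<le> i mod n" "i mod n < n" using assms by simp_all
  have "(i + 1) div n = i div n + 1 \<and> (i + 1) mod n = 0" if e: "i mod n + 1 = n"
  proof
    have *: "i + 1 = n * (i div n + 1) + 0" using i e by (simp only: distrib_left mult_1_right)
    show "(i + 1) div n = i div n + 1" by (rule int_div_pos_eq [OF *]) (use assms in auto)
    show "(i + 1) mod n = 0" by (rule int_mod_pos_eq [OF *]) (use assms in auto)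
  qed
  moreover have "(i + 1) div n = i div n \<and> (i + 1) mod n = i mod n + 1" if e: "i mod n + 1 \<noteq> n"
  proof
    have *: "i + 1 = n * (i div n) + (i mod n + 1)" using i by linarith
    show "(i + 1) div n = i div n" by (rule int_div_pos_eq [OF *]) (use r e in auto)
    show "(i + 1) mod n = i mod n + 1" by (rule int_mod_pos_eq [OF *]) (use r e in auto)
  qed
  ultimately show "(i + 1) div n = (if i mod n + 1 = n then i div n + 1 else i div n)"
    and "(i + 1) mod n = (if i mod n + 1 = n then 0 else i mod n + 1)" by auto
qed

lemma periodic_itinerary_step:
  fixes A :: "symb \<Rightarrow> real^'n^'n" and b :: "real^'n" and X :: "symb list" and e :: "int \<Rightarrow> real^'n"
  defines "n \<equiv> int (length X)"
  defines "y \<equiv> \<lambda>i. word_map A b (take (nat (i mod n)) X) (e (i div n))"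
  assumes X: "X \<noteq> []" and e: "word_map A b X (e (i div n)) = e (i div n + 1)"
  shows "y (i + 1) = affine_piece A b (X ! nat (i mod n)) (y i)"
proof -
  have n: "0 < n" using X by (simp add: n_def)
  define r where "r = nat (i mod n)"
  have r: "r < length X" "int r = i mod n" using n by (simp_all add: r_def n_def nat_less_iff)
  have step: "affine_piece A b (X ! r) (y i) = word_map A b (take (Suc r) X) (e (i div n))"
    using r(1) by (simp add: word_map_take_Suc y_def r_def)
  show ?thesis
  proof (cases "i mod n + 1 = n")
    case True
    then have "Suc r = length X" using r by (simp add: n_def)
    then have "affine_piece A b (X ! r) (y i) = e (i div n + 1)" using step e by simp
    then show ?thesis using True n by (simp add: y_def div_mod_succ r_def)
  next
    case False
    have "nat (i mod n + 1) = Suc r" using r(2) by simp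
    then show ?thesis using False n step by (simp add: y_def div_mod_succ r_def)
  qed
qed

lemma filterlim_int_div:
  fixes n :: int
  assumes "0 < n"
  shows "filterlim (\<lambda>i. i div n) at_top at_top" and "filterlim (\<lambda>i. i div n) at_bot at_bot"
proof -
  show "filterlim (\<lambda>i. i div n) at_top at_top"
    unfolding filterlim_at_top
  proof
    fix Z
    have "Z \<le> i div n" if "Z * n \<le> i" for i
      using zdiv_mono1 [OF that assms] assms by simp
    then show "eventually (\<lambda>i. Z \<le> i div n) at_top"
      by (auto simp: eventually_at_top_linorder)
  qed
  show "filterlim (\<lambda>i. i div n) at_bot at_bot"
    unfolding filterlim_at_bot
  proof
    fix Z
    have "i div n \<le> Z" if "i \<le> Z * n" for i
      using zdiv_mono1 [OF that assms] assms by simp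
    then show "eventually (\<lambda>i. i div n \<le> Z) at_bot"
      by (auto simp: eventually_at_bot_linorder)
  qed
qed


text \<open>The bound on the right is one continuous function of \<open>x\<close> for all phases \<open>r\<close>, so it tends to \<open>0\<close> as \<open>x\<close> tends
to \<open>x0\<close> no matter how the phase varies.\<close>

lemma infdist_cycle_bound:
  fixes x x0 :: "real^'n"
  assumes "r < length X"
  shows "infdist (word_map A b (take r X) x) ((\<lambda>r. word_map A b (take r X) x0) ` {..<length X})
    \<le> (\<Sum>r<length X. norm (word_matrix A (take r X) *v (x - x0)))"
proof -
  have "infdist (word_map A b (take r X) x) ((\<lambda>r. word_map A b (take r X) x0) ` {..<length X})
      \<le> dist (word_map A b (take r X) x) (word_map A b (take r X) x0)"
    by (rule infdist_le) (use assms in auto)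
  also have "\<dots> = norm (word_matrix A (take r X) *v (x - x0))"
    by (simp add: dist_norm word_map_diff)
  also have "\<dots> \<le> (\<Sum>r<length X. norm (word_matrix A (take r X) *v (x - x0)))"
    by (rule member_le_sum) (use assms in auto)
  finally show ?thesis .
qed

text \<open>For negative indices the orbit passes through the points \<open>x0 + a l\<^sup>q z\<close> with \<open>q < 0\<close> at the beginning of each block
\<open>X\<close>; at \<open>q = 0\<close> this is \<open>y0\<close>. After the word \<open>Y\<close> it follows the forward iterates of \<open>word_map A b Y y0\<close>.\<close>

lemma homoclinic_orbit_exists:
  fixes x0 z y0 :: "real^'n"
  assumes X: "X \<noteq> []" and fixed: "word_map A b X x0 = x0"
    and z: "word_matrix A X *v z = l *\<^sub>R z" and l: "1 < l" and y0: "y0 = x0 + a *\<^sub>R z"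
    and forward: "(\<lambda>k. (word_map A b X ^^ k) (word_map A b Y y0)) \<longlonglongrightarrow> x0"
  obtains y where "symbolic_orbit A b (homoclinic_seq X Y) y"
    and "homoclinic_to y ((\<lambda>r. word_map A b (take r X) x0) ` {..<length X})"
    and "\<And>i. i < length Y + length X \<Longrightarrow> y (int i) = word_map A b (take i (Y @ X)) y0"
proof -
  define n p where "n = int (length X)" and "p = int (length Y)"
  have n: "0 < n" using X by (simp add: n_def)
  define e where "e q = x0 + (a * l powi q) *\<^sub>R z" for q :: int
  define e' where "e' q = (word_map A b X ^^ nat q) (word_map A b Y y0)" for q :: int
  define orb where "orb e i = word_map A b (take (nat (i mod n)) X) (e (i div n))"
    for e :: "int \<Rightarrow> real^'n" and i
  have Fe: "word_map A b X (e q) = e (q + 1)" for q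
  proof -
    have "word_map A b X (e q) = x0 + word_matrix A X *v (e q - x0)"
      using word_map_affine [of A b X "e q" x0] by (simp add: fixed)
    then show ?thesis using l by (simp add: e_def matrix_vector_mult_scaleR z power_int_add)
  qed
  have Fe': "word_map A b X (e' q) = e' (q + 1)" if "0 \<le> q" for q
    using that by (simp add: e'_def nat_add_distrib)
  define y where "y i = (if i < 0 then orb e i else if i < p then word_map A b (take (nat i) Y) y0
      else orb e' (i - p))" for i
  have step_e: "orb e (i + 1) = affine_piece A b (X ! nat (i mod n)) (orb e i)" for i
    unfolding orb_def n_def by (rule periodic_itinerary_step [OF X]) (rule Fe)
  have step_e': "orb e' (i + 1) = affine_piece A b (X ! nat (i mod n)) (orb e' i)" if "0 \<le> i" for i
    unfolding orb_def n_def
    by (rule periodic_itinerary_step [OF X], rule Fe') (use that n in \<open>simp add: pos_imp_zdiv_nonneg_iff n_def [symmetric]\<close>)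
  have orb0: "orb e 0 = y0" "orb e' 0 = word_map A b Y y0"
    by (simp_all add: orb_def e_def e'_def y0)
  have p0: "0 \<le> p" by (simp add: p_def)
  have step: "y (i + 1) = affine_piece A b (homoclinic_seq X Y i) (y i)" for i
  proof -
    consider "i < -1" | "i = -1" | "0 \<le> i" "i + 1 < p" | "0 \<le> i" "i + 1 = p" | "0 \<le> i" "p \<le> i" by linarith
    then show ?thesis
    proof cases
      case 1
      then show ?thesis by (simp add: y_def step_e homoclinic_seq_def n_def)
    next
      case 2
      have "y 0 = y0"
      proof (cases "p = 0")
        case True
        then show ?thesis by (simp add: y_def orb0) (simp add: p_def)
      next
        case False
        then show ?thesis using p0 by (simp add: y_def)
      qed
      then show ?thesis using 2 step_e [of "-1"] by (simp add: y_def homoclinic_seq_def n_def orb0)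
    next
      case 3
      then have "nat (i + 1) = Suc (nat i)" "nat i < length Y" by (simp_all add: p_def nat_less_iff)
      then show ?thesis using 3 by (simp add: y_def word_map_take_Suc homoclinic_seq_def p_def)
    next
      case 4
      then have *: "Suc (nat i) = length Y" "nat i < length Y" by (auto simp: p_def nat_less_iff)
      have "y (i + 1) = word_map A b (take (Suc (nat i)) Y) y0"
        using 4 by (simp add: y_def orb0 *(1))
      then show ?thesis using 4 *(2) by (simp add: y_def word_map_take_Suc homoclinic_seq_def p_def)
    next
      case 5
      have "y (i + 1) = orb e' ((i - p) + 1)"
        using 5 by (simp add: y_def algebra_simps)
      also have "\<dots> = affine_piece A b (X ! nat ((i - p) mod n)) (orb e' (i - p))"
        by (rule step_e') (use 5 in simp)
      finally show ?thesis using 5 by (simp add: y_def homoclinic_seq_def n_def p_def)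
    qed
  qed
  let ?C = "(\<lambda>r. word_map A b (take r X) x0) ` {..<length X}"
  let ?g = "\<lambda>x. \<Sum>r<length X. norm (word_matrix A (take r X) *v (x - x0))"
  have orb_bound: "infdist (orb e i) ?C \<le> ?g (e (i div n))" for e i
    unfolding orb_def by (rule infdist_cycle_bound) (use n in \<open>simp add: n_def nat_less_iff\<close>)
  have g0: "((\<lambda>i. ?g (f i)) \<longlongrightarrow> 0) F" if "(f \<longlongrightarrow> x0) F" for f :: "int \<Rightarrow> real^'n" and F
  proof -
    have "((\<lambda>i. ?g (f i)) \<longlongrightarrow> ?g x0) F" by (intro tendsto_intros that)
    then show ?thesis by simp
  qed
  have "((\<lambda>i. infdist (y i) ?C) \<longlongrightarrow> 0) at_bot"
  proof (rule tendsto_sandwich [where f = "\<lambda>_. 0" and h = "\<lambda>i. ?g (e (i div n))"])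
    have "filterlim (\<lambda>q::int. nat (- q)) at_top at_bot"
      unfolding filterlim_at_top
    proof
      fix Z :: nat
      show "eventually (\<lambda>q::int. Z \<le> nat (- q)) at_bot"
        unfolding eventually_at_bot_linorder by (rule exI [of _ "- int Z"]) auto
    qed
    moreover have "(\<lambda>k. 1 / l ^ k) \<longlonglongrightarrow> 0"
      using l LIMSEQ_inverse_realpow_zero [of l] by (simp add: inverse_eq_divide)
    ultimately have "((\<lambda>q. 1 / l ^ nat (- q)) \<longlongrightarrow> 0) at_bot"
      by (rule filterlim_compose [rotated])
    then have "((\<lambda>q. l powi q) \<longlongrightarrow> 0) at_bot"
    proof (rule Lim_transform_eventually)
      show "eventually (\<lambda>q. 1 / l ^ nat (- q) = l powi q) at_bot"
        unfolding eventually_at_bot_linorder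
        by (rule exI [of _ "-1"]) (auto simp: power_int_def inverse_eq_divide power_one_over)
    qed
    then have "(e \<longlongrightarrow> x0 + (a * 0) *\<^sub>R z) at_bot"
      unfolding e_def by (intro tendsto_intros)
    then have "(e \<longlongrightarrow> x0) at_bot" by simp
    then have "((\<lambda>i. e (i div n)) \<longlongrightarrow> x0) at_bot"
      by (rule filterlim_compose) (rule filterlim_int_div [OF n])
    then show "((\<lambda>i. ?g (e (i div n))) \<longlongrightarrow> 0) at_bot" by (rule g0)
    show "eventually (\<lambda>i. infdist (y i) ?C \<le> ?g (e (i div n))) at_bot"
      unfolding eventually_at_bot_linorder
      by (rule exI [of _ "-1"]) (use orb_bound in \<open>auto simp: y_def\<close>)
  qed (auto simp: infdist_nonneg)
  moreover have "((\<lambda>i. infdist (y i) ?C) \<longlongrightarrow> 0) at_top"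
  proof (rule tendsto_sandwich [where f = "\<lambda>_. 0" and h = "\<lambda>i. ?g (e' ((i - p) div n))"])
    have "filterlim nat at_top (at_top :: int filter)"
      unfolding filterlim_at_top
    proof
      fix Z :: nat
      show "eventually (\<lambda>q::int. Z \<le> nat q) at_top"
        unfolding eventually_at_top_linorder by (rule exI [of _ "int Z"]) auto
    qed
    then have "(e' \<longlongrightarrow> x0) at_top"
      unfolding e'_def by (rule filterlim_compose [OF forward])
    then have e'_div: "((\<lambda>i. e' (i div n)) \<longlongrightarrow> x0) at_top"
      by (rule filterlim_compose) (rule filterlim_int_div [OF n])
    have shift: "filterlim (\<lambda>i::int. i - p) at_top at_top"
      unfolding filterlim_at_top
    proof
      fix Z :: int
      show "eventually (\<lambda>i. Z \<le> i - p) at_top"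
        unfolding eventually_at_top_linorder by (rule exI [of _ "Z + p"]) auto
    qed
    have "((\<lambda>i. e' ((i - p) div n)) \<longlongrightarrow> x0) at_top"
      by (rule filterlim_compose [OF e'_div shift])
    then show "((\<lambda>i. ?g (e' ((i - p) div n))) \<longlongrightarrow> 0) at_top" by (rule g0)
    show "eventually (\<lambda>i. infdist (y i) ?C \<le> ?g (e' ((i - p) div n))) at_top"
      unfolding eventually_at_top_linorder
      by (rule exI [of _ p]) (use orb_bound p0 in \<open>auto simp: y_def\<close>)
  qed (auto simp: infdist_nonneg)
  moreover have "y (int i) = word_map A b (take i (Y @ X)) y0" if i: "i < length Y + length X" for i
  proof (cases "i < length Y")
    case True
    then show ?thesis by (simp add: y_def p_def)
  next
    case False
    define m where "m = i - length Y"
    have m: "m < length X" "int i - p = int m" using False i by (simp_all add: m_def p_def of_nat_diff)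
    have "int m div n = 0" "int m mod n = int m" using m by (simp_all add: n_def)
    then show ?thesis
      using False m by (simp add: y_def p_def orb_def e'_def word_map_append m_def [symmetric])
  qed
  ultimately show ?thesis
    using that [of y] step by (simp add: symbolic_orbit_def homoclinic_to_def)
qed

lemma flip_at_append: "Y \<noteq> [] \<Longrightarrow> flip_at 0 (Y @ Z) = flip_at 0 Y @ Z"
  by (cases Y) (simp_all add: flip_at_def)

lemma take_flip_at: "0 < i \<Longrightarrow> take i (flip_at 0 Z) = flip_at 0 (take i Z)"
  by (cases Z; cases i) (simp_all add: flip_at_def)

text \<open>The cycle is recovered from the displacement \<open>V\<close> of the point at which \<open>Z\<close> begins: one passage through
\<open>Z\<close> leads to the initial point \<open>x0 + u\<close>, and each further block multiplies the displacement by \<open>P\<close>.\<close>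

lemma power_word_cycle:
  fixes A :: "symb \<Rightarrow> real^'n^'n" and b x0 :: "real^'n" and X Z :: "symb list" and k :: nat
  defines "P \<equiv> word_matrix A X"
  fixes xs :: "(real^'n) list"
  assumes cyc: "is_cycle A b (word_power k X @ Z) xs" and Z: "Z \<noteq> []"
    and fixed: "word_map A b X x0 = x0"
  defines "V \<equiv> xs ! (k * length X) - x0"
  defines "u \<equiv> (word_map A b Z x0 - x0) + word_matrix A Z *v V"
  shows "V = matpow P k *v u"
    and "m < k \<Longrightarrow> r < length X \<Longrightarrow> xs ! (m * length X + r) = word_map A b (take r X) (x0 + matpow P m *v u)"
proof -
  let ?F = "word_map A b X"
  have Fm: "(?F ^^ m) (xs ! 0) = x0 + matpow P m *v (xs ! 0 - x0)" for m
  proof -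
    have "(?F ^^ m) x0 = x0" by (induction m) (simp_all add: fixed)
    then show ?thesis
      using word_map_affine [of A b "word_power m X" "xs ! 0" x0]
      by (simp add: word_map_power word_matrix_power P_def)
  qed
  have kn: "xs ! (k * length X) = (?F ^^ k) (xs ! 0)"
    using cycle_point [OF cyc, of "k * length X"] Z by (simp add: word_map_power)
  have "word_map A b Z (xs ! (k * length X)) = xs ! 0"
    using cycle_fixed_point [OF cyc] Z by (simp add: word_map_append word_map_power kn)
  then have "xs ! 0 - x0 = u"
    using word_map_affine [of A b Z "xs ! (k * length X)" x0] by (simp add: u_def V_def)
  with Fm have Fu: "(?F ^^ m) (xs ! 0) = x0 + matpow P m *v u" for m by simp
  show "V = matpow P k *v u" using kn Fu [of k] by (simp add: V_def)
  assume m: "m < k" and r: "r < length X"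
  obtain d where k: "k = m + Suc d" using m less_iff_Suc_add by auto
  have split: "word_power k X @ Z = word_power m X @ X @ word_power d X @ Z"
    by (simp only: k word_power_add word_power_Suc append_assoc)
  have "Suc m * length X \<le> k * length X" using m by (intro mult_right_mono) auto
  then have "m * length X + r < length (word_power k X @ Z)" using r by simp
  from cycle_point [OF cyc this] show "xs ! (m * length X + r) = word_map A b (take r X) (x0 + matpow P m *v u)"
    unfolding split using r by (simp add: word_map_append word_map_power Fu)
qed

lemma nth_power_word:
  assumes "m < k" "r < length X"
  shows "(word_power k X @ Z) ! (m * length X + r) = X ! r"
    and "m * length X + r < length (word_power k X @ Z)"
proof -
  obtain d where k: "k = m + Suc d" using assms less_iff_Suc_add by auto
  have "word_power k X @ Z = word_power m X @ X @ word_power d X @ Z"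
    by (simp only: k word_power_add word_power_Suc append_assoc)
  then show "(word_power k X @ Z) ! (m * length X + r) = X ! r"
    using assms by (simp add: nth_append)
  have "Suc m * length X \<le> k * length X" using assms by (intro mult_right_mono) auto
  then show "m * length X + r < length (word_power k X @ Z)" using assms by simp
qed

lemma consistent_limit:
  assumes "f \<longlonglongrightarrow> t" "eventually (\<lambda>k. consistent (f k) s) sequentially"
  shows "consistent t s"
proof (cases s)
  case L
  then have "eventually (\<lambda>k. f k \<le> 0) sequentially"
    using assms(2) by (auto simp: consistent_def elim!: eventually_mono)
  then have "t \<le> 0" by (intro tendsto_upperbound [OF assms(1)]) auto
  then show ?thesis using L by (simp add: consistent_def)
next
  case R
  then have "eventually (\<lambda>k. 0 \<le> f k) sequentially"
    using assms(2) by (auto simp: consistent_def elim!: eventually_mono)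
  then have "0 \<le> t" by (intro tendsto_lowerbound [OF assms(1)]) auto
  then show ?thesis using R by (simp add: consistent_def)
qed

section \<open>Stable cycles force a homoclinic connection\<close>

theorem theorem5p2:
  fixes A :: "symb \<Rightarrow> real^'n^'n" and b \<xi> :: "real^'n" and j :: 'n
    and X Y :: "symb list" and \<alpha> :: nat
    and l1 l2 \<beta> c :: real and w1 w2 z1 z2 x0 :: "real^'n"
    and Eu Es :: "(real^'n) set"
  assumes continuity: "A R = A L + (\<chi> i k. \<xi> $ i * axis j 1 $ k)"
    and i: "1 \<le> \<alpha>" "\<alpha> \<le> length X + length Y - 1"
      "X @ Y = flip_at \<alpha> (flip_at 0 (Y @ X))"
    and ii_eigenvalues:
      "complex_of_real l1 \<in> eigenvalues (word_matrix A X)"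
      "complex_of_real l2 \<in> eigenvalues (word_matrix A X)"
      "alg_multiplicity (word_matrix A X) (complex_of_real l1) = 1"
      "alg_multiplicity (word_matrix A X) (complex_of_real l2) = 1"
    and \<beta>_eq: "\<beta> = remaining_modulus (word_matrix A X) l1 l2"
    and ii_order: "0 \<le> \<beta>" "\<beta> < l2" "l2 < 1" "1 < l1"
    and eigenvectors:
      "left_eigenvector (word_matrix A X) l1 w1" "right_eigenvector (word_matrix A X) l1 z1"
      "left_eigenvector (word_matrix A X) l2 w2" "right_eigenvector (word_matrix A X) l2 z2"
      "w1 \<bullet> z1 = 1" "w2 \<bullet> z2 = 1"
    and ii_transversal: "z1 $ j \<noteq> 0"
    and c_eq: "c = det ((vector [w1, w2] :: real^'n^2) ** word_matrix A Y **
                        transpose (vector [z1, z2] :: real^'n^2))"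
    and iii: "c \<notin> {-1, 0}"
    and x0_eq: "x0 = the_cycle A b X ! 0"
    and Eu_eq: "Eu = unstable_manifold (word_map A b X) x0"
    and Es_eq: "Es = stable_manifold (word_map A b X) x0"
    and iv: "\<not> word_map A b (flip_at 0 Y) ` Eu \<subseteq> Es"
    and v: "\<exists>kmin. \<forall>k\<ge>kmin. \<exists>xs.
      admissible_cycle j A b (word_power k X @ Y) xs \<and>
      set xs \<inter> switching_manifold j = {} \<and>
      stable_word A (word_power k X @ Y)"
  shows "(\<exists>!xs. is_cycle A b X xs) \<and>
    admissible_cycle j A b X (the_cycle A b X) \<and>
    x0 \<notin> switching_manifold j \<and>
    (\<exists>y. symbolic_orbit A b (homoclinic_seq X Y) y \<and>
      homoclinic_to y (set (the_cycle A b X)) \<and>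
      Eu \<inter> switching_manifold j = {y 0} \<and>
      y (int \<alpha>) \<in> switching_manifold j \<and>
      (\<lambda>k. the_cycle A b (word_power k X @ flip_at 0 Y) ! (k * length X)) \<longlonglongrightarrow> y 0) \<and>
    l1 * l2 = 1 \<and> l2 \<le> c \<and> c \<le> 1 \<and>
    (\<exists>K. \<forall>k\<ge>K. \<exists>!xs. is_cycle A b (word_power k X @ flip_at 0 Y) xs)"
proof -
  define P Q Q0 where "P = word_matrix A X" and "Q = word_matrix A Y" and "Q0 = word_matrix A (flip_at 0 Y)"
  define F G G0 where "F = word_map A b X" and "G = word_map A b Y" and "G0 = word_map A b (flip_at 0 Y)"
  define n where "n = length X"
  interpret continuous_pwl A b \<xi> j by unfold_locales (rule continuity)
  have Pz: "P *v z1 = l1 *\<^sub>R z1" and wP: "w1 v* P = l1 *\<^sub>R w1" "w2 v* P = l2 *\<^sub>R w2"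
    and z1: "z1 \<noteq> 0"
    using eigenvectors by (auto simp: left_eigenvector_def right_eigenvector_def P_def)
  have w1P: "w1 \<bullet> (P *v x) = l1 * (w1 \<bullet> x)" and w2P: "w2 \<bullet> (P *v x) = l2 * (w2 \<bullet> x)" for x
    by (simp_all add: dot_lmul_matrix [symmetric] wP)
  have X: "X \<noteq> []"
  proof
    assume "X = []"
    then have "z1 = l1 *\<^sub>R z1" using Pz by (simp add: P_def)
    then have "(1 - l1) *\<^sub>R z1 = 0" by (simp add: algebra_simps)
    then show False using z1 ii_order by simp
  qed
  have heads: "X ! 0 = flip_symb ((Y @ X) ! 0)"
  proof -
    have "X ! 0 = (X @ Y) ! 0" using X by (simp add: nth_append)
    also have "\<dots> = flip_at \<alpha> (flip_at 0 (Y @ X)) ! 0" by (rule arg_cong [OF i(3)])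
    also have "\<dots> = flip_symb ((Y @ X) ! 0)" using i(1) X by (simp add: flip_at_def)
    finally show ?thesis .
  qed
  have flip_ne: "flip_symb s \<noteq> s" for s by (cases s) auto
  have Y: "Y \<noteq> []"
  proof
    assume "Y = []"
    then have "flip_symb (X ! 0) = X ! 0" using heads by simp
    then show False using flip_ne by blast
  qed
  \<comment> \<open>The flip at \<open>\<alpha> > 0\<close> leaves index 0 alone, so this is the flip at index 0.\<close>
  have XY0: "X ! 0 \<noteq> Y ! 0"
    using heads Y flip_ne [of "Y ! 0"] by (simp add: nth_append)
  obtain T where pow: "\<And>k. matpow P k = l1 ^ k *\<^sub>R outer z1 w1 + l2 ^ k *\<^sub>R T k"
    and T: "T \<longlonglongrightarrow> outer z2 w2"
    unfolding P_def
    by (rule matpow_splitting [OF ii_eigenvalues, of w1 z1 w2 z2])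
      (use ii_order \<beta>_eq eigenvectors in auto)
  interpret dominant_powers P T l1 l2 z1 w1 z2 w2
    by unfold_locales (use pow T ii_order eigenvectors in auto)

  define q12 q21 where "q12 = w1 \<bullet> (Q *v z2)" and "q21 = w2 \<bullet> (Q *v z1)"
  have entries: "((vector [w1, w2] :: real^'n^2) ** Q ** transpose (vector [z1, z2] :: real^'n^2)) $ s $ t
      = (if s = 1 then w1 else w2) \<bullet> (Q *v (if t = 1 then z1 else z2))" for s t :: 2
  proof -
    have "(M ** Q ** transpose N) $ s $ t = (M $ s) \<bullet> (Q *v (N $ t))" for M N :: "real^'n^2"
      unfolding matrix_mul_assoc [symmetric]
      by (simp add: matrix_matrix_mult_def matrix_vector_mult_def transpose_def inner_vec_def)
    moreover have "(vector [x, y] :: real^'n^2) $ s = (if s = 1 then x else y)" for x y s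
      using exhaust_2 [of s] by auto
    ultimately show ?thesis by simp
  qed
  have c_det: "c = (w1 \<bullet> (Q *v z1)) * (w2 \<bullet> (Q *v z2)) - q12 * q21"
    unfolding c_eq Q_def [symmetric] det_2 entries by (simp add: q12_def q21_def)

  obtain kmin xs where xs: "\<And>k. kmin \<le> k \<Longrightarrow> admissible_cycle j A b (word_power k X @ Y) (xs k)"
    "\<And>k. kmin \<le> k \<Longrightarrow> set (xs k) \<inter> switching_manifold j = {}"
    "\<And>k. kmin \<le> k \<Longrightarrow> stable_word A (word_power k X @ Y)"
    using v by metis
  have ev_kmin: "eventually (\<lambda>k. kmin \<le> k) sequentially" by (rule eventually_ge_at_top)
  have "eventually (\<lambda>k. \<forall>z\<in>eigenvalues (Q ** matpow P k). cmod z \<le> 1) sequentially"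
    using ev_kmin
  proof eventually_elim
    case (elim k)
    from xs(3) [OF this] show ?case
      by (simp add: stable_word_def word_matrix_append word_matrix_power P_def Q_def)
  qed
  note mc = multiplier_constraints [OF this, folded q12_def q21_def]
  have q11: "w1 \<bullet> (Q *v z1) = 0" by (rule mc(1))
  have c: "c = - (q12 * q21)" using c_det q11 by simp
  have m: "l1 * l2 \<le> 1" "l1 * l2 = 1 \<Longrightarrow> q12 * q21 \<noteq> 1" "l1 * l2 = 1 \<Longrightarrow> \<bar>c\<bar> \<le> 1"
    using mc c iii by auto

  have uniqueX: "\<exists>!x. F x = x"
    unfolding F_def by (rule unique_fixed_point) (rule one_not_eigenvalue [OF Pz], simp add: P_def)
  have cycX: "\<exists>!xs. is_cycle A b X xs" "is_cycle A b X (the_cycle A b X)"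
    using unique_cycle [OF X uniqueX [unfolded F_def]] by auto
  have Fx0: "F x0 = x0" unfolding F_def x0_eq by (rule cycle_fixed_point [OF cycX(2) X])
  have cyc_pt: "the_cycle A b X ! r = word_map A b (take r X) x0" if "r < n" for r
    unfolding x0_eq using cycle_point [OF cycX(2)] that by (simp add: n_def)
  have cyc_set: "set (the_cycle A b X) = (\<lambda>r. word_map A b (take r X) x0) ` {..<length X}"
  proof -
    have "length (the_cycle A b X) = length X" using cycX(2) by (simp add: is_cycle_def)
    then have "set (the_cycle A b X) = (\<lambda>r. the_cycle A b X ! r) ` {..<length X}"
      by (auto simp: set_conv_nth)
    also have "\<dots> = (\<lambda>r. word_map A b (take r X) x0) ` {..<length X}"
      by (rule image_cong) (auto simp: cyc_pt n_def)
    finally show ?thesis .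
  qed
  have F: "F x = x0 + P *v (x - x0)" for x
    using word_map_affine [of A b X x x0] Fx0 by (simp add: F_def P_def)
  have Eu: "Eu = range (\<lambda>a. x0 + a *\<^sub>R z1)"
    unfolding Eu_eq F_def [symmetric] by (rule unstable_manifold_eq [OF F Pz])
  have in_Es: "x \<in> Es" if "w1 \<bullet> (x - x0) = 0" for x
    unfolding Es_eq F_def [symmetric] by (rule kernel_subset_stable_manifold [OF F that])
  define \<gamma> where "\<gamma> = G x0 - x0"
  have G: "G x = x0 + (\<gamma> + Q *v (x - x0))" for x
    using word_map_affine [of A b Y x x0] by (simp add: G_def Q_def \<gamma>_def)

  \<comment> \<open>The displacement of the point of the cycle at which \<open>Y\<close> begins.\<close>
  define V where "V k = xs k ! (k * n) - x0" for k
  have cyc: "is_cycle A b (word_power k X @ Y) (xs k)" if "kmin \<le> k" for k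
    using xs(1) [OF that] by (simp add: admissible_cycle_def)
  have Vfix: "V k = matpow P k *v (\<gamma> + Q *v V k)" if "kmin \<le> k" for k
    using power_word_cycle(1) [OF cyc [OF that] Y Fx0 [unfolded F_def]]
    by (simp add: V_def n_def P_def Q_def \<gamma>_def G_def)
  have point: "xs k ! (m * n + r) = word_map A b (take r X) (x0 + matpow P m *v (\<gamma> + Q *v V k))"
    if "kmin \<le> k" "m < k" "r < n" for k m r
    using power_word_cycle(2) [OF cyc [OF that(1)] Y Fx0 [unfolded F_def] that(2)] that(3)
    by (simp add: V_def n_def P_def Q_def \<gamma>_def G_def)
  have sign: "consistent (xs k ! i $ j) ((word_power k X @ Y) ! i)" "xs k ! i $ j \<noteq> 0"
    if "kmin \<le> k" "i < length (word_power k X @ Y)" for k i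
  proof -
    show "consistent (xs k ! i $ j) ((word_power k X @ Y) ! i)"
      using xs(1) [OF that(1)] admissible_iff [OF cyc [OF that(1)]] that(2) by blast
    have "xs k ! i \<in> set (xs k)"
      using cyc [OF that(1)] that(2) by (simp add: is_cycle_def)
    then show "xs k ! i $ j \<noteq> 0"
      using xs(2) [OF that(1)] by (auto simp: switching_manifold_def)
  qed
  have Vev: "eventually (\<lambda>k. V k = matpow P k *v (\<gamma> + Q *v V k)) sequentially"
    using ev_kmin by eventually_elim (rule Vfix)
  have n: "0 < n" using X by (simp add: n_def)
  have last_index: "k * n < length (word_power k X @ Y)" "(word_power k X @ Y) ! (k * n) = Y ! 0" for k
    using Y by (simp_all add: n_def nth_append)
  have sgn: "eventually (\<lambda>k. (x0 + V k) $ j * (x0 + matpow P (k - 1) *v (\<gamma> + Q *v V k)) $ j < 0) sequentially"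
    using ev_kmin eventually_gt_at_top [of 0]
  proof eventually_elim
    case (elim k)
    have v: "x0 + V k = xs k ! (k * n)" by (simp add: V_def)
    have u: "x0 + matpow P (k - 1) *v (\<gamma> + Q *v V k) = xs k ! ((k - 1) * n)"
      using point [OF elim(1), of "k - 1" 0] elim(2) n by simp
    have ui: "(k - 1) * n < length (word_power k X @ Y)" "(word_power k X @ Y) ! ((k - 1) * n) = X ! 0"
      using nth_power_word [of "k - 1" k 0 X Y] elim(2) n by (simp_all add: n_def)
    have "consistent (xs k ! (k * n) $ j) (Y ! 0)" "xs k ! (k * n) $ j \<noteq> 0"
      "consistent (xs k ! ((k - 1) * n) $ j) (X ! 0)" "xs k ! ((k - 1) * n) $ j \<noteq> 0"
      using sign [OF elim(1) last_index(1)] sign [OF elim(1) ui(1)] last_index(2) ui(2) by simp_all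
    then show ?case
      unfolding u v using XY0
      by (cases "X ! 0"; cases "Y ! 0") (auto simp: consistent_def mult_less_0_iff neq_iff)
  qed
  define a where "a = (if l1 * l2 = 1 then q12 * (w2 \<bullet> \<gamma>) else 0) / (if l1 * l2 = 1 then 1 - q12 * q21 else 1)"
  note alt = alternating_fixed_points [OF q11 m(1) _ ii_transversal Vev sgn, folded q12_def q21_def, folded a_def, OF m(2)]
  have w1\<gamma>: "w1 \<bullet> \<gamma> = 0" by (rule alt(1))

  obtain \<eta> where G0: "\<And>x. G0 x = G x + (x $ j) *\<^sub>R \<eta>"
    using word_map_flip [of 0 Y] Y by (auto simp: G0_def G_def)
  define W where "W = flip_at 0 (Y @ X)"
  have W: "W = flip_at 0 Y @ X" using Y by (simp add: W_def flip_at_append)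
  have lenW: "\<alpha> < length W" using i(1,2) X by (simp add: W_def flip_at_def)
  obtain \<theta> where \<theta>_def: "\<And>x. word_map A b (flip_at \<alpha> W) x
      = word_map A b W x + (word_map A b (take \<alpha> W) x $ j) *\<^sub>R \<theta>"
    using word_map_flip [OF lenW] by blast
  have GF: "G (F x) = F (G0 x) + (word_map A b (take \<alpha> W) x $ j) *\<^sub>R \<theta>" for x
  proof -
    have "G (F x) = word_map A b (flip_at \<alpha> W) x"
      unfolding W_def i(3) [symmetric] by (simp add: word_map_append F_def G_def)
    also have "word_map A b (flip_at \<alpha> W) x = word_map A b W x + (word_map A b (take \<alpha> W) x $ j) *\<^sub>R \<theta>"
      by (rule \<theta>_def)
    also have "word_map A b W x = F (G0 x)" by (simp add: W word_map_append F_def G0_def)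
    finally show ?thesis .
  qed
  \<comment> \<open>\<open>G\<close> maps the unstable line into the stable hyperplane.\<close>
  have w1G: "w1 \<bullet> (G (x0 + t *\<^sub>R z1) - x0) = 0" for t
    by (simp add: G inner_add_right matrix_vector_mult_scaleR q11 w1\<gamma>)
  have FEu: "F (x0 + t *\<^sub>R z1) = x0 + (t * l1) *\<^sub>R z1" for t
    by (simp add: F matrix_vector_mult_scaleR Pz)
  \<comment> \<open>By (iv) the correction from the flip at index 0 is not parallel to the stable hyperplane. The flip at \<open>\<alpha>\<close> has to compensate it, so the same is true of its correction.\<close>
  obtain t where "G0 (x0 + t *\<^sub>R z1) \<notin> Es"
    using iv by (auto simp: Eu G0_def [symmetric] image_subset_iff)
  then have t: "w1 \<bullet> (G0 (x0 + t *\<^sub>R z1) - x0) \<noteq> 0" using in_Es by blast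
  have split_GF: "w1 \<bullet> (G (F x) - x0) = l1 * (w1 \<bullet> (G0 x - x0)) + (word_map A b (take \<alpha> W) x $ j) * (w1 \<bullet> \<theta>)" for x
    by (simp add: GF F [of "G0 x"] w1P inner_add_right)
  have split_G0: "w1 \<bullet> (G0 x - x0) = w1 \<bullet> (G x - x0) + x $ j * (w1 \<bullet> \<eta>)" for x
    by (simp add: G0 inner_add_right inner_diff_right)
  have \<eta>: "w1 \<bullet> \<eta> \<noteq> 0" using t by (auto simp: split_G0 w1G)
  have \<theta>: "w1 \<bullet> \<theta> \<noteq> 0"
    using split_GF [of "x0 + t *\<^sub>R z1"] t l by (auto simp: FEu w1G)

  define h where "h = x0 $ j"
  \<comment> \<open>The parameter at which the unstable line meets the switching manifold.\<close>
  define a0 where "a0 = - h / z1 $ j"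
  define y0 where "y0 = x0 + a0 *\<^sub>R z1"
  have y0j: "y0 $ j = 0" using ii_transversal by (simp add: y0_def a0_def h_def)
  have G0y0: "G0 y0 = G y0" by (simp add: G0 y0j)
  have y\<alpha>W: "word_map A b (take \<alpha> W) y0 $ j = 0"
  proof -
    have "w1 \<bullet> (G0 y0 - x0) = 0" unfolding G0y0 unfolding y0_def by (rule w1G)
    moreover have "w1 \<bullet> (G (F y0) - x0) = 0" by (simp add: y0_def FEu w1G)
    ultimately show ?thesis using split_GF [of y0] \<theta> by simp
  qed
  have y\<alpha>: "word_map A b (take \<alpha> (Y @ X)) y0 $ j = 0"
  proof -
    have "take \<alpha> (Y @ X) \<noteq> []" using i(1) Y by auto
    then have e: "word_map A b (flip_at 0 (take \<alpha> (Y @ X))) y0 = word_map A b (take \<alpha> (Y @ X)) y0"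
      by (rule word_map_flip_0_on_manifold) (rule y0j)
    have "take \<alpha> W = flip_at 0 (take \<alpha> (Y @ X))"
      unfolding W_def by (rule take_flip_at) (use i(1) in simp)
    then show ?thesis using y\<alpha>W by (simp only: e)
  qed
  have commute: "G (F y0) = F (G y0)" using GF [of y0] by (simp add: y\<alpha>W G0y0)

  \<comment> \<open>If \<open>x0\<close> were on the switching manifold, the \<open>X\<^sup>k Y\<close>-cycles would pass through it for large \<open>k\<close>.\<close>
  have h0: "h \<noteq> 0"
  proof
    assume "h = 0"
    then have "y0 = x0" by (simp add: y0_def a0_def)
    then have "G x0 = F (G x0)" using commute Fx0 by simp
    then have "P *v \<gamma> = \<gamma>" using F [of "G x0"] by (simp add: \<gamma>_def algebra_simps)
    then have \<gamma>0: "\<gamma> = 0" by (rule one_not_eigenvalue [OF Pz])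
    have "eventually (\<lambda>k. \<forall>v. v = matpow P k *v (Q *v v) \<longrightarrow> v = 0) sequentially"
      by (rule fixed_points_degenerate(1) [OF q11 m(1)]) (use m(2) in \<open>simp add: q12_def q21_def\<close>)
    then have "eventually (\<lambda>k::nat. False) sequentially"
      using ev_kmin
    proof eventually_elim
      case (elim k)
      have "V k = 0" using elim(1) Vfix [OF elim(2)] by (simp add: \<gamma>0)
      then have "xs k ! (k * n) $ j = 0" using \<open>h = 0\<close> by (simp add: V_def h_def)
      then show False using sign(2) [OF elim(2) last_index(1)] by simp
    qed
    then show False by simp
  qed
  have prod: "(h + a * z1 $ j) * (h + a / l1 * z1 $ j) \<le> 0" using alt(4) by (simp add: h_def)
  have l12: "l1 * l2 = 1"
  proof (rule ccontr)
    assume "l1 * l2 \<noteq> 1"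
    then have "a = 0" by (simp add: a_def)
    then have "h * h \<le> 0" using prod by simp
    then show False using h0 by (auto simp: mult_le_0_iff)
  qed
  have c1: "c \<le> 1" "-1 < c" using m(3) [OF l12] iii by auto
  \<comment> \<open>The \<open>w2\<close>-component of \<open>G (F y0) = F (G y0)\<close>.\<close>
  have w2\<gamma>: "w2 \<bullet> \<gamma> = - a0 * q21 * (l1 + 1)"
  proof -
    have "w2 \<bullet> (G (F y0) - x0) = w2 \<bullet> (F (G y0) - x0)" by (simp only: commute)
    then have "w2 \<bullet> \<gamma> + a0 * l1 * q21 = l2 * (w2 \<bullet> \<gamma> + a0 * q21)"
      by (simp add: y0_def FEu G F [of "x0 + _"] w2P inner_add_right matrix_vector_mult_scaleR q21_def
          Pz mult.assoc)
    then have "l1 * (w2 \<bullet> \<gamma> + a0 * l1 * q21) = w2 \<bullet> \<gamma> + a0 * q21"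
      using l12 by (metis mult.assoc mult.left_neutral)
    then have "(l1 - 1) * (w2 \<bullet> \<gamma> + a0 * q21 * (l1 + 1)) = 0"
      by (simp add: algebra_simps)
    then show ?thesis using l by simp
  qed
  \<comment> \<open>The position of the limit of the \<open>X\<^sup>k Y\<close>-cycles on the unstable line, in units of that of \<open>y0\<close>.\<close>
  define \<tau> where "\<tau> = c * (l1 + 1) / (1 + c)"
  have a_\<tau>: "a = a0 * \<tau>"
    by (simp add: a_def l12 w2\<gamma> \<tau>_def c)
  have "\<tau> \<ge> 1"
  proof (rule ccontr)
    assume "\<not> 1 \<le> \<tau>"
    then have \<tau>: "\<tau> < 1" "\<tau> / l1 < 1" using l by (auto simp: divide_less_eq)
    have "a * z1 $ j = - h * \<tau>" using ii_transversal by (simp add: a_\<tau> a0_def)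
    then have "(h + a * z1 $ j) * (h + a / l1 * z1 $ j) = h * h * ((1 - \<tau>) * (1 - \<tau> / l1))"
      by (simp add: algebra_simps)
    moreover have "0 < h * h * ((1 - \<tau>) * (1 - \<tau> / l1))"
    proof (rule mult_pos_pos)
      show "0 < h * h" using h0 not_real_square_gt_zero by blast
      show "0 < (1 - \<tau>) * (1 - \<tau> / l1)" by (rule mult_pos_pos) (use \<tau> in auto)
    qed
    ultimately show False using prod by simp
  qed
  then have "1 + c \<le> c * (l1 + 1)" using c1 by (simp add: \<tau>_def le_divide_eq)
  then have "1 \<le> c * l1" by (simp add: algebra_simps)
  then have "l2 * 1 \<le> l2 * (c * l1)" using l by (intro mult_left_mono) auto
  then have l2c: "l2 \<le> c" using l12 by (simp add: mult.left_commute mult.commute)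

  have admX: "admissible_cycle j A b X (the_cycle A b X)"
    unfolding admissible_iff [OF cycX(2)]
  proof (intro allI impI)
    fix r assume r: "r < length X"
    \<comment> \<open>In the middle of the \<open>X\<^sup>k Y\<close>-cycle the points are close to the \<open>X\<close>-cycle and carry the symbols of \<open>X\<close>.\<close>
    define e where "e k = matpow P (k div 2) *v (\<gamma> + Q *v V k)" for k
    have e: "e \<longlonglongrightarrow> 0" unfolding e_def by (rule alt(3))
    have "(\<lambda>k. word_map A b (take r X) x0 + word_matrix A (take r X) *v e k)
        \<longlonglongrightarrow> word_map A b (take r X) x0 + word_matrix A (take r X) *v 0"
      by (intro tendsto_intros e)
    then have "(\<lambda>k. word_map A b (take r X) (x0 + e k)) \<longlonglongrightarrow> word_map A b (take r X) x0"
      by (simp add: word_map_affine [of A b _ "x0 + _" x0])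
    then have "(\<lambda>k. word_map A b (take r X) (x0 + e k) $ j) \<longlonglongrightarrow> word_map A b (take r X) x0 $ j"
      by (rule tendsto_vec_nth)
    then have "consistent (word_map A b (take r X) x0 $ j) (X ! r)"
    proof (rule consistent_limit)
      show "eventually (\<lambda>k. consistent (word_map A b (take r X) (x0 + e k) $ j) (X ! r)) sequentially"
        using ev_kmin eventually_gt_at_top [of 0]
      proof eventually_elim
        case (elim k)
        have k2: "k div 2 < k" using elim by simp
        show ?case
          using sign(1) [OF elim(1) nth_power_word(2) [OF k2 r]] point [OF elim(1) k2] r
          by (simp add: nth_power_word(1) [OF k2 r] n_def e_def)
      qed
    qed
    then show "consistent (the_cycle A b X ! r $ j) (X ! r)" using cyc_pt r by (simp add: n_def)
  qed

  \<comment> \<open>The nondegeneracy that distinguishes the flipped word from \<open>Y\<close>.\<close>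
  have Q0z1: "w1 \<bullet> (Q0 *v z1) = z1 $ j * (w1 \<bullet> \<eta>)"
  proof -
    have "Q0 *v z1 = G0 (x0 + z1) - G0 x0"
      using word_map_diff [of A b "flip_at 0 Y" "x0 + z1" x0] by (simp add: Q0_def G0_def)
    also have "\<dots> = Q *v z1 + (z1 $ j) *\<^sub>R \<eta>"
      by (simp add: G0 G [of "x0 + z1"] G [of x0] algebra_simps)
    finally show ?thesis by (simp add: inner_add_right q11)
  qed
  have \<eta>Q0: "w1 \<bullet> (Q0 *v z1) \<noteq> 0" using \<eta> ii_transversal by (simp add: Q0z1)
  have Y0: "flip_at 0 Y \<noteq> []" using Y by (simp add: flip_at_def)
  have uniq: "eventually (\<lambda>k. (\<exists>!xs. is_cycle A b (word_power k X @ flip_at 0 Y) xs) \<and>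
      is_cycle A b (word_power k X @ flip_at 0 Y) (the_cycle A b (word_power k X @ flip_at 0 Y))) sequentially"
    using fixed_points_nondegenerate(1) [OF \<eta>Q0]
  proof eventually_elim
    case (elim k)
    have "v = 0" if "word_matrix A (word_power k X @ flip_at 0 Y) *v v = v" for v
    proof -
      have v: "Q0 *v (matpow P k *v v) = v"
        using that by (simp add: word_matrix_append word_matrix_power Q0_def P_def matrix_vector_mul_assoc)
      then have "matpow P k *v v = matpow P k *v (Q0 *v (matpow P k *v v))" by simp
      then have "matpow P k *v v = 0" using elim by blast
      then show ?thesis using v by simp
    qed
    then have "\<exists>!x. word_map A b (word_power k X @ flip_at 0 Y) x = x" by (rule unique_fixed_point)
    moreover have "word_power k X @ flip_at 0 Y \<noteq> []" using Y0 by simp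
    ultimately show ?case by (intro conjI unique_cycle)
  qed
  define V0 where "V0 k = the_cycle A b (word_power k X @ flip_at 0 Y) ! (k * n) - x0" for k
  define \<gamma>0 where "\<gamma>0 = G0 x0 - x0"
  have "eventually (\<lambda>k. V0 k = matpow P k *v (\<gamma>0 + Q0 *v V0 k)) sequentially"
    using uniq
  proof eventually_elim
    case (elim k)
    then show ?case
      using power_word_cycle(1) [OF conjunct2 [OF elim] Y0 Fx0 [unfolded F_def]]
      by (simp add: V0_def n_def P_def Q0_def \<gamma>0_def G0_def)
  qed
  then have "V0 \<longlonglongrightarrow> (- (w1 \<bullet> \<gamma>0) / (w1 \<bullet> (Q0 *v z1))) *\<^sub>R z1"
    by (rule fixed_points_nondegenerate(2) [OF \<eta>Q0])
  moreover have "w1 \<bullet> \<gamma>0 = h * (w1 \<bullet> \<eta>)"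
    using split_G0 [of x0] w1G [of 0] by (simp add: \<gamma>0_def h_def)
  ultimately have "V0 \<longlonglongrightarrow> a0 *\<^sub>R z1" using \<eta> by (simp add: Q0z1 a0_def)
  then have "(\<lambda>k. x0 + V0 k) \<longlonglongrightarrow> x0 + a0 *\<^sub>R z1" by (intro tendsto_intros)
  then have conv: "(\<lambda>k. the_cycle A b (word_power k X @ flip_at 0 Y) ! (k * length X)) \<longlonglongrightarrow> y0"
    by (simp add: V0_def n_def y0_def)

  have forward: "(\<lambda>k. (F ^^ k) (G y0)) \<longlonglongrightarrow> x0"
    using in_Es [of "G y0"] w1G [of a0] by (simp add: Es_eq stable_manifold_def F_def y0_def)
  obtain y where y: "symbolic_orbit A b (homoclinic_seq X Y) y"
    "homoclinic_to y ((\<lambda>r. word_map A b (take r X) x0) ` {..<length X})"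
    "\<And>i. i < length Y + length X \<Longrightarrow> y (int i) = word_map A b (take i (Y @ X)) y0"
    by (rule homoclinic_orbit_exists [OF X Fx0 [unfolded F_def] Pz [unfolded P_def] ii_order(4) y0_def
          forward [unfolded F_def G_def]]) (rule that)
  have yy0: "y 0 = y0" using y(3) [of 0] X by simp
  have Eu_\<Sigma>: "Eu \<inter> switching_manifold j = {y 0}"
  proof -
    have "a' = a0" if "h + a' * z1 $ j = 0" for a'
    proof -
      have "a' * z1 $ j = - h" using that by linarith
      then show ?thesis unfolding a0_def by (intro nonzero_eq_divide_eq [OF ii_transversal, THEN iffD2])
    qed
    then have "x = y0" if x: "x \<in> Eu" "x $ j = 0" for x
    proof -
      obtain a' where a': "x = x0 + a' *\<^sub>R z1" using x(1) unfolding Eu by blast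
      then have "h + a' * z1 $ j = 0" using x(2) by (simp add: h_def)
      then have "a' = a0" by (rule \<open>\<And>a'. h + a' * z1 $ j = 0 \<Longrightarrow> a' = a0\<close>)
      then show ?thesis by (simp only: a' y0_def)
    qed
    moreover have "y0 \<in> Eu" unfolding Eu y0_def by (rule rangeI)
    ultimately show ?thesis
      unfolding yy0 switching_manifold_def using y0j by blast
  qed
  have y\<alpha>_\<Sigma>: "y (int \<alpha>) \<in> switching_manifold j"
  proof -
    have "\<alpha> < length Y + length X" using lenW by (simp add: W_def flip_at_def)
    from y(3) [OF this] show ?thesis using y\<alpha> by (simp only: switching_manifold_def mem_Collect_eq)
  qed
  have "x0 \<notin> switching_manifold j" using h0 by (simp add: switching_manifold_def h_def)
  moreover have "\<exists>K. \<forall>k\<ge>K. \<exists>!xs. is_cycle A b (word_power k X @ flip_at 0 Y) xs"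
    using uniq unfolding eventually_sequentially by blast
  moreover have "\<exists>y. symbolic_orbit A b (homoclinic_seq X Y) y \<and>
      homoclinic_to y (set (the_cycle A b X)) \<and>
      Eu \<inter> switching_manifold j = {y 0} \<and>
      y (int \<alpha>) \<in> switching_manifold j \<and>
      (\<lambda>k. the_cycle A b (word_power k X @ flip_at 0 Y) ! (k * length X)) \<longlonglongrightarrow> y 0"
    by (rule exI [of _ y], intro conjI y(1) y(2) [folded cyc_set] Eu_\<Sigma> y\<alpha>_\<Sigma> conv [folded yy0])
  ultimately show ?thesis
    by (intro conjI cycX(1) admX l12 l2c c1(1))
qed

end
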